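(* Let $\Sigma=(A,G,\alpha,\sigma)$ be a unital discrete twisted C$^*$-dynamical system. Then $M_0A(\Sigma)$ is a unital subalgebra of $L(\Sigma)$. Moreover, $(M_0A(\Sigma),\|\cdot\|_{\rm cb})$ is a Banach algebra, with an isometric conjugation $T\mapsto T^c$ given by $$T^c(g,a)=\sigma(g,g^{-1})^*\,\alpha_g\Big(T_{g^{-1}}\big(\alpha_g^{-1}(a^*\sigma(g,g^{-1})^* )\big)\Big)^*\qquad(g\in G,\ a\in A).$$ The map $T\mapsto M_T$ from $M_0A(\Sigma)$ into $\mathcal{D}(C^*_{\rm r}(\Sigma))$ is a unital injective Banach algebra homomorphism that respects conjugation.
   Context: Conventions: all C$^*$-algebras are unital and homomorphisms between them are unital and $*$-preserving. $\Sigma=(A,G,\alpha,\sigma)$ is a unital discrete twisted C$^*$-dynamical system: $A$ is a C$^*$-algebra with unit $1$, $G$ is a discrete group with identity $e$, $\alpha:G\to \mathrm{Aut}(A)$ and $\sigma:G\times G\to \mathcal{U}(A)$ (the unitary group of $A$) are maps satisfying $\alpha_g\alpha_h=\mathrm{Ad}(\sigma(g,h))\,\alpha_{gh}$, $\sigma(g,h)\sigma(gh,k)=\alpha_g(\sigma(h,k))\sigma(g,hk)$ and $\sigma(g,e)=\sigma(e,g)=1$ for all $g,h,k\in G$. $L(\Sigma)$ is the set of all maps $T:G\times A\to A$ that are linear in the second variable; write $T_g(a)=T(g,a)$. It is a unital algebra with pointwise addition and scalar multiplication, product $(T\times T')(g,a)=T(g,T'(g,a))$ and unit $I(g,a)=a$.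 Reduced crossed product: $C_c(\Sigma)$ is the space $C_c(G,A)$ of finitely supported functions $G\to A$ (with its twisted convolution $*$-algebra structure). $A^\Sigma$ is the (right) Hilbert $A$-module of functions $\xi:G\to A$ with $\sum_g\alpha_g^{-1}(\xi(g)^*\xi(g))$ norm-convergent, with $\langle\xi,\eta\rangle=\sum_g\alpha_g^{-1}(\xi(g)^*\eta(g))$ and $(\xi\cdot a)(g)=\xi(g)\alpha_g(a)$. On $A^\Sigma$ put $(\ell_\Sigma(a)\xi)(h)=a\,\xi(h)$ and $(\lambda_\Sigma(g)\xi)(h)=\alpha_g(\xi(g^{-1}h))\,\sigma(g,g^{-1}h)$, and identify $a\in A$ with $\ell_\Sigma(a)$. For $f\in C_c(\Sigma)$, $\Lambda_\Sigma(f)=\sum_g f(g)\lambda_\Sigma(g)$, and $C^*_{\rm r}(\Sigma)$ is the C$^*$-subalgebra of $\mathcal{L}(A^\Sigma)$ (adjointable operators) obtained as the norm closure of $\Lambda_\Sigma(C_c(\Sigma))$. For $T\in L(\Sigma)$ and $f\in C_c(\Sigma)$, $(T\cdot f)(g)=T_g(f(g))$. $T$ is a (reduced) multiplier of $\Sigma$ if there is a bounded linear map $M_T:C^*_{\rm r}(\Sigma)\to C^*_{\rm r}(\Sigma)$ with $M_T(\Lambda_\Sigma(f))=\Lambda_\Sigma(T\cdot f)$ for all $f\in C_c(\Sigma)$. $M_0A(\Sigma)$ is the set of those multipliers for which $M_T$ is completely bounded, and $\|T\|_{\rm cb}=\|M_T\|_{\rm cb}$. For a C$^*$-algebra $B$,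 $\mathcal{D}(B)$ is the Banach algebra of all completely bounded maps $B\to B$ with composition as product and the completely bounded norm; it carries the isometric conjugation $\Phi\mapsto\Phi^c$, $\Phi^c(b)=(\Phi(b^* ))^*$. *)

theory Defs
  imports "HOL-Analysis.Analysis" "HOL-Library.Function_Algebras"
begin

section \<open>Complex vector spaces and unital algebras\<close>

class scaleC =
  fixes scaleC :: "complex \<Rightarrow> 'a \<Rightarrow> 'a"  (infixr "*\<^sub>C" 75)

class complex_vector = scaleC + ab_group_add +
  assumes scaleC_add_right: "c *\<^sub>C (x + y) = c *\<^sub>C x + c *\<^sub>C y"
    and scaleC_add_left: "(c + d) *\<^sub>C x = c *\<^sub>C x + d *\<^sub>C x"
    and scaleC_scaleC: "c *\<^sub>C (d *\<^sub>C x) = (c * d) *\<^sub>C x"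
    and scaleC_one: "1 *\<^sub>C x = x"

instantiation "fun" :: (type, scaleC) scaleC
begin
definition scaleC_fun :: "complex \<Rightarrow> ('a \<Rightarrow> 'b) \<Rightarrow> 'a \<Rightarrow> 'b"
  where "scaleC_fun c f = (\<lambda>x. c *\<^sub>C f x)"
instance ..
end

instance "fun" :: (type, complex_vector) complex_vector
  by standard
    (simp_all add: fun_eq_iff scaleC_fun_def scaleC_add_right scaleC_add_left
      scaleC_scaleC scaleC_one)

definition csubspace :: "'x::complex_vector set \<Rightarrow> bool"
  where "csubspace S \<longleftrightarrow>
    0 \<in> S \<and> (\<forall>x\<in>S. \<forall>y\<in>S. x + y \<in> S) \<and> (\<forall>c. \<forall>x\<in>S. c *\<^sub>C x \<in> S)"

definition clinear_on :: "'x::complex_vector set \<Rightarrow> ('x \<Rightarrow> 'y::complex_vector) \<Rightarrow> bool"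
  where "clinear_on S f \<longleftrightarrow>
    (\<forall>x\<in>S. \<forall>y\<in>S. f (x + y) = f x + f y) \<and> (\<forall>c. \<forall>x\<in>S. f (c *\<^sub>C x) = c *\<^sub>C f x)"

locale unital_algebra =
  fixes S :: "'x::complex_vector set" and mult :: "'x \<Rightarrow> 'x \<Rightarrow> 'x" and e :: 'x
  assumes subspace: "csubspace S"
    and mult_closed: "x \<in> S \<Longrightarrow> y \<in> S \<Longrightarrow> mult x y \<in> S"
    and mult_assoc: "x \<in> S \<Longrightarrow> y \<in> S \<Longrightarrow> z \<in> S \<Longrightarrow> mult (mult x y) z = mult x (mult y z)"
    and mult_linear_left: "y \<in> S \<Longrightarrow> clinear_on S (\<lambda>x. mult x y)"
    and mult_linear_right: "x \<in> S \<Longrightarrow> clinear_on S (mult x)"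
    and unit_closed: "e \<in> S"
    and unit_left: "x \<in> S \<Longrightarrow> mult e x = x"
    and unit_right: "x \<in> S \<Longrightarrow> mult x e = x"

locale unital_subalgebra = unital_algebra L mult e
  for S :: "'x::complex_vector set" and L mult e +
  assumes sub_subset: "S \<subseteq> L"
    and sub_subspace: "csubspace S"
    and sub_mult: "x \<in> S \<Longrightarrow> y \<in> S \<Longrightarrow> mult x y \<in> S"
    and sub_unit: "e \<in> S"

text \<open>The unit is required to have norm one, except in the zero algebra.\<close>

locale unital_banach_algebra = unital_algebra S mult e
  for S :: "'x::complex_vector set" and mult e +
  fixes nrm :: "'x \<Rightarrow> real"
  assumes nrm_nonneg: "x \<in> S \<Longrightarrow> 0 \<le> nrm x"
    and nrm_eq_0: "x \<in> S \<Longrightarrow> nrm x = 0 \<longleftrightarrow> x = 0"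
    and nrm_scaleC: "x \<in> S \<Longrightarrow> nrm (c *\<^sub>C x) = cmod c * nrm x"
    and nrm_triangle: "x \<in> S \<Longrightarrow> y \<in> S \<Longrightarrow> nrm (x + y) \<le> nrm x + nrm y"
    and nrm_mult: "x \<in> S \<Longrightarrow> y \<in> S \<Longrightarrow> nrm (mult x y) \<le> nrm x * nrm y"
    and nrm_unit: "e \<noteq> 0 \<Longrightarrow> nrm e = 1"
    and nrm_complete:
      "range X \<subseteq> S \<Longrightarrow> \<forall>\<epsilon>>0. \<exists>N. \<forall>m\<ge>N. \<forall>n\<ge>N. nrm (X m - X n) < \<epsilon> \<Longrightarrow>
       \<exists>x\<in>S. (\<lambda>n::nat. nrm (X n - x)) \<longlonglongrightarrow> 0"

text \<open>A conjugation is a conjugate-linear involution that preserves the order of products.\<close>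

locale isometric_conjugation =
  fixes S :: "'x::complex_vector set" and mult :: "'x \<Rightarrow> 'x \<Rightarrow> 'x" and nrm :: "'x \<Rightarrow> real"
    and conj :: "'x \<Rightarrow> 'x"
  assumes conj_closed: "x \<in> S \<Longrightarrow> conj x \<in> S"
    and conj_add: "x \<in> S \<Longrightarrow> y \<in> S \<Longrightarrow> conj (x + y) = conj x + conj y"
    and conj_scaleC: "x \<in> S \<Longrightarrow> conj (c *\<^sub>C x) = cnj c *\<^sub>C conj x"
    and conj_mult: "x \<in> S \<Longrightarrow> y \<in> S \<Longrightarrow> conj (mult x y) = mult (conj x) (conj y)"
    and conj_conj: "x \<in> S \<Longrightarrow> conj (conj x) = x"
    and conj_isometric: "x \<in> S \<Longrightarrow> nrm (conj x) = nrm x"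

locale unital_banach_algebra_hom =
  dom: unital_banach_algebra S mult e nrm + cod: unital_banach_algebra S' mult' e' nrm'
  for S :: "'x::complex_vector set" and mult e nrm
    and S' :: "'y::complex_vector set" and mult' e' nrm' +
  fixes \<phi> :: "'x \<Rightarrow> 'y"
  assumes hom_closed: "x \<in> S \<Longrightarrow> \<phi> x \<in> S'"
    and hom_linear: "clinear_on S \<phi>"
    and hom_mult: "x \<in> S \<Longrightarrow> y \<in> S \<Longrightarrow> \<phi> (mult x y) = mult' (\<phi> x) (\<phi> y)"
    and hom_unit: "\<phi> e = e'"
    and hom_bounded: "\<exists>K. \<forall>x\<in>S. nrm' (\<phi> x) \<le> K * nrm x"


section \<open>Unital C*-algebras and twisted dynamical systems\<close>

text \<open>The superclasses do not include \<open>0 \<noteq> 1\<close>, so the zero algebra is admitted;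
  otherwise \<open>norm 1 = 1\<close> follows from the C*-identity.\<close>

class cstar_algebra = complex_vector + real_normed_algebra + complete_space + monoid_mult +
  fixes star :: "'a \<Rightarrow> 'a"  ("_\<^sup>\<star>" [1000] 999)
  assumes scaleR_scaleC: "r *\<^sub>R x = complex_of_real r *\<^sub>C x"
    and norm_scaleC: "norm (c *\<^sub>C x) = cmod c * norm x"
    and mult_scaleC_left: "(c *\<^sub>C x) * y = c *\<^sub>C (x * y)"
    and mult_scaleC_right: "x * (c *\<^sub>C y) = c *\<^sub>C (x * y)"
    and star_add: "(x + y)\<^sup>\<star> = x\<^sup>\<star> + y\<^sup>\<star>"
    and star_scaleC: "(c *\<^sub>C x)\<^sup>\<star> = cnj c *\<^sub>C x\<^sup>\<star>"
    and star_mult: "(x * y)\<^sup>\<star> = y\<^sup>\<star> * x\<^sup>\<star>"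
    and star_star: "(x\<^sup>\<star>)\<^sup>\<star> = x"
    and cstar_identity: "norm (x\<^sup>\<star> * x) = (norm x)\<^sup>2"

definition unitary :: "'a::cstar_algebra \<Rightarrow> bool"
  where "unitary u \<longleftrightarrow> u\<^sup>\<star> * u = 1 \<and> u * u\<^sup>\<star> = 1"

definition star_automorphism :: "('a::cstar_algebra \<Rightarrow> 'a) \<Rightarrow> bool"
  where "star_automorphism \<phi> \<longleftrightarrow>
    bij \<phi> \<and> clinear_on UNIV \<phi> \<and> (\<forall>x y. \<phi> (x * y) = \<phi> x * \<phi> y) \<and>
    (\<forall>x. \<phi> (x\<^sup>\<star>) = (\<phi> x)\<^sup>\<star>) \<and> \<phi> 1 = 1"

text \<open>The discrete group is a type of class \<^class>\<open>group_add\<close>: it is not assumed commutative, and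
  \<open>g h\<close>, \<open>g\<close> inverse and \<open>e\<close> are written \<open>g + h\<close>, \<open>- g\<close> and \<open>0\<close>.\<close>

locale twisted_system =
  fixes \<alpha> :: "'g::group_add \<Rightarrow> 'a::cstar_algebra \<Rightarrow> 'a" and \<sigma> :: "'g \<Rightarrow> 'g \<Rightarrow> 'a"
  assumes automorphism: "star_automorphism (\<alpha> g)"
    and unitary_cocycle: "unitary (\<sigma> g h)"
    and twisted_action: "\<alpha> g (\<alpha> h a) = \<sigma> g h * \<alpha> (g + h) a * (\<sigma> g h)\<^sup>\<star>"
    and cocycle: "\<sigma> g h * \<sigma> (g + h) k = \<alpha> g (\<sigma> h k) * \<sigma> g (h + k)"
    and normalized_right: "\<sigma> g 0 = 1"
    and normalized_left: "\<sigma> 0 g = 1"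

definition L_Sigma :: "('g \<Rightarrow> 'a::cstar_algebra \<Rightarrow> 'a) set"
  where "L_Sigma = {T. \<forall>g. clinear_on UNIV (T g)}"

definition L_mult ::
    "('g \<Rightarrow> 'a::cstar_algebra \<Rightarrow> 'a) \<Rightarrow> ('g \<Rightarrow> 'a \<Rightarrow> 'a) \<Rightarrow> 'g \<Rightarrow> 'a \<Rightarrow> 'a"
  where "L_mult T T' = (\<lambda>g a. T g (T' g a))"

definition L_unit :: "'g \<Rightarrow> 'a::cstar_algebra \<Rightarrow> 'a"
  where "L_unit = (\<lambda>g a. a)"

definition Cc :: "('g \<Rightarrow> 'a::cstar_algebra) set"
  where "Cc = {f. finite {g. f g \<noteq> 0}}"

definition act :: "('g \<Rightarrow> 'a::cstar_algebra \<Rightarrow> 'a) \<Rightarrow> ('g \<Rightarrow> 'a) \<Rightarrow> 'g \<Rightarrow> 'a"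
  where "act T f = (\<lambda>g. T g (f g))"


section \<open>The Hilbert module and its adjointable operators\<close>

text \<open>Maps that are only defined on a subspace \<open>S\<close> of a type (operators on the Hilbert module, and
  linear maps on an algebra of such operators) are represented by total functions vanishing outside
  \<open>S\<close>. Then equality of maps is equality of functions, and the vector space operations and the
  composition are the pointwise ones and \<open>(\<circ>)\<close>; only the identity has to be cut off.\<close>

definition self_maps :: "'x::zero set \<Rightarrow> ('x \<Rightarrow> 'x) set"
  where "self_maps S = {F. (\<forall>x\<in>S. F x \<in> S) \<and> (\<forall>x. x \<notin> S \<longrightarrow> F x = 0)}"

definition restr :: "'x::zero set \<Rightarrow> ('x \<Rightarrow> 'x) \<Rightarrow> 'x \<Rightarrow> 'x"
  where "restr S F = (\<lambda>x. if x \<in> S then F x else 0)"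

type_synonym ('g, 'a) operator = "('g \<Rightarrow> 'a) \<Rightarrow> ('g \<Rightarrow> 'a)"

context
  fixes \<alpha> :: "'g::group_add \<Rightarrow> 'a::cstar_algebra \<Rightarrow> 'a" and \<sigma> :: "'g \<Rightarrow> 'g \<Rightarrow> 'a"
begin

definition hmod :: "('g \<Rightarrow> 'a) set"
  where "hmod = {\<xi>. (\<lambda>g. inv (\<alpha> g) ((\<xi> g)\<^sup>\<star> * \<xi> g)) summable_on UNIV}"

definition hinner :: "('g \<Rightarrow> 'a) \<Rightarrow> ('g \<Rightarrow> 'a) \<Rightarrow> 'a"
  where "hinner \<xi> \<eta> = (\<Sum>\<^sub>\<infinity>g. inv (\<alpha> g) ((\<xi> g)\<^sup>\<star> * \<eta> g))"

definition hnorm :: "('g \<Rightarrow> 'a) \<Rightarrow> real"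
  where "hnorm \<xi> = sqrt (norm (hinner \<xi> \<xi>))"

definition is_adjoint :: "('g, 'a) operator \<Rightarrow> ('g, 'a) operator \<Rightarrow> bool"
  where "is_adjoint F F' \<longleftrightarrow> (\<forall>\<xi>\<in>hmod. \<forall>\<eta>\<in>hmod. hinner (F \<xi>) \<eta> = hinner \<xi> (F' \<eta>))"

text \<open>Complex linearity, linearity over the coefficient algebra and boundedness are consequences of adjointability.\<close>

definition adjointable :: "('g, 'a) operator set"
  where "adjointable = {F \<in> self_maps hmod. \<exists>F'\<in>self_maps hmod. is_adjoint F F'}"

definition adj :: "('g, 'a) operator \<Rightarrow> ('g, 'a) operator"
  where "adj F = (THE F'. F' \<in> self_maps hmod \<and> is_adjoint F F')"

definition op_norm :: "('g, 'a) operator \<Rightarrow> real"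
  where "op_norm F = Sup {hnorm (F \<xi>) | \<xi>. \<xi> \<in> hmod \<and> hnorm \<xi> \<le> 1}"


section \<open>Completely bounded maps on algebras of adjointable operators\<close>

text \<open>The norm on \<open>n \<times> n\<close> matrices over a C*-algebra \<open>B\<close> of adjointable operators is the operator
  norm for their action on the \<open>n\<close>-fold direct sum of the Hilbert module.
  Only the entries with indices below \<open>n\<close> matter.\<close>

definition hnorm_sum :: "nat \<Rightarrow> (nat \<Rightarrow> 'g \<Rightarrow> 'a) \<Rightarrow> real"
  where "hnorm_sum n \<xi> = sqrt (norm (\<Sum>i<n. hinner (\<xi> i) (\<xi> i)))"

definition matrix_norm :: "nat \<Rightarrow> (nat \<Rightarrow> nat \<Rightarrow> ('g, 'a) operator) \<Rightarrow> real"
  where "matrix_norm n b =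
    Sup {hnorm_sum n (\<lambda>i. \<Sum>j<n. b i j (\<xi> j)) | \<xi>. (\<forall>j<n. \<xi> j \<in> hmod) \<and> hnorm_sum n \<xi> \<le> 1}"

definition matrices :: "nat \<Rightarrow> ('g, 'a) operator set \<Rightarrow> (nat \<Rightarrow> nat \<Rightarrow> ('g, 'a) operator) set"
  where "matrices n B = {b. \<forall>i<n. \<forall>j<n. b i j \<in> B}"

definition completely_bounded ::
    "('g, 'a) operator set \<Rightarrow> (('g, 'a) operator \<Rightarrow> ('g, 'a) operator) \<Rightarrow> bool"
  where "completely_bounded B \<Phi> \<longleftrightarrow>
    (\<exists>K. \<forall>n\<ge>1. \<forall>b\<in>matrices n B. matrix_norm n (\<lambda>i j. \<Phi> (b i j)) \<le> K * matrix_norm n b)"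

definition amplification_norm ::
    "('g, 'a) operator set \<Rightarrow> nat \<Rightarrow> (('g, 'a) operator \<Rightarrow> ('g, 'a) operator) \<Rightarrow> real"
  where "amplification_norm B n \<Phi> =
    Sup {matrix_norm n (\<lambda>i j. \<Phi> (b i j)) | b. b \<in> matrices n B \<and> matrix_norm n b \<le> 1}"

definition cb_norm ::
    "('g, 'a) operator set \<Rightarrow> (('g, 'a) operator \<Rightarrow> ('g, 'a) operator) \<Rightarrow> real"
  where "cb_norm B \<Phi> = (SUP n\<in>{1..}. amplification_norm B n \<Phi>)"

definition cb_maps :: "('g, 'a) operator set \<Rightarrow> (('g, 'a) operator \<Rightarrow> ('g, 'a) operator) set"
  where "cb_maps B = {\<Phi> \<in> self_maps B. clinear_on B \<Phi> \<and> completely_bounded B \<Phi>}"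

definition cb_conj ::
    "('g, 'a) operator set \<Rightarrow> (('g, 'a) operator \<Rightarrow> ('g, 'a) operator)
      \<Rightarrow> ('g, 'a) operator \<Rightarrow> ('g, 'a) operator"
  where "cb_conj B \<Phi> = restr B (\<lambda>b. adj (\<Phi> (adj b)))"


section \<open>The reduced crossed product and its multipliers\<close>

definition ell :: "'a \<Rightarrow> ('g, 'a) operator"
  where "ell a = restr hmod (\<lambda>\<xi> h. a * \<xi> h)"

definition lam :: "'g \<Rightarrow> ('g, 'a) operator"
  where "lam g = restr hmod (\<lambda>\<xi> h. \<alpha> g (\<xi> (- g + h)) * \<sigma> g (- g + h))"

definition Lam :: "('g \<Rightarrow> 'a) \<Rightarrow> ('g, 'a) operator"
  where "Lam f = (\<Sum>g | f g \<noteq> 0. ell (f g) \<circ> lam g)"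

definition Cstar_r :: "('g, 'a) operator set"
  where "Cstar_r = {F \<in> adjointable. \<forall>\<epsilon>>0. \<exists>f\<in>Cc. op_norm (F - Lam f) < \<epsilon>}"

definition is_multiplier_map ::
    "('g \<Rightarrow> 'a \<Rightarrow> 'a) \<Rightarrow> (('g, 'a) operator \<Rightarrow> ('g, 'a) operator) \<Rightarrow> bool"
  where "is_multiplier_map T M \<longleftrightarrow>
    M \<in> self_maps Cstar_r \<and> clinear_on Cstar_r M \<and>
    (\<exists>K. \<forall>x\<in>Cstar_r. op_norm (M x) \<le> K * op_norm x) \<and>
    (\<forall>f\<in>Cc. M (Lam f) = Lam (act T f))"

definition is_multiplier :: "('g \<Rightarrow> 'a \<Rightarrow> 'a) \<Rightarrow> bool"
  where "is_multiplier T \<longleftrightarrow> T \<in> L_Sigma \<and> (\<exists>M. is_multiplier_map T M)"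

definition multiplier_map ::
    "('g \<Rightarrow> 'a \<Rightarrow> 'a) \<Rightarrow> ('g, 'a) operator \<Rightarrow> ('g, 'a) operator"
  where "multiplier_map T = (THE M. is_multiplier_map T M)"

definition M0A :: "('g \<Rightarrow> 'a \<Rightarrow> 'a) set"
  where "M0A = {T. is_multiplier T \<and> completely_bounded Cstar_r (multiplier_map T)}"

definition multiplier_cb_norm :: "('g \<Rightarrow> 'a \<Rightarrow> 'a) \<Rightarrow> real"
  where "multiplier_cb_norm T = cb_norm Cstar_r (multiplier_map T)"

definition multiplier_conj :: "('g \<Rightarrow> 'a \<Rightarrow> 'a) \<Rightarrow> 'g \<Rightarrow> 'a \<Rightarrow> 'a"
  where "multiplier_conj T = (\<lambda>g a.
    (\<sigma> g (- g))\<^sup>\<star> * (\<alpha> g (T (- g) (inv (\<alpha> g) (a\<^sup>\<star> * (\<sigma> g (- g))\<^sup>\<star>))))\<^sup>\<star>)"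

end

end

theory Submission
  imports Defs
begin

text \<open>Everything rests on two facts about the reduced crossed product \<open>C*_r\<close>. An operator
  \<open>\<Lambda>(f)\<close> determines \<open>f\<close>, since \<open>\<Lambda>(f)\<close> maps the vector supported at the neutral element with value
  \<open>1\<close> to \<open>f\<close>; and the operators \<open>\<Lambda>(f)\<close> are dense. By density a multiplier \<open>T\<close> has only one map
  \<open>M_T\<close>, and to recognise \<open>M_T\<close> it is enough to check \<open>M_T(\<Lambda>(f)) = \<Lambda>(T f)\<close>. So sums, multiples and
  products of multipliers correspond to sums, multiples and compositions of the maps, and
  \<open>T \<mapsto> M_T\<close> is an injective homomorphism. All norm inequalities for multipliers are those of completely
  bounded maps.

  For completeness, a Cauchy sequence of multipliers \<open>T_n\<close> gives maps that converge to a completely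
  bounded \<open>\<Phi>\<close>. Evaluating on functions supported at one point shows that \<open>T_n(g, a)\<close> converges in \<open>A\<close>,
  to \<open>T(g, a)\<close> say, and then \<open>\<Phi>(\<Lambda>(f)) = \<Lambda>(T f)\<close> because \<open>f\<close> has finite support. For the conjugation,
  \<open>\<Lambda>(f)* = \<Lambda>(f*)\<close> with \<open>f*(g) = \<sigma>(g, g\<inverse>)* \<alpha>_g(f(g\<inverse>)*)\<close>, and \<open>T\<^sup>c f = (T f*)*\<close> is the formula in the
  theorem; the norm is preserved because a matrix of operators has the same norm as its conjugate
  transpose.

  These arguments need the theory of adjointable operators on a Hilbert module over an abstract
  C*-algebra. Its base is the order on \<open>A\<close>: \<open>x* x\<close> is positive, positive elements are closed under
  addition, and the norm is monotone on them. Positive elements are taken to be the squares of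
  self-adjoint elements, and everything about them is derived from a square root of \<open>1 - h\<close> for
  \<open>h = h*\<close> of norm at most one, without spectra or states
  (\<open>sqrt_one_minus\<close>, \<open>cpos_add\<close>, \<open>cpos_norm_mono\<close>, \<open>cpos_star_mult\<close>). The inequality of Cauchy and
  Schwarz follows as usual, and the module of the system becomes the space of square-summable
  families in \<open>A\<close> after the change of coordinates \<open>x(g) = \<alpha>_g\<inverse>(\<xi>(g))\<close>. Adjointable operators are bounded
  by a gliding hump argument (\<open>adjoint_pair_bounded_op\<close>), and they are complete in the operator norm
  (\<open>adjoint_pair_limit\<close>); hence so are \<open>C*_r\<close> and the completely bounded maps on it.\<close>

section \<open>Complex vector spaces and maps vanishing outside a subset\<close>

instance cstar_algebra \<subseteq> banach ..

lemma scaleC_zero_left [simp]: "0 *\<^sub>C x = (0::'x::complex_vector)"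
  using scaleC_add_left[of 0 0 x] by simp

lemma scaleC_zero_right [simp]: "c *\<^sub>C 0 = (0::'x::complex_vector)"
  using scaleC_add_right[of c 0 "0::'x"] by simp

lemma scaleC_minus_left: "(- c) *\<^sub>C x = - (c *\<^sub>C (x::'x::complex_vector))"
  using scaleC_add_left[of c "- c" x] by (simp add: eq_neg_iff_add_eq_0 add.commute)

lemma scaleC_minus_right: "c *\<^sub>C (- x) = - (c *\<^sub>C (x::'x::complex_vector))"
  using scaleC_add_right[of c x "- x"] by (simp add: eq_neg_iff_add_eq_0 add.commute)

lemma scaleC_minus_one: "(- 1) *\<^sub>C x = - (x::'x::complex_vector)"
  by (simp add: scaleC_minus_left scaleC_one)

lemma scaleC_diff_right: "c *\<^sub>C (x - y) = c *\<^sub>C x - c *\<^sub>C (y::'x::complex_vector)"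
  using scaleC_add_right[of c x "- y"] by (simp add: scaleC_minus_right)

lemma scaleC_sum_right: "c *\<^sub>C (\<Sum>i\<in>I. f i) = (\<Sum>i\<in>I. c *\<^sub>C (f i :: 'x::complex_vector))"
  by (induction I rule: infinite_finite_induct) (simp_all add: scaleC_add_right)

lemma scaleC_fun_apply [simp]: "(c *\<^sub>C f) x = c *\<^sub>C f x"
  by (simp add: scaleC_fun_def)

lemma sum_fun_apply: "(\<Sum>i\<in>I. f i) x = (\<Sum>i\<in>I. f i x)"
  by (induction I rule: infinite_finite_induct) simp_all

lemma csubspace_0: "csubspace S ==> 0 \<in> S"
  and csubspace_add: "csubspace S ==> x \<in> S ==> y \<in> S ==> x + y \<in> S"
  and csubspace_scaleC: "csubspace S ==> x \<in> S ==> c *\<^sub>C x \<in> S"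
  by (simp_all add: csubspace_def)

lemma csubspace_diff: "csubspace S ==> x \<in> S ==> y \<in> S ==> x - y \<in> S"
  using csubspace_add[of S x "(-1) *\<^sub>C y"] csubspace_scaleC[of S y "-1"]
  by (simp add: scaleC_minus_one)

lemma csubspace_sum: "csubspace S ==> (\<And>i. i \<in> I ==> f i \<in> S) ==> (\<Sum>i\<in>I. f i) \<in> S"
  by (induction I rule: infinite_finite_induct) (auto simp: csubspace_0 csubspace_add)

lemma clinear_on_add: "clinear_on S f ==> x \<in> S ==> y \<in> S ==> f (x + y) = f x + f y"
  and clinear_on_scaleC: "clinear_on S f ==> x \<in> S ==> f (c *\<^sub>C x) = c *\<^sub>C f x"
  by (simp_all add: clinear_on_def)

lemma clinear_on_0: "clinear_on S f ==> 0 \<in> S ==> f 0 = 0"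
  using clinear_on_scaleC[of S f 0 0] by simp

lemma clinear_on_diff: "clinear_on S f ==> csubspace S ==> x \<in> S ==> y \<in> S ==> f (x - y) = f x - f y"
  using clinear_on_add[of S f x "(-1) *\<^sub>C y"] clinear_on_scaleC[of S f y "-1"] csubspace_scaleC[of S y "-1"]
  by (simp add: scaleC_minus_one)

lemma self_maps_closed: "F \<in> self_maps S ==> x \<in> S ==> F x \<in> S"
  and self_maps_outside: "F \<in> self_maps S ==> x \<notin> S ==> F x = 0"
  by (auto simp: self_maps_def)

lemma self_maps_eqI: "F \<in> self_maps S ==> G \<in> self_maps S ==> (\<And>x. x \<in> S ==> F x = G x) ==> F = G"
  by (rule ext) (metis self_maps_outside)

lemma csubspace_self_maps: "csubspace S ==> csubspace (self_maps S)"
  unfolding csubspace_def[of "self_maps S"] 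
  by (auto simp: self_maps_def csubspace_0 csubspace_add csubspace_scaleC)

lemma self_maps_range: "0 \<in> S ==> F \<in> self_maps S ==> F x \<in> S"
  by (cases "x \<in> S") (auto simp: self_maps_def)

lemma restr_self_maps: "(\<And>x. x \<in> S ==> F x \<in> S) ==> restr S F \<in> self_maps S"
  by (auto simp: self_maps_def restr_def)

section \<open>Positive elements of a C*-algebra\<close>

lemma star_one [simp]: "(1::'a::cstar_algebra)\<^sup>\<star> = 1"
  by (metis mult_1_right star_mult star_star)

lemma star_zero [simp]: "(0::'a::cstar_algebra)\<^sup>\<star> = 0"
  using star_scaleC[of 0 "0::'a"] by simp

lemma star_minus: "(- x)\<^sup>\<star> = - ((x::'a::cstar_algebra)\<^sup>\<star>)"
  using star_scaleC[of "-1" x] by (simp add: scaleC_minus_one)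

lemma star_diff: "(x - y)\<^sup>\<star> = x\<^sup>\<star> - (y::'a::cstar_algebra)\<^sup>\<star>"
  using star_add[of x "- y"] by (simp add: star_minus)

lemma star_sum: "(\<Sum>i\<in>I. f i)\<^sup>\<star> = (\<Sum>i\<in>I. (f i :: 'a::cstar_algebra)\<^sup>\<star>)"
  by (induction I rule: infinite_finite_induct) (simp_all add: star_add)

lemma star_scaleR: "(r *\<^sub>R x)\<^sup>\<star> = r *\<^sub>R (x::'a::cstar_algebra)\<^sup>\<star>"
  by (simp add: scaleR_scaleC star_scaleC)

lemma norm_star [simp]: "norm (x\<^sup>\<star>) = norm (x::'a::cstar_algebra)"
proof -
  have "norm x \<le> norm (x\<^sup>\<star>)" for x :: 'a
  proof (cases "norm x = 0")
    case False
    have "norm x * norm x \<le> norm (x\<^sup>\<star>) * norm x"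
      using norm_mult_ineq[of "x\<^sup>\<star>" x] cstar_identity[of x] by (simp add: power2_eq_square)
    then show ?thesis using False by simp
  qed simp
  from this[of x] this[of "x\<^sup>\<star>"] show ?thesis by (simp add: star_star)
qed

lemma norm_mult_star: "norm (x * x\<^sup>\<star>) = (norm (x::'a::cstar_algebra))\<^sup>2"
  using cstar_identity[of "x\<^sup>\<star>"] by (simp add: star_star)

lemma norm_self_adjoint_square: "a\<^sup>\<star> = a ==> norm (a * a) = (norm (a::'a::cstar_algebra))\<^sup>2"
  using cstar_identity[of a] by simp

lemma norm_one_le: "norm (1::'a::cstar_algebra) \<le> 1"
proof (cases "norm (1::'a) = 0")
  case False
  then show ?thesis using cstar_identity[of "1::'a"] by (simp add: power2_eq_square)
qed simp

lemma tendsto_star: "(f \<longlongrightarrow> l) F ==> ((\<lambda>x. (f x)\<^sup>\<star>) \<longlongrightarrow> (l::'a::cstar_algebra)\<^sup>\<star>) F"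
  by (simp only: tendsto_iff dist_norm star_diff[symmetric] norm_star)

text \<open>The limit \<open>y\<close> of this iteration satisfies \<open>y = (h + y\<^sup>2) / 2\<close>, which says that
  \<open>(1 - y)\<^sup>2 = 1 - h\<close>.\<close>

fun half_iter :: "'a::cstar_algebra => nat => 'a"
  where "half_iter h 0 = 0"
  | "half_iter h (Suc n) = (1/2) *\<^sub>R (h + half_iter h n * half_iter h n)"

text \<open>The same iteration for the number \<open>h = 1\<close>. It increases to \<open>1\<close> and majorises the iteration
  for every \<open>h\<close> of norm at most one.\<close>

fun half_iter_real :: "nat => real"
  where "half_iter_real 0 = 0"
  | "half_iter_real (Suc n) = (1 + (half_iter_real n)\<^sup>2) / 2"

lemma half_iter_real_bounds: "0 \<le> half_iter_real n \<and> half_iter_real n \<le> 1"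
  by (induction n) (auto simp: power_le_one)

lemma half_iter_real_mono: "half_iter_real n \<le> half_iter_real (Suc n)"
proof -
  have "0 \<le> (1 - half_iter_real n)\<^sup>2" by simp
  then show ?thesis by (simp add: power2_diff)
qed

lemma half_iter_commute: "z * h = h * z ==> z * half_iter h n = half_iter h n * z"
  by (induction n) (simp_all add: distrib_left distrib_right, metis mult.assoc)

lemma half_iter_norm: "norm h \<le> 1 ==> norm (half_iter h n) \<le> half_iter_real n"
proof (induction n)
  case (Suc n)
  have "norm (h + half_iter h n * half_iter h n) \<le> 1 + (half_iter_real n)\<^sup>2"
    using Suc norm_mult_ineq[of "half_iter h n" "half_iter h n"]
    by (intro order.trans[OF norm_triangle_ineq] add_mono) 
      (auto simp: power2_eq_square half_iter_real_bounds intro!: mult_mono elim!: order.trans)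
  then show ?case by simp
qed simp

text \<open>All iterates commute, so \<open>y\<^sub>n\<^sub>+\<^sub>2 - y\<^sub>n\<^sub>+\<^sub>1 = (y\<^sub>n\<^sub>+\<^sub>1 - y\<^sub>n) (y\<^sub>n\<^sub>+\<^sub>1 + y\<^sub>n) / 2\<close>; the
  numbers satisfy the same identity, and the estimate passes from one step to the next.\<close>

lemma half_iter_step:
  assumes "norm h \<le> 1"
  shows "norm (half_iter h (Suc n) - half_iter h n) \<le> half_iter_real (Suc n) - half_iter_real n"
proof (induction n)
  case 0
  then show ?case using assms by simp
next
  case (Suc n)
  let ?y = "half_iter h" and ?t = half_iter_real
  have c: "?y (Suc n) * ?y n = ?y n * ?y (Suc n)"
    by (rule half_iter_commute) (metis half_iter_commute)
  have "?y (Suc (Suc n)) - ?y (Suc n) = (1/2) *\<^sub>R ((?y (Suc n) - ?y n) * (?y (Suc n) + ?y n))"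
  proof -
    have "(?y (Suc n) - ?y n) * (?y (Suc n) + ?y n) = ?y (Suc n) * ?y (Suc n) - ?y n * ?y n"
      using c by (simp add: algebra_simps del: half_iter.simps)
    then show ?thesis 
      by (subst half_iter.simps(2), subst half_iter.simps(2)[of h n])
        (simp only: scaleR_diff_right[symmetric], simp)
  qed
  also have "norm \<dots> \<le> (1/2) * ((?t (Suc n) - ?t n) * (?t (Suc n) + ?t n))"
  proof -
    have "norm ((?y (Suc n) - ?y n) * (?y (Suc n) + ?y n)) \<le> (?t (Suc n) - ?t n) * (?t (Suc n) + ?t n)"
      by (rule order.trans[OF norm_mult_ineq], rule mult_mono)
        (use Suc half_iter_norm[OF assms] half_iter_real_mono[of n] in
          \<open>auto intro!: order.trans[OF norm_triangle_ineq] add_mono simp del: half_iter.simps half_iter_real.simps\<close>)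
    then show ?thesis by simp
  qed
  also have "\<dots> = ?t (Suc (Suc n)) - ?t (Suc n)"
    by (subst (4) half_iter_real.simps(2), subst (3) half_iter_real.simps(2))
      (simp add: power2_eq_square field_simps del: half_iter_real.simps)
  finally show ?case .
qed

text \<open>The root inherits its properties from the iterates, which are polynomials in \<open>h\<close>. That it
  commutes with everything that commutes with \<open>h\<close> takes the place of the functional calculus
  below.\<close>

lemma sqrt_one_minus:
  fixes h :: "'a::cstar_algebra"
  assumes h: "h\<^sup>\<star> = h" "norm h \<le> 1"
  obtains b where "b\<^sup>\<star> = b" "b * b = 1 - h" "norm (1 - b) \<le> 1" 
    "\<And>z. z * h = h * z ==> z * b = b * z"
proof -
  let ?y = "half_iter h" and ?t = half_iter_real
  have "convergent ?t"
    by (rule Bseq_monoseq_convergent, rule BseqI'[of _ 1])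
      (use half_iter_real_bounds half_iter_real_mono in \<open>auto simp: monoseq_Suc simp del: half_iter_real.simps\<close>)
  then have Ct: "Cauchy ?t" by (rule convergent_Cauchy)
  have step: "norm (?y (n + k) - ?y n) \<le> ?t (n + k) - ?t n" for n k
  proof (induction k)
    case (Suc k)
    have "norm (?y (n + Suc k) - ?y n) \<le> norm (?y (Suc (n + k)) - ?y (n + k)) + norm (?y (n + k) - ?y n)"
      by (metis (no_types) add_Suc_right diff_add_cancel add_diff_eq norm_triangle_ineq)
    then show ?case using Suc half_iter_step[OF h(2), of "n + k"] by simp
  qed simp
  have "Cauchy ?y"
  proof (rule metric_CauchyI)
    fix e :: real assume "0 < e"
    with Ct obtain M where M: "\<And>m n. m \<ge> M ==> n \<ge> M ==> dist (?t m) (?t n) < e"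
      unfolding Cauchy_def by blast
    have *: "dist (?y m) (?y n) < e" if "n \<ge> M" "m \<ge> n" for m n
      using step[of n "m - n"] M[of m n] that by (auto simp: dist_norm abs_less_iff)
    have "dist (?y m) (?y n) < e" if "n \<ge> M" "m \<ge> M" for m n
      using *[of n m] *[of m n] that by (metis dist_commute nle_le)
    then show "\<exists>M. \<forall>m\<ge>M. \<forall>n\<ge>M. dist (?y m) (?y n) < e" by blast
  qed
  then obtain y where y: "?y \<longlonglongrightarrow> y"
    using Cauchy_convergent convergent_def by blast
  have "(\<lambda>n. ?y (Suc n)) \<longlonglongrightarrow> (1/2) *\<^sub>R (h + y * y)"
    unfolding half_iter.simps by (intro tendsto_intros y)
  then have "y = (1/2) *\<^sub>R (h + y * y)"
    using LIMSEQ_unique LIMSEQ_Suc[OF y] by blast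
  then have "2 *\<^sub>R y = 2 *\<^sub>R ((1/2) *\<^sub>R (h + y * y))" by simp
  then have y2: "2 *\<^sub>R y = h + y * y" by simp
  have star: "(?y n)\<^sup>\<star> = ?y n" for n
    by (induction n) (simp_all add: star_add star_mult star_scaleR h)
  show thesis
  proof
    show "(1 - y)\<^sup>\<star> = 1 - y"
    proof -
      have "(\<lambda>n. (?y n)\<^sup>\<star>) \<longlonglongrightarrow> y\<^sup>\<star>" by (rule tendsto_star[OF y])
      then have "y\<^sup>\<star> = y" unfolding star by (rule LIMSEQ_unique[OF _ y])
      then show ?thesis by (simp add: star_diff)
    qed
    show "(1 - y) * (1 - y) = 1 - h"
    proof -
      have "y * y = y + y - h" using y2 by (simp add: scaleR_2 eq_diff_eq add.commute)
      then show ?thesis by (simp add: left_diff_distrib right_diff_distrib)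
    qed
    show "norm (1 - (1 - y)) \<le> 1"
      using half_iter_norm[OF h(2)] half_iter_real_bounds
      by (auto intro!: LIMSEQ_le_const2[OF tendsto_norm[OF y]] intro: order.trans)
    show "z * (1 - y) = (1 - y) * z" if "z * h = h * z" for z
    proof -
      have "(\<lambda>n. ?y n * z) \<longlonglongrightarrow> z * y"
        unfolding half_iter_commute[OF that, symmetric] by (intro tendsto_intros y)
      moreover have "(\<lambda>n. ?y n * z) \<longlonglongrightarrow> y * z" by (intro tendsto_intros y)
      ultimately have "z * y = y * z" by (rule LIMSEQ_unique)
      then show ?thesis by (simp add: left_diff_distrib right_diff_distrib)
    qed
  qed
qed

text \<open>Squares of self-adjoint elements: the positive elements of a C*-algebra, without reference
  to the spectrum.\<close>

definition cpos :: "'a::cstar_algebra => bool"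
  where "cpos x \<longleftrightarrow> (\<exists>b. b\<^sup>\<star> = b \<and> x = b * b)"

lemma cposI: "b\<^sup>\<star> = b ==> x = b * b ==> cpos x"
  by (auto simp: cpos_def)

lemma cpos_self_adjoint: "cpos x ==> x\<^sup>\<star> = x"
  by (auto simp: cpos_def star_mult)

lemma cpos_scaleR: "cpos x ==> 0 \<le> r ==> cpos (r *\<^sub>R x)"
  unfolding cpos_def[of x]
  by (auto intro!: cposI[of "sqrt r *\<^sub>R _"] simp: star_scaleR)

lemma cpos_zero [simp]: "cpos 0" by (rule cposI[of 0]) auto

lemma cpos_one_minus: "h\<^sup>\<star> = h ==> norm h \<le> 1 ==> cpos (1 - h)"
  by (metis cposI sqrt_one_minus)

lemma cpos_scale_minus:
  fixes h :: "'a::cstar_algebra"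
  assumes "h\<^sup>\<star> = h" "norm h \<le> t"
  shows "cpos (t *\<^sub>R 1 - h)"
proof (cases "t = 0")
  case False
  then have t: "0 < t" using assms norm_ge_zero[of h] by linarith
  have "cpos (t *\<^sub>R (1 - (1/t) *\<^sub>R h))"
    by (intro cpos_scaleR cpos_one_minus) (use assms t in \<open>auto simp: star_scaleR\<close>)
  then show ?thesis using t by (simp add: scaleR_diff_right)
qed (use assms in auto)

text \<open>The element \<open>u = b + i c\<close> satisfies \<open>u* u = s\<close>, so its norm is at most \<open>sqrt s\<close>, and \<open>b\<close> is
  its real part.\<close>

lemma norm_le_sqrt_of_sum_squares:
  fixes b c :: "'a::cstar_algebra"
  assumes b: "b\<^sup>\<star> = b" and c: "c\<^sup>\<star> = c" and bc: "b * c = c * b"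
    and s: "b * b + c * c = s *\<^sub>R 1" "0 \<le> s"
  shows "norm b \<le> sqrt s"
proof -
  define u where "u = b + \<i> *\<^sub>C c"
  have us: "u\<^sup>\<star> = b - \<i> *\<^sub>C c"
    by (simp add: u_def star_add star_scaleC b c scaleC_minus_left)
  have "u\<^sup>\<star> * u = b * b + c * c"
    unfolding us unfolding u_def
    by (simp add: algebra_simps mult_scaleC_left mult_scaleC_right scaleC_scaleC bc scaleC_minus_one
        scaleC_diff_right)
  then have "u\<^sup>\<star> * u = s *\<^sub>R 1" using s by simp
  then have "(norm u)\<^sup>2 \<le> s"
    using cstar_identity[of u] s(2) mult_left_le[OF norm_one_le[where 'a='a], of s] by simp
  then have nu: "norm u \<le> sqrt s" by (rule real_le_rsqrt)
  have "u + u\<^sup>\<star> = 2 *\<^sub>R b"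
    unfolding us unfolding u_def by (simp add: scaleR_2)
  then have "2 * norm b = norm (u + u\<^sup>\<star>)" by simp
  also have "\<dots> \<le> 2 * sqrt s" using norm_triangle_ineq[of u "u\<^sup>\<star>"] nu by simp
  finally show ?thesis by simp
qed

text \<open>If \<open>a = b\<^sup>2\<close> and \<open>1 - a = c\<^sup>2\<close> then \<open>b\<^sup>2 + c\<^sup>2 = 1\<close>, which bounds the norm of \<open>c\<close>.
  Conversely an element \<open>a = a*\<close> with \<open>norm (1 - a) \<le> 1\<close> is positive by \<open>cpos_one_minus\<close>; so
  positivity can be tested by norms.\<close>

lemma cpos_norm_one_minus:
  fixes a :: "'a::cstar_algebra"
  assumes "cpos a" "norm a \<le> 1"
  shows "norm (1 - a) \<le> 1"
proof -
  obtain b where b: "b\<^sup>\<star> = b" "a = b * b" using assms by (auto simp: cpos_def)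
  obtain c where c: "c\<^sup>\<star> = c" "c * c = 1 - a" "\<And>z. z * a = a * z ==> z * c = c * z"
    using sqrt_one_minus[OF cpos_self_adjoint[OF assms(1)] assms(2)] by metis
  have bc: "b * c = c * b" by (rule c(3)) (simp add: b mult.assoc)
  have "norm c \<le> sqrt 1"
    by (rule norm_le_sqrt_of_sum_squares[OF c(1) b(1) bc[symmetric]]) (simp_all add: b c(2))
  then show ?thesis using norm_self_adjoint_square[OF c(1)] c(2) by (simp add: power_le_one)
qed

lemma cpos_norm_minus:
  fixes a :: "'a::cstar_algebra"
  assumes "cpos a" "norm a \<le> t"
  shows "norm (t *\<^sub>R 1 - a) \<le> t"
proof (cases "t = 0")
  case False
  then have t: "0 < t" using assms norm_ge_zero[of a] by linarith
  have "norm (1 - (1/t) *\<^sub>R a) \<le> 1"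
    by (intro cpos_norm_one_minus cpos_scaleR) (use assms t in auto)
  then have "norm (t *\<^sub>R (1 - (1/t) *\<^sub>R a)) \<le> t" using t by simp
  then show ?thesis using t by (simp add: scaleR_diff_right)
qed (use assms in auto)

text \<open>The elements \<open>norm a - a\<close> and \<open>norm b - b\<close> have norm at most \<open>norm a\<close> and \<open>norm b\<close>. So for
  \<open>t = norm a + norm b\<close> the element \<open>t - (a + b)\<close> has norm at most \<open>t\<close>, and this characterises
  positivity.\<close>

lemma cpos_add:
  fixes a b :: "'a::cstar_algebra"
  assumes "cpos a" "cpos b"
  shows "cpos (a + b)"
proof -
  define t where "t = norm a + norm b"
  have "norm (t *\<^sub>R 1 - (a + b)) \<le> t"
    using norm_triangle_ineq[of "norm a *\<^sub>R 1 - a" "norm b *\<^sub>R 1 - b"]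
      cpos_norm_minus[OF assms(1) order.refl] cpos_norm_minus[OF assms(2) order.refl]
    by (simp add: t_def scaleR_add_left algebra_simps)
  then have "cpos (t *\<^sub>R 1 - (t *\<^sub>R 1 - (a + b)))"
    by (intro cpos_scale_minus)
      (simp_all add: star_diff star_add star_scaleR cpos_self_adjoint assms)
  then show ?thesis by (simp add: algebra_simps)
qed

lemma cpos_sum: "(\<And>i. i \<in> I ==> cpos (f i)) ==> cpos (\<Sum>i\<in>I. f i)"
  by (induction I rule: infinite_finite_induct) (auto intro: cpos_add)

lemma cpos_sqrt:
  fixes a :: "'a::cstar_algebra"
  assumes "cpos a"
  obtains b where "b\<^sup>\<star> = b" "b * b = a" "cpos b" "\<And>z. z * a = a * z ==> z * b = b * z"
proof (cases "a = 0")
  case True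
  then show thesis using that[of 0] by simp
next
  case False
  define t where "t = norm a"
  have t: "0 < t" using False by (simp add: t_def)
  define h where "h = 1 - (1/t) *\<^sub>R a"
  have sa: "a\<^sup>\<star> = a" by (rule cpos_self_adjoint[OF assms])
  have "norm h \<le> 1" unfolding h_def
    by (intro cpos_norm_one_minus cpos_scaleR) (use assms t in \<open>auto simp: t_def\<close>)
  moreover have "h\<^sup>\<star> = h" by (simp add: h_def star_diff star_scaleR sa)
  ultimately obtain c where c: "c\<^sup>\<star> = c" "c * c = 1 - h" "norm (1 - c) \<le> 1"
    "\<And>z. z * h = h * z ==> z * c = c * z" by (metis sqrt_one_minus)
  show thesis
  proof
    show "(sqrt t *\<^sub>R c)\<^sup>\<star> = sqrt t *\<^sub>R c" by (simp add: star_scaleR c)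
    show "sqrt t *\<^sub>R c * sqrt t *\<^sub>R c = a" using t by (simp add: c(2) h_def)
    have "cpos (1 - (1 - c))"
      by (rule cpos_one_minus) (simp_all add: star_diff c)
    then show "cpos (sqrt t *\<^sub>R c)" using t by (intro cpos_scaleR) auto
    show "z * sqrt t *\<^sub>R c = sqrt t *\<^sub>R c * z" if "z * a = a * z" for z
      using c(4)[of z] that by (simp add: h_def algebra_simps)
  qed
qed

text \<open>Here \<open>p = b\<^sup>2\<close> and \<open>s - p = c\<^sup>2\<close> with commuting roots, so \<open>b\<^sup>2 + c\<^sup>2 = s\<close>.\<close>

lemma norm_le_of_cpos:
  fixes p :: "'a::cstar_algebra"
  assumes p: "cpos p" and q: "cpos (s *\<^sub>R 1 - p)" and s: "0 \<le> s"
  shows "norm p \<le> s"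
proof -
  obtain b where b: "b\<^sup>\<star> = b" "b * b = p" "\<And>z. z * p = p * z ==> z * b = b * z"
    using cpos_sqrt[OF p] by metis
  obtain c where c: "c\<^sup>\<star> = c" "c * c = s *\<^sub>R 1 - p" 
      "\<And>z. z * (s *\<^sub>R 1 - p) = (s *\<^sub>R 1 - p) * z ==> z * c = c * z"
    using cpos_sqrt[OF q] by metis
  have "b * p = p * b" using b(2) by (metis mult.assoc)
  then have bc: "b * c = c * b" by (intro c(3)) (simp add: algebra_simps)
  have "norm b \<le> sqrt s"
    by (rule norm_le_sqrt_of_sum_squares[OF b(1) c(1) bc]) (simp_all add: b c(2) s)
  then have "(norm b)\<^sup>2 \<le> s" using s
    by (metis norm_ge_zero power_mono real_sqrt_pow2)
  then show ?thesis using norm_self_adjoint_square[OF b(1)] b(2) by simp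
qed

lemma cpos_norm_mono:
  fixes p q :: "'a::cstar_algebra"
  assumes p: "cpos p" and q: "cpos (q - p)"
  shows "norm p \<le> norm q"
proof (rule norm_le_of_cpos[OF p])
  have "q\<^sup>\<star> = q" using cpos_self_adjoint[OF cpos_add[OF p q]] by simp
  then have "cpos (norm q *\<^sub>R 1 - q + (q - p))"
    by (intro cpos_add q cpos_scale_minus) simp_all
  then show "cpos (norm q *\<^sub>R 1 - p)" by simp
qed simp

text \<open>The first half of the theorem of Fukamiya and Kaplansky. Usually it is read off from the
  fact that \<open>y* y\<close> and \<open>y y*\<close> have the same non-zero spectrum. Instead, put \<open>z = - y* y\<close> and
  \<open>m = norm z\<close>. Writing \<open>y = h + i k\<close> one finds that \<open>y y* = 2 (h\<^sup>2 + k\<^sup>2) + z\<close> is positive of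
  norm \<open>m\<close>, hence \<open>m - y y*\<close> has norm at most \<open>m\<close>. As \<open>(m - y y*) y = y (m + z)\<close>, this gives
  \<open>norm ((m + z) z (m + z)) \<le> m\<^sup>3\<close>, which would be exceeded for a positive \<open>z\<close> of norm
  \<open>m \<noteq> 0\<close>.\<close>

lemma cpos_neg_star_mult:
  fixes y :: "'a::cstar_algebra"
  assumes neg: "cpos (- (y\<^sup>\<star> * y))"
  shows "y = 0"
proof -
  define m z where "m = (norm y)\<^sup>2" and "z = - (y\<^sup>\<star> * y)"
  have z: "cpos z" "z\<^sup>\<star> = z" using neg cpos_self_adjoint by (auto simp: z_def)
  define h k where "h = (1/2) *\<^sub>R (y + y\<^sup>\<star>)" and "k = (1/2) *\<^sub>R (\<i> *\<^sub>C (y\<^sup>\<star> - y))"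
  have hs: "h\<^sup>\<star> = h" by (simp add: h_def star_add star_scaleR star_star add.commute)
  have ks: "k\<^sup>\<star> = k" by (simp add: k_def star_diff star_scaleR star_scaleC star_star scaleC_minus_left
        flip: scaleC_minus_right)
  have "h * h + k * k = (1/2) *\<^sub>R (y\<^sup>\<star> * y + y * y\<^sup>\<star>)"
  proof -
    have 1: "(y + y\<^sup>\<star>) * (y + y\<^sup>\<star>) - (y\<^sup>\<star> - y) * (y\<^sup>\<star> - y) = 2 *\<^sub>R (y\<^sup>\<star> * y + y * y\<^sup>\<star>)"
      by (simp add: algebra_simps scaleR_2)
    have "h * h = (1/4) *\<^sub>R ((y + y\<^sup>\<star>) * (y + y\<^sup>\<star>))"
      unfolding h_def by simp
    moreover have "k * k = (-1/4) *\<^sub>R ((y\<^sup>\<star> - y) * (y\<^sup>\<star> - y))"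
      unfolding k_def by (simp add: scaleR_scaleC mult_scaleC_left mult_scaleC_right scaleC_scaleC)
    ultimately have "h * h + k * k = (1/4) *\<^sub>R ((y + y\<^sup>\<star>) * (y + y\<^sup>\<star>) - (y\<^sup>\<star> - y) * (y\<^sup>\<star> - y))"
      by (simp add: scaleR_diff_right)
    then show ?thesis unfolding 1 by simp
  qed
  then have "y * y\<^sup>\<star> = 2 *\<^sub>R (h * h + k * k) + z" by (simp add: z_def)
  moreover have "cpos (2 *\<^sub>R (h * h + k * k) + z)"
    using hs ks z(1) by (intro cpos_add cpos_scaleR) (auto intro: cposI)
  ultimately have "cpos (y * y\<^sup>\<star>)" by simp
  then have nm: "norm (m *\<^sub>R 1 - y * y\<^sup>\<star>) \<le> m"
    by (intro cpos_norm_minus) (simp_all add: m_def norm_mult_star)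
  define w where "w = m *\<^sub>R 1 + z"
  have ws: "w\<^sup>\<star> = w" by (simp add: w_def star_add star_scaleR z)
  have "(m *\<^sub>R 1 - y * y\<^sup>\<star>) * y = y * w" by (simp add: w_def z_def algebra_simps mult.assoc)
  then have "norm (y * w) \<le> m * norm y"
    using norm_mult_ineq[of "m *\<^sub>R 1 - y * y\<^sup>\<star>" y] mult_right_mono[OF nm, of "norm y"] by simp
  then have "(norm (y * w))\<^sup>2 \<le> (m * norm y)\<^sup>2" by (rule power_mono) simp
  also have "\<dots> = m^3" by (simp add: power_mult_distrib m_def flip: power_mult power_add)
  finally have "norm ((y * w)\<^sup>\<star> * (y * w)) \<le> m^3" by (simp add: cstar_identity)
  moreover have "(y * w)\<^sup>\<star> * (y * w) = - (w * z * w)" by (simp add: star_mult ws z_def mult.assoc)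
  ultimately have "norm (w * z * w) \<le> m^3" by simp
  moreover have "(w * z * w)\<^sup>\<star> = w * z * w" by (simp add: star_mult ws z mult.assoc)
  ultimately have A: "cpos (m^3 *\<^sub>R 1 - w * z * w)" by (intro cpos_scale_minus) simp_all
  obtain c where c: "c\<^sup>\<star> = c" "z = c * c" using z(1) by (auto simp: cpos_def)
  have B: "cpos (z * z * z)" by (rule cposI[of "c * c * c"]) (simp_all add: c star_mult mult.assoc)
  \<comment> \<open>To exploit \<open>z (m + z)\<^sup>2 \<le> m\<^sup>3\<close> by addition of positive elements only, drop the term
      \<open>z\<^sup>3\<close> and replace \<open>2 m z\<^sup>2\<close> by its tangent at \<open>m / 2\<close>, that is, add \<open>z\<^sup>3\<close> and
      \<open>2 m (z - m / 2)\<^sup>2\<close> to \<open>m\<^sup>3 - z (m + z)\<^sup>2\<close>. What remains is \<open>3 m\<^sup>2 z \<le> 3 m\<^sup>3 / 2\<close>, so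
      the norm of \<open>z\<close> is at most \<open>m / 2\<close>.\<close>
  define v where "v = z - (m/2) *\<^sub>R 1"
  have "v\<^sup>\<star> = v" by (simp add: v_def star_diff star_scaleR z)
  then have C: "cpos ((2 * m) *\<^sub>R (v * v))" by (intro cpos_scaleR) (auto intro: cposI simp: m_def)
  have m0: "0 \<le> m" by (simp add: m_def)
  have "m^3 *\<^sub>R 1 - w * z * w + z * z * z + (2 * m) *\<^sub>R (v * v) = (3/2 * m^3) *\<^sub>R 1 - (3 * m\<^sup>2) *\<^sub>R z"
  proof -
    have A1: "w * z * w = m\<^sup>2 *\<^sub>R z + (2 * m) *\<^sub>R (z * z) + z * z * z"
      by (simp add: w_def algebra_simps scaleR_add_left power2_eq_square)
        (simp only: mult_2_right scaleR_add_left)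
    have A2: "(2 * m) *\<^sub>R (v * v) = (2 * m) *\<^sub>R (z * z) - (2 * m\<^sup>2) *\<^sub>R z + (m^3 / 2) *\<^sub>R 1"
      by (simp add: v_def algebra_simps power2_eq_square power3_eq_cube flip: scaleR_add_left)
    have A3: "m^3 *\<^sub>R (1::'a) + (m^3 / 2) *\<^sub>R 1 = (3/2 * m^3) *\<^sub>R 1"
      by (simp flip: scaleR_add_left)
    have A4: "m\<^sup>2 *\<^sub>R z + (2 * m\<^sup>2) *\<^sub>R z = (3 * m\<^sup>2) *\<^sub>R z"
      by (simp flip: scaleR_add_left)
    show ?thesis unfolding A1 A2 A3[symmetric] A4[symmetric] by (simp add: algebra_simps)
  qed
  then have D: "cpos ((3/2 * m^3) *\<^sub>R 1 - (3 * m\<^sup>2) *\<^sub>R z)"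
    using cpos_add[OF cpos_add[OF A B] C] by simp
  have "norm ((3 * m\<^sup>2) *\<^sub>R z) \<le> 3/2 * m^3"
    by (rule norm_le_of_cpos[OF _ D]) (use z m0 in \<open>auto intro!: cpos_scaleR\<close>)
  moreover have "norm z = m" by (simp add: z_def m_def cstar_identity)
  ultimately have "m^3 \<le> 0" using m0 by (simp add: power2_eq_square power3_eq_cube)
  then have "m = 0" using m0 by (simp add: power_le_zero_eq)
  then show ?thesis by (simp add: m_def)
qed

text \<open>With \<open>a = x* x\<close>, \<open>r = \<bar>a\<bar>\<close> the positive root of \<open>a\<^sup>2\<close> and \<open>n = r - a\<close>, twice the negative
  part of \<open>a\<close>, one has \<open>a n = - r n\<close>. So \<open>(x n)* (x n) = n a n = - n r n\<close> is the negative of a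
  positive element; the previous lemma gives \<open>x n = 0\<close>, whence \<open>n = 0\<close> and \<open>a = r\<close>.\<close>

theorem cpos_star_mult: "cpos (x\<^sup>\<star> * (x::'a::cstar_algebra))"
proof -
  define a where "a = x\<^sup>\<star> * x"
  have sa: "a\<^sup>\<star> = a" by (simp add: a_def star_mult star_star)
  have "cpos (a * a)" using sa by (auto intro: cposI)
  then obtain r where r: "r\<^sup>\<star> = r" "r * r = a * a" "cpos r" "\<And>z. z * (a * a) = a * a * z ==> z * r = r * z"
    by (metis cpos_sqrt)
  have ar: "a * r = r * a" by (rule r(4)) (simp add: mult.assoc)
  obtain c where c: "c\<^sup>\<star> = c" "c * c = r" "\<And>z. z * r = r * z ==> z * c = c * z"
    using cpos_sqrt[OF r(3)] by metis
  have ac: "a * c = c * a" by (rule c(3)[OF ar])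
  have rc: "r * c = c * r" by (rule c(3)) simp
  define n where "n = r - a"
  have ns: "n\<^sup>\<star> = n" by (simp add: n_def star_diff r sa)
  have nc: "n * c = c * n" by (simp add: n_def algebra_simps ac rc)
  have anr: "a * n = - (r * n)" by (simp add: n_def algebra_simps ar r)
  have "(x * n)\<^sup>\<star> * (x * n) = - (n * (r * n))"
  proof -
    have "(x * n)\<^sup>\<star> * (x * n) = n * (a * n)" by (simp add: star_mult ns a_def mult.assoc)
    then show ?thesis by (simp add: anr)
  qed
  moreover have "cpos (n * (r * n))"
  proof (rule cposI)
    show "(c * n)\<^sup>\<star> = c * n" by (simp add: star_mult ns c nc)
    show "n * (r * n) = c * n * (c * n)" by (metis c(2) mult.assoc nc)
  qed
  ultimately have "x * n = 0" by (intro cpos_neg_star_mult) simp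
  then have "a * n = 0" by (simp add: a_def mult.assoc)
  then have rn: "r * n = 0" using anr by simp
  have "n * n = 0" using \<open>a * n = 0\<close> rn by (simp add: n_def algebra_simps)
  then have "n = 0" using norm_self_adjoint_square[OF ns] by simp
  then show ?thesis using r(3) by (simp add: n_def a_def)
qed

lemma cpos_conjugate: "cpos p ==> cpos (b\<^sup>\<star> * p * (b::'a::cstar_algebra))"
proof -
  assume "cpos p"
  then obtain c where c: "c\<^sup>\<star> = c" "p = c * c" by (auto simp: cpos_def)
  show "cpos (b\<^sup>\<star> * p * b)" using cpos_star_mult[of "c * b"] by (simp add: c star_mult mult.assoc)
qed

text \<open>Both conditions \<open>l* = l\<close> and \<open>norm (t - l) \<le> t\<close> are closed; the constant \<open>t\<close> only has to
  exceed the norms of the elements near the limit.\<close>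

lemma cpos_tendsto:
  fixes f :: "'b => 'a::cstar_algebra"
  assumes lim: "(f \<longlongrightarrow> l) F" and F: "F \<noteq> bot" and pos: "\<And>x. cpos (f x)"
  shows "cpos l"
proof -
  define t where "t = norm l + 1"
  have "((\<lambda>x. (f x)\<^sup>\<star>) \<longlongrightarrow> l\<^sup>\<star>) F" by (rule tendsto_star[OF lim])
  then have "(f \<longlongrightarrow> l\<^sup>\<star>) F" unfolding cpos_self_adjoint[OF pos] .
  then have ls: "l\<^sup>\<star> = l" using tendsto_unique[OF F] lim by blast
  have "((\<lambda>x. norm (f x)) \<longlongrightarrow> norm l) F" by (rule tendsto_norm[OF lim])
  then have "\<forall>\<^sub>F x in F. norm (f x) < t" by (rule order_tendstoD) (simp add: t_def)
  then have "\<forall>\<^sub>F x in F. norm (t *\<^sub>R 1 - f x) \<le> t"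
    by eventually_elim (rule cpos_norm_minus[OF pos], simp)
  moreover have "((\<lambda>x. norm (t *\<^sub>R 1 - f x)) \<longlongrightarrow> norm (t *\<^sub>R 1 - l)) F"
    by (intro tendsto_intros lim)
  ultimately have "norm (t *\<^sub>R 1 - l) \<le> t" by (intro tendsto_upperbound[OF _ _ F])
  then have "cpos (t *\<^sub>R 1 - (t *\<^sub>R 1 - l))"
    by (intro cpos_scale_minus) (simp_all add: star_diff star_scaleR ls)
  then show ?thesis by simp
qed

section \<open>Semi-inner-product modules\<close>

text \<open>Definiteness is added in \<open>hilbert_module\<close>: in the \<open>n\<close>-fold direct sums below only the first
  \<open>n\<close> terms of a sequence matter.\<close>

locale semi_hilbert_module =
  fixes H :: "'x::complex_vector set" and ip :: "'x => 'x => 'a::cstar_algebra"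
    and ract :: "'x => 'a => 'x"
  assumes H: "csubspace H"
    and ract_closed: "x \<in> H ==> ract x a \<in> H"
    and ip_add_right: "x \<in> H ==> y \<in> H ==> z \<in> H ==> ip x (y + z) = ip x y + ip x z"
    and ip_scaleC_right: "x \<in> H ==> y \<in> H ==> ip x (c *\<^sub>C y) = c *\<^sub>C ip x y"
    and ip_ract: "x \<in> H ==> y \<in> H ==> ip x (ract y a) = ip x y * a"
    and star_ip: "x \<in> H ==> y \<in> H ==> (ip x y)\<^sup>\<star> = ip y x"
    and cpos_ip: "x \<in> H ==> cpos (ip x x)"
begin

lemmas H_0 = csubspace_0[OF H] and H_add = csubspace_add[OF H] and H_scaleC = csubspace_scaleC[OF H]
  and H_diff = csubspace_diff[OF H] and H_sum = csubspace_sum[OF H]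

lemma ip_diff_right: "x \<in> H ==> y \<in> H ==> z \<in> H ==> ip x (y - z) = ip x y - ip x z"
  using ip_add_right[of x y "(-1) *\<^sub>C z"] ip_scaleC_right[of x z "-1"] H_scaleC[of z "-1"]
  by (simp add: scaleC_minus_one)

lemma ip_add_left: "x \<in> H ==> y \<in> H ==> z \<in> H ==> ip (x + y) z = ip x z + ip y z"
  using arg_cong[OF ip_add_right[of z x y], of star] by (simp add: star_ip star_add H_add)

lemma ip_diff_left: "x \<in> H ==> y \<in> H ==> z \<in> H ==> ip (x - y) z = ip x z - ip y z"
  using arg_cong[OF ip_diff_right[of z x y], of star] by (simp add: star_ip star_diff H_diff)

lemma ip_scaleC_left: "x \<in> H ==> y \<in> H ==> ip (c *\<^sub>C x) y = cnj c *\<^sub>C ip x y"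
  using arg_cong[OF ip_scaleC_right[of y x c], of star] by (simp add: star_ip star_scaleC H_scaleC)

lemma ip_ract_left: "x \<in> H ==> y \<in> H ==> ip (ract x a) y = a\<^sup>\<star> * ip x y"
  using arg_cong[OF ip_ract[of y x a], of star] by (simp add: star_ip star_mult ract_closed)

lemma ip_zero_right: "x \<in> H ==> ip x 0 = 0"
  using ip_scaleC_right[of x 0 0] H_0 by simp

lemma ip_sum_right: "x \<in> H ==> (\<And>i. i \<in> I ==> f i \<in> H) ==> ip x (\<Sum>i\<in>I. f i) = (\<Sum>i\<in>I. ip x (f i))"
  by (induction I rule: infinite_finite_induct) (simp_all add: ip_zero_right ip_add_right H_sum)

lemma ip_zero_left: "x \<in> H ==> ip 0 x = 0"
  using ip_scaleC_left[of 0 x 0] H_0 by simp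

lemma ip_sum_left: "x \<in> H ==> (\<And>i. i \<in> I ==> f i \<in> H) ==> ip (\<Sum>i\<in>I. f i) x = (\<Sum>i\<in>I. ip (f i) x)"
  by (induction I rule: infinite_finite_induct) (simp_all add: ip_zero_left ip_add_left H_sum)

definition hn :: "'x => real"
  where "hn x = sqrt (norm (ip x x))"

lemma hn_nonneg [simp]: "0 \<le> hn x"
  by (simp add: hn_def)

lemma hn_square: "(hn x)\<^sup>2 = norm (ip x x)"
  by (simp add: hn_def)

lemma hn_zero [simp]: "hn 0 = 0"
  by (simp add: hn_def ip_zero_right H_0)

text \<open>Expand \<open>\<langle>x b - y, x b - y\<rangle> \<ge> 0\<close> for \<open>b = \<langle>x, y\<rangle> / s\<close> and use \<open>b* \<langle>x, x\<rangle> b \<le> s b* b\<close>: the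
  result is \<open>\<langle>x, y\<rangle>* \<langle>x, y\<rangle> / s \<le> \<langle>y, y\<rangle>\<close>, and the norm is monotone.\<close>

lemma norm_ip_square_le:
  assumes x: "x \<in> H" and y: "y \<in> H" and s: "norm (ip x x) \<le> s" "0 < s"
  shows "(norm (ip x y))\<^sup>2 \<le> s * norm (ip y y)"
proof -
  define b where "b = (1/s) *\<^sub>R ip x y"
  have sb: "b\<^sup>\<star> = (1/s) *\<^sub>R ip y x" by (simp add: b_def star_scaleR star_ip x y)
  note [simp] = x y ract_closed H_diff
  have "cpos (ip (ract x b - y) (ract x b - y) + b\<^sup>\<star> * (s *\<^sub>R 1 - ip x x) * b)"
    by (intro cpos_add cpos_ip cpos_conjugate cpos_scale_minus) (simp_all add: star_ip s)
  also have "ip (ract x b - y) (ract x b - y) + b\<^sup>\<star> * (s *\<^sub>R 1 - ip x x) * b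
      = ip y y + s *\<^sub>R (b\<^sup>\<star> * b) - b\<^sup>\<star> * ip x y - ip y x * b"
    by (simp add: ip_diff_right ip_diff_left ip_ract ip_ract_left algebra_simps)
  also have "\<dots> = ip y y - (1/s) *\<^sub>R (ip y x * ip x y)"
    using s by (simp add: sb)
  finally have c: "cpos (ip y y - (1/s) *\<^sub>R (ip y x * ip x y))" .
  have "ip y x = (ip x y)\<^sup>\<star>" by (simp add: star_ip)
  then have "norm ((1/s) *\<^sub>R ((ip x y)\<^sup>\<star> * ip x y)) \<le> norm (ip y y)"
    using c s by (intro cpos_norm_mono cpos_scaleR cpos_star_mult) auto
  then show ?thesis using s by (simp add: cstar_identity field_simps)
qed

theorem Cauchy_Schwarz:
  assumes x: "x \<in> H" and y: "y \<in> H"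
  shows "norm (ip x y) \<le> hn x * hn y"
proof -
  let ?X = "norm (ip x x)" and ?Y = "norm (ip y y)"
  \<comment> \<open>The vector \<open>x\<close> may have norm zero, hence the detour through a positive \<open>e\<close>.\<close>
  have *: "(norm (ip x y))\<^sup>2 \<le> (?X + e) * ?Y" if "0 < e" for e
    by (rule norm_ip_square_le[OF x y]) (use that norm_ge_zero[of "ip x x"] in linarith)+
  have "((\<lambda>e. (?X + e) * ?Y) \<longlongrightarrow> (?X + 0) * ?Y) (at_right 0)"
    by (intro tendsto_intros)
  then have "(norm (ip x y))\<^sup>2 \<le> (?X + 0) * ?Y"
    by (rule tendsto_lowerbound) (auto simp: eventually_at_right_field * intro!: exI[of _ 1])
  then have "(norm (ip x y))\<^sup>2 \<le> (hn x * hn y)\<^sup>2"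
    by (simp add: power_mult_distrib hn_square)
  then show ?thesis by (rule power2_le_imp_le) simp
qed

lemma hn_triangle:
  assumes x: "x \<in> H" and y: "y \<in> H"
  shows "hn (x + y) \<le> hn x + hn y"
proof (rule power2_le_imp_le)
  have "ip (x + y) (x + y) = (ip x x + ip x y) + (ip y x + ip y y)"
    by (simp add: ip_add_left ip_add_right x y H_add)
  then have "norm (ip (x + y) (x + y)) \<le> (hn x * hn x + hn x * hn y) + (hn y * hn x + hn y * hn y)"
    using Cauchy_Schwarz x y by (metis (no_types, lifting) add_mono norm_triangle_mono)
  then show "(hn (x + y))\<^sup>2 \<le> (hn x + hn y)\<^sup>2"
    by (simp add: hn_square) (simp add: power2_eq_square algebra_simps)
qed simp

lemma hn_scaleC: "x \<in> H ==> hn (c *\<^sub>C x) = cmod c * hn x"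
  by (simp add: hn_def ip_scaleC_left ip_scaleC_right H_scaleC scaleC_scaleC norm_scaleC norm_mult
      real_sqrt_mult)

lemma hn_minus: "x \<in> H ==> hn (- x) = hn x"
  using hn_scaleC[of x "-1"] by (simp add: scaleC_minus_one)

lemma hn_diff_commute: "x \<in> H ==> y \<in> H ==> hn (x - y) = hn (y - x)"
  using hn_minus[of "x - y"] H_diff by simp

lemma hn_triangle_diff: "x \<in> H ==> y \<in> H ==> z \<in> H ==> hn (x - z) \<le> hn (x - y) + hn (y - z)"
  using hn_triangle[of "x - y" "y - z"] H_diff by simp

lemma hn_sum: "(\<And>i. i \<in> I ==> f i \<in> H) ==> hn (\<Sum>i\<in>I. f i) \<le> (\<Sum>i\<in>I. hn (f i))"
proof (induction I rule: infinite_finite_induct)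
  case (insert i I)
  then show ?case using hn_triangle[of "f i" "\<Sum>i\<in>I. f i"] H_sum[of I f] by simp
qed simp_all

definition bounded_op :: "('x => 'x) => bool"
  where "bounded_op F \<longleftrightarrow> (\<forall>x\<in>H. F x \<in> H) \<and> clinear_on H F \<and> (\<exists>K. \<forall>x\<in>H. hn (F x) \<le> K * hn x)"

text \<open>Meaningful for bounded operators only: the supremum of an unbounded set of reals is
  arbitrary.\<close>

definition opn :: "('x => 'x) => real"
  where "opn F = Sup {hn (F x) |x. x \<in> H \<and> hn x \<le> 1}"

lemma opn_bound_unit:
  assumes "bounded_op F" "x \<in> H" "hn x \<le> 1"
  shows "hn (F x) \<le> opn F"
proof -
  obtain K where K: "\<And>x. x \<in> H ==> hn (F x) \<le> K * hn x" using assms by (auto simp: bounded_op_def)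
  have "hn (F x) \<le> max K 0" if "x \<in> H" "hn x \<le> 1" for x
    using K[OF that(1)] mult_right_mono[of K "max K 0" "hn x"] mult_left_mono[OF that(2), of "max K 0"]
    by simp
  then show ?thesis unfolding opn_def
    by (intro cSup_upper bdd_aboveI[of _ "max K 0"]) (use assms in auto)
qed

lemma opn_nonneg: "bounded_op F ==> 0 \<le> opn F"
  using order.trans[OF hn_nonneg opn_bound_unit[of F 0]] H_0 by simp

lemma opn_bound:
  assumes F: "bounded_op F" and x: "x \<in> H"
  shows "hn (F x) \<le> opn F * hn x"
proof (cases "hn x = 0")
  case True
  then show ?thesis using assms by (auto simp: bounded_op_def)
next
  case False
  then have p: "0 < hn x" using hn_nonneg[of x] by linarith
  let ?c = "complex_of_real (1 / hn x)"
  have "hn (F (?c *\<^sub>C x)) \<le> opn F"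
    using p x by (intro opn_bound_unit[OF F] H_scaleC) (simp_all add: hn_scaleC norm_divide)
  moreover have "F (?c *\<^sub>C x) = ?c *\<^sub>C F x" "F x \<in> H" using F x 
    unfolding bounded_op_def by (auto intro!: clinear_on_scaleC)
  ultimately show ?thesis using p by (simp add: hn_scaleC norm_divide field_simps)
qed

lemma opn_le:
  assumes "\<And>x. x \<in> H ==> hn (F x) \<le> K * hn x" "0 \<le> K"
  shows "opn F \<le> K"
  unfolding opn_def
proof (rule cSup_least)
  show "{hn (F x) |x. x \<in> H \<and> hn x \<le> 1} \<noteq> {}" using H_0 by force
  show "r \<le> K" if "r \<in> {hn (F x) |x. x \<in> H \<and> hn x \<le> 1}" for r
    using that assms mult_left_le[of "hn _" K] by (auto intro: order.trans)
qed

lemma bounded_op_add: "bounded_op F ==> bounded_op G ==> bounded_op (F + G)"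
  unfolding bounded_op_def
proof (elim conjE exE, intro conjI exI ballI)
  fix K L x assume *: "\<forall>x\<in>H. F x \<in> H" "\<forall>x\<in>H. G x \<in> H" 
    "\<forall>x\<in>H. hn (F x) \<le> K * hn x" "\<forall>x\<in>H. hn (G x) \<le> L * hn x" and x: "x \<in> H"
  show "hn ((F + G) x) \<le> (K + L) * hn x"
    using * x hn_triangle[of "F x" "G x"] by (fastforce simp: algebra_simps)
qed (auto simp: clinear_on_def scaleC_add_right H_add)

lemma bounded_op_scaleC: "bounded_op F ==> bounded_op (c *\<^sub>C F)"
  unfolding bounded_op_def
proof (elim conjE exE, intro conjI exI ballI)
  fix K x assume *: "\<forall>x\<in>H. F x \<in> H" "\<forall>x\<in>H. hn (F x) \<le> K * hn x" and x: "x \<in> H"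
  show "hn ((c *\<^sub>C F) x) \<le> (cmod c * K) * hn x"
    using * x by (simp add: hn_scaleC mult_left_mono mult.assoc)
qed (auto simp: clinear_on_def scaleC_add_right H_scaleC scaleC_scaleC mult.commute)

lemma bounded_op_diff: "bounded_op F ==> bounded_op G ==> bounded_op (F - G)"
  using bounded_op_add[of F "(-1) *\<^sub>C G"] bounded_op_scaleC[of G "-1"] by (simp add: scaleC_minus_one)

lemma opn_triangle: "bounded_op F ==> bounded_op G ==> opn (F + G) \<le> opn F + opn G"
proof (rule opn_le)
  fix x assume *: "bounded_op F" "bounded_op G" "x \<in> H"
  then show "hn ((F + G) x) \<le> (opn F + opn G) * hn x"
    using hn_triangle[of "F x" "G x"] opn_bound[of F x] opn_bound[of G x]
    by (simp add: bounded_op_def algebra_simps)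
qed (simp add: opn_nonneg)

lemma opn_scaleC_le: "bounded_op F ==> opn (c *\<^sub>C F) \<le> cmod c * opn F"
  by (rule opn_le)
    (simp_all add: hn_scaleC bounded_op_def[of F] opn_nonneg mult.assoc mult_left_mono opn_bound)

lemma opn_scaleC: 
  assumes "bounded_op F" shows "opn (c *\<^sub>C F) = cmod c * opn F"
proof (cases "c = 0")
  case True
  have "bounded_op (0 *\<^sub>C F)" by (rule bounded_op_scaleC[OF assms])
  then have "0 \<le> opn (0 *\<^sub>C F)" by (rule opn_nonneg)
  then show ?thesis using True opn_scaleC_le[OF assms, of 0] by simp
next
  case False
  have "opn ((1/c) *\<^sub>C (c *\<^sub>C F)) \<le> cmod (1/c) * opn (c *\<^sub>C F)"
    by (rule opn_scaleC_le[OF bounded_op_scaleC[OF assms]])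
  moreover have "(1/c) *\<^sub>C (c *\<^sub>C F) = F" using False by (simp add: scaleC_scaleC scaleC_one)
  ultimately show ?thesis using opn_scaleC_le[OF assms, of c] False
    by (simp add: norm_divide field_simps)
qed

lemma opn_diff_commute: "bounded_op F ==> bounded_op G ==> opn (F - G) = opn (G - F)"
  using opn_scaleC[of "F - G" "-1"] by (simp add: scaleC_minus_one bounded_op_diff)

lemma opn_triangle_diff: 
  "bounded_op F ==> bounded_op G ==> bounded_op K ==> opn (F - K) \<le> opn (F - G) + opn (G - K)"
  using opn_triangle[of "F - G" "G - K"] by (simp add: bounded_op_diff)

definition adjoint_pair :: "('x => 'x) => ('x => 'x) => bool"
  where "adjoint_pair F G \<longleftrightarrow> (\<forall>x\<in>H. F x \<in> H \<and> G x \<in> H) \<and> (\<forall>x\<in>H. \<forall>y\<in>H. ip (F x) y = ip x (G y))"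

lemma adjoint_pair_commute: "adjoint_pair F G ==> adjoint_pair G F"
  unfolding adjoint_pair_def by (metis star_ip)

text \<open>Since \<open>\<langle>G y, G y\<rangle> = \<langle>F (G y), y\<rangle>\<close>, the square of the norm of \<open>G y\<close> is at most \<open>opn F\<close> times
  the norms of \<open>G y\<close> and of \<open>y\<close>.\<close>

lemma adjoint_bound:
  assumes F: "bounded_op F" and FG: "adjoint_pair F G" and y: "y \<in> H"
  shows "hn (G y) \<le> opn F * hn y"
proof -
  have G: "G y \<in> H" "F (G y) \<in> H" using FG y by (auto simp: adjoint_pair_def)
  have "(hn (G y))\<^sup>2 = norm (ip (F (G y)) y)"
    using FG y G by (simp add: hn_square adjoint_pair_def)
  also have "\<dots> \<le> hn (F (G y)) * hn y" by (rule Cauchy_Schwarz[OF G(2) y])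
  also have "\<dots> \<le> opn F * hn (G y) * hn y"
    by (rule mult_right_mono[OF opn_bound[OF F G(1)]]) simp
  finally have *: "hn (G y) * hn (G y) \<le> hn (G y) * (opn F * hn y)"
    by (simp add: power2_eq_square algebra_simps)
  show ?thesis
  proof (cases "hn (G y) = 0")
    case False
    then show ?thesis using * hn_nonneg[of "G y"] by (simp add: mult_le_cancel_left)
  qed (simp add: opn_nonneg[OF F])
qed

lemma opn_adjoint_le: "bounded_op F ==> adjoint_pair F G ==> opn G \<le> opn F"
  by (rule opn_le) (auto intro: adjoint_bound opn_nonneg)

lemma opn_adjoint: "bounded_op F ==> bounded_op G ==> adjoint_pair F G ==> opn G = opn F"
  using opn_adjoint_le[of F G] opn_adjoint_le[of G F] adjoint_pair_commute[of F G] by simp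

lemma tendsto_ip_left:
  assumes "\<And>n. X n \<in> H" "x \<in> H" "y \<in> H" "(\<lambda>n. hn (X n - x)) \<longlonglongrightarrow> 0"
  shows "(\<lambda>n. ip (X n) y) \<longlonglongrightarrow> ip x y"
proof (rule LIM_zero_cancel, rule Lim_null_comparison)
  show "\<forall>\<^sub>F n in sequentially. norm (ip (X n) y - ip x y) \<le> hn (X n - x) * hn y"
    using assms by (auto intro!: always_eventually Cauchy_Schwarz H_diff simp flip: ip_diff_left)
  show "(\<lambda>n. hn (X n - x) * hn y) \<longlonglongrightarrow> 0"
    using tendsto_mult_right[OF assms(4), of "hn y"] by simp
qed

lemma hn_diff_le_of_tendsto:
  assumes "\<And>n. X n \<in> H" "x \<in> H" "y \<in> H" "(\<lambda>n. hn (X n - x)) \<longlonglongrightarrow> 0" "\<And>n. n \<ge> N ==> hn (y - X n) \<le> K"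
  shows "hn (y - x) \<le> K"
proof -
  have le: "hn (y - x) \<le> K + hn (X n - x)" if "n \<ge> N" for n
    using hn_triangle_diff[OF assms(3) assms(1)[of n] assms(2)] assms(5)[OF that] by linarith
  have "(\<lambda>n. K + hn (X n - x)) \<longlonglongrightarrow> K + 0" by (intro tendsto_intros assms)
  then have "hn (y - x) \<le> K + 0"
    by (rule LIMSEQ_le_const) (use le in blast)
  then show ?thesis by simp
qed

end

section \<open>Hilbert modules\<close>

locale hilbert_module = semi_hilbert_module +
  assumes ip_definite: "x \<in> H ==> ip x x = 0 ==> x = 0"
    and complete: "(\<And>n. X n \<in> H) ==> (\<And>e. 0 < e ==> \<exists>N. \<forall>m\<ge>N. \<forall>n\<ge>N. hn (X m - X n) < e) ==>
      \<exists>x\<in>H. (\<lambda>n. hn (X n - x)) \<longlonglongrightarrow> 0"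
begin

lemma hn_eq_0: "x \<in> H ==> hn x = 0 \<longleftrightarrow> x = 0"
  using ip_definite[of x] by (auto simp: hn_def ip_zero_right H_0)

lemma ip_ext:
  assumes "x \<in> H" "y \<in> H" "\<And>z. z \<in> H ==> ip x z = ip y z"
  shows "x = y"
  using ip_definite[of "x - y"] assms by (simp add: ip_diff_left H_diff)

lemma adjoint_unique:
  assumes "adjoint_pair F G" "adjoint_pair F G'" "y \<in> H"
  shows "G y = G' y"
  by (rule ip_ext) (use assms in \<open>auto simp: adjoint_pair_def\<close>, metis star_ip)

lemma adjoint_pair_clinear:
  assumes "adjoint_pair F G"
  shows "clinear_on H F"
  using assms unfolding clinear_on_def
  by (auto intro!: ip_ext simp: adjoint_pair_def H_add H_scaleC ip_add_left ip_scaleC_left)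

lemma complete_geometric:
  assumes X: "\<And>n. X n \<in> H" "\<And>n. hn (X (Suc n) - X n) \<le> (1/3)^n"
  obtains x where "x \<in> H" "\<And>n. hn (X n - x) \<le> 3/2 * (1/3)^n"
proof -
  have *: "hn (X (n + k) - X n) \<le> 3/2 * ((1/3)^n - (1/3)^(n+k))" for n k
  proof (induction k)
    case (Suc k)
    have "hn (X (n + Suc k) - X n) \<le> hn (X (Suc (n + k)) - X (n + k)) + hn (X (n + k) - X n)"
      using hn_triangle_diff[of "X (Suc (n + k))" "X (n + k)" "X n"] X(1) by simp
    then show ?case using Suc X(2)[of "n + k"] by simp
  qed simp
  have le: "hn (X m - X n) \<le> 3/2 * (1/3)^n" if "n \<le> m" for m n
    using *[of n "m - n"] that by (simp add: algebra_simps) (smt (verit) zero_le_power zero_le_divide_1_iff)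
  have "\<exists>x\<in>H. (\<lambda>n. hn (X n - x)) \<longlonglongrightarrow> 0"
  proof (rule complete[OF X(1)])
    fix e :: real assume e: "0 < e"
    have "(\<lambda>n. 3 * (1/3::real)^n) \<longlonglongrightarrow> 3 * 0" by (intro tendsto_intros LIMSEQ_realpow_zero) auto
    then obtain N where N: "3 * (1/3::real)^N < e" 
      using e by (metis (no_types, lifting) mult_zero_right order_tendstoD(2) eventually_sequentially order.refl)
    have "hn (X m - X n) < e" if "m \<ge> N" "n \<ge> N" for m n
      using hn_triangle_diff[of "X m" "X N" "X n"] le[OF that(1)] le[OF that(2)] N X(1)
        hn_diff_commute[of "X N" "X n"] by simp
    then show "\<exists>N. \<forall>m\<ge>N. \<forall>n\<ge>N. hn (X m - X n) < e" by blast
  qed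
  then obtain x where x: "x \<in> H" "(\<lambda>n. hn (X n - x)) \<longlonglongrightarrow> 0" by blast
  have "hn (X n - x) \<le> 3/2 * (1/3)^n" for n
    by (rule hn_diff_le_of_tendsto[OF X(1) x(1) X(1) x(2), of n])
      (use le hn_diff_commute X(1) in metis)
  then show thesis using that x(1) by blast
qed

text \<open>A gliding hump argument for the maps \<open>\<langle>F y, _\<rangle> = \<langle>y, G _\<rangle>\<close> with \<open>y\<close> a unit vector, which are
  pointwise bounded by the norm of \<open>G _\<close>. If \<open>F\<close> were unbounded, take unit vectors \<open>y n\<close> with
  \<open>t n = hn (F (y n)) > 4\<^sup>n\<close>. Moving from \<open>X n\<close> by a step \<open>u n\<close> of length \<open>1 / 3\<^sup>n\<close> along
  \<open>F (y n)\<close>, in one of the two directions, makes the norm of \<open>\<langle>F (y n), X (n + 1)\<rangle>\<close> at least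
  \<open>t n / 3\<^sup>n\<close>. All later steps together have length at most half of \<open>1 / 3\<^sup>n\<close>, so the limit
  \<open>x\<close> satisfies \<open>hn (G x) \<ge> (4 / 3)\<^sup>n / 2\<close> for every \<open>n\<close>.\<close>

theorem adjoint_pair_bounded_op:
  assumes FG: "adjoint_pair F G"
  shows "bounded_op F"
proof -
  have FH: "F x \<in> H" "G x \<in> H" if "x \<in> H" for x using FG that by (auto simp: adjoint_pair_def)
  have lin: "clinear_on H F" by (rule adjoint_pair_clinear[OF FG])
  have "\<exists>K. \<forall>x\<in>H. hn (F x) \<le> K * hn x"
  proof (rule ccontr)
    assume "\<nexists>K. \<forall>x\<in>H. hn (F x) \<le> K * hn x"
    then have unb: "\<exists>x\<in>H. K * hn x < hn (F x)" for K by (metis not_le)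
    have "\<exists>y\<in>H. hn y = 1 \<and> 4^n < hn (F y)" for n :: nat
    proof -
      obtain x where x: "x \<in> H" "4^n * hn x < hn (F x)" using unb by blast
      have "hn x \<noteq> 0"
      proof
        assume "hn x = 0"
        then have "x = 0" using x(1) hn_eq_0 by blast
        then show False using x(2) clinear_on_0[OF lin H_0] by simp
      qed
      then have p: "0 < hn x" using hn_nonneg[of x] by linarith
      let ?c = "complex_of_real (1 / hn x)"
      show ?thesis
        by (rule bexI[of _ "?c *\<^sub>C x"]) 
          (use p x FH in \<open>auto simp: hn_scaleC norm_divide clinear_on_scaleC[OF lin] H_scaleC field_simps\<close>)
    qed
    then obtain y where y: "\<And>n::nat. y n \<in> H" "\<And>n. hn (y n) = 1" "\<And>n. 4^n < hn (F (y n))"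
      by metis
    define t where "t n = hn (F (y n))" for n
    have t: "0 < t n" "4^n < t n" for n using y(3)[of n] by (auto simp: t_def intro: less_trans[OF _ y(3)])
    define u where "u n = complex_of_real ((1/3)^n / t n) *\<^sub>C F (y n)" for n
    have u: "u n \<in> H" "hn (u n) = (1/3)^n" "norm (ip (F (y n)) (u n)) = (1/3)^n * t n" for n
    proof -
      show "u n \<in> H" "hn (u n) = (1/3)^n"
        using t(1)[of n] y FH by (auto simp: u_def H_scaleC hn_scaleC norm_divide norm_power simp flip: t_def)
      have "norm (ip (F (y n)) (F (y n))) = (t n)\<^sup>2" by (simp add: t_def hn_square)
      then show "norm (ip (F (y n)) (u n)) = (1/3)^n * t n"
        using t(1)[of n] y FH by (simp add: u_def ip_scaleC_right norm_scaleC norm_divide norm_power power2_eq_square)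
    qed
    \<comment> \<open>One of the two vectors \<open>x + u n\<close> and \<open>x - u n\<close> has a large image, because the difference
        of the images is \<open>2 \<langle>F (y n), u n\<rangle>\<close>.\<close>
    define nxt where "nxt n x = (if (1/3)^n * t n \<le> norm (ip (F (y n)) (x + u n)) then x + u n else x - u n)" for n x
    define X where "X = rec_nat 0 nxt"
    have X0: "X 0 = 0" and XS: "X (Suc n) = nxt n (X n)" for n by (simp_all add: X_def)
    have XH: "X n \<in> H" for n by (induction n) (auto simp: X0 XS nxt_def H_0 H_add H_diff u)
    have Xd: "hn (X (Suc n) - X n) \<le> (1/3)^n" for n
      using u(1,2)[of n] by (auto simp: XS nxt_def hn_minus)
    have Xl: "(1/3)^n * t n \<le> norm (ip (F (y n)) (X (Suc n)))" for n
    proof (cases "(1/3)^n * t n \<le> norm (ip (F (y n)) (X n + u n))")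
      case False
      have "ip (F (y n)) (X n + u n) - ip (F (y n)) (X n - u n) = 2 *\<^sub>R ip (F (y n)) (u n)"
        using XH u y FH by (simp add: ip_add_right ip_diff_right scaleR_2)
      then have "2 * ((1/3)^n * t n) \<le> norm (ip (F (y n)) (X n + u n)) + norm (ip (F (y n)) (X n - u n))"
        using norm_triangle_ineq4[of "ip (F (y n)) (X n + u n)" "ip (F (y n)) (X n - u n)"] u(3)[of n] by simp
      then show ?thesis using False by (simp add: XS nxt_def)
    qed (simp add: XS nxt_def)
    obtain x where x: "x \<in> H" "\<And>n. hn (X n - x) \<le> 3/2 * (1/3)^n"
      using complete_geometric[OF XH Xd] by metis
    have "(4/3)^n / 2 \<le> hn (G x)" for n
    proof -
      have "norm (ip (F (y n)) (X (Suc n) - x)) \<le> t n * hn (X (Suc n) - x)"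
        unfolding t_def by (rule Cauchy_Schwarz) (use XH x y FH H_diff in auto)
      also have "\<dots> \<le> t n * ((1/3)^n / 2)"
        using x(2)[of "Suc n"] t(1)[of n] by (intro mult_left_mono) auto
      finally have "(1/3)^n * t n - t n * ((1/3)^n / 2) \<le> norm (ip (F (y n)) x)"
        using Xl[of n] norm_triangle_ineq2[of "ip (F (y n)) (X (Suc n))" "ip (F (y n)) x"] XH x y FH
        by (simp only: ip_diff_right)
      also have "ip (F (y n)) x = ip (y n) (G x)" using FG x y by (simp add: adjoint_pair_def)
      also have "norm \<dots> \<le> hn (G x)" using Cauchy_Schwarz[of "y n" "G x"] y x FH by simp
      finally have "t n * ((1/3)^n / 2) \<le> hn (G x)" by simp
      moreover have "4^n * ((1/3)^n / 2) \<le> t n * ((1/3)^n / 2)"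
        using t(2)[of n] by (intro mult_right_mono) auto
      ultimately show ?thesis by (simp add: power_divide)
    qed
    moreover obtain n where "2 * hn (G x) < (4/3::real)^n" using real_arch_pow[of "4/3"] by auto
    ultimately show False by (smt (verit) field_sum_of_halves)
  qed
  then show ?thesis using lin FH by (auto simp: bounded_op_def)
qed

lemma adjoint_pair_diff: "adjoint_pair F G ==> adjoint_pair F' G' ==> adjoint_pair (F - F') (G - G')"
  by (auto simp: adjoint_pair_def H_diff ip_diff_left ip_diff_right)

lemma pointwise_limit:
  assumes F: "\<And>n. bounded_op (F n)" and C: "\<And>e. 0 < e ==> \<exists>N. \<forall>m\<ge>N. \<forall>n\<ge>N. opn (F m - F n) < e"
    and x: "x \<in> H"
  shows "\<exists>y\<in>H. (\<lambda>n. hn (F n x - y)) \<longlonglongrightarrow> 0"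
proof (rule complete)
  show "F n x \<in> H" for n using F x by (auto simp: bounded_op_def)
  fix e :: real assume "0 < e"
  then have "0 < e / (hn x + 1)" using hn_nonneg[of x] by (intro divide_pos_pos) linarith+
  from C[OF this] obtain N where N: "\<And>m n. m \<ge> N ==> n \<ge> N ==> opn (F m - F n) < e / (hn x + 1)" by blast
  have "hn (F m x - F n x) < e" if "m \<ge> N" "n \<ge> N" for m n
  proof -
    have p: "0 < hn x + 1" using hn_nonneg[of x] by linarith
    have "hn (F m x - F n x) \<le> opn (F m - F n) * hn x"
      using opn_bound[OF bounded_op_diff[OF F F] x, of m n] by simp
    also have "\<dots> \<le> opn (F m - F n) * (hn x + 1)"
      by (intro mult_left_mono opn_nonneg bounded_op_diff F) simp
    also have "\<dots> < e" using N[OF that] p by (simp add: field_simps)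
    finally show ?thesis .
  qed
  then show "\<exists>N. \<forall>m\<ge>N. \<forall>n\<ge>N. hn (F m x - F n x) < e" by blast
qed

text \<open>The operators converge at each vector because the module is complete, and so do the
  adjoints, as \<open>opn (G m - G n) = opn (F m - F n)\<close>. The limits are set to zero outside the
  module.\<close>

theorem adjoint_pair_limit:
  assumes FG: "\<And>n. adjoint_pair (F n) (G n)"
    and C: "\<And>e. 0 < e ==> \<exists>N. \<forall>m\<ge>N. \<forall>n\<ge>N. opn (F m - F n) < e"
  obtains F' G' where "adjoint_pair F' G'" "\<And>x. x \<notin> H ==> F' x = 0" "\<And>x. x \<notin> H ==> G' x = 0"
    "(\<lambda>n. opn (F n - F')) \<longlonglongrightarrow> 0"
proof -
  note bF = adjoint_pair_bounded_op[OF FG] and bG = adjoint_pair_bounded_op[OF adjoint_pair_commute[OF FG]]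
  have oG: "opn (G m - G n) = opn (F m - F n)" for m n
    by (intro opn_adjoint bounded_op_diff bF bG adjoint_pair_diff FG)
  have "\<exists>y. (x \<in> H --> y \<in> H \<and> (\<lambda>n. hn (F n x - y)) \<longlonglongrightarrow> 0) \<and> (x \<notin> H --> y = 0)" for x
    using pointwise_limit[of F x, OF bF C] by blast
  then obtain F' where F': "\<And>x. x \<in> H ==> F' x \<in> H" "\<And>x. x \<in> H ==> (\<lambda>n. hn (F n x - F' x)) \<longlonglongrightarrow> 0"
     "\<And>x. x \<notin> H ==> F' x = 0" by metis
  have "\<exists>y. (x \<in> H --> y \<in> H \<and> (\<lambda>n. hn (G n x - y)) \<longlonglongrightarrow> 0) \<and> (x \<notin> H --> y = 0)" for x
    using pointwise_limit[of G x, OF bG] C unfolding oG by blast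
  then obtain G' where G': "\<And>x. x \<in> H ==> G' x \<in> H" "\<And>x. x \<in> H ==> (\<lambda>n. hn (G n x - G' x)) \<longlonglongrightarrow> 0"
     "\<And>x. x \<notin> H ==> G' x = 0" by metis
  have FGH: "F n x \<in> H" "G n x \<in> H" if "x \<in> H" for n x using FG that by (auto simp: adjoint_pair_def)
  show thesis
  proof
    show "adjoint_pair F' G'"
      unfolding adjoint_pair_def
    proof (intro conjI ballI F' G')
      fix x y assume x: "x \<in> H" and y: "y \<in> H"
      have "(\<lambda>n. ip (F n x) y) \<longlonglongrightarrow> ip (F' x) y"
        by (rule tendsto_ip_left) (use x y F' FGH in auto)
      moreover have "(\<lambda>n. (ip (G n y) x)\<^sup>\<star>) \<longlonglongrightarrow> (ip (G' y) x)\<^sup>\<star>"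
        by (rule tendsto_star, rule tendsto_ip_left) (use x y G' FGH in auto)
      moreover have "(ip (G n y) x)\<^sup>\<star> = ip (F n x) y" for n
        using FG[of n] x y by (auto simp: adjoint_pair_def star_ip)
      ultimately show "ip (F' x) y = ip x (G' y)"
        using LIMSEQ_unique x y G' by (simp add: star_ip)
    qed auto
    show "(\<lambda>n. opn (F n - F')) \<longlonglongrightarrow> 0"
    proof (rule LIMSEQ_I)
      fix e :: real assume "0 < e"
      then have "0 < e / 2" by simp
      from C[OF this] obtain N where N: "\<And>m n. m \<ge> N ==> n \<ge> N ==> opn (F m - F n) < e / 2" by blast
      have "norm (opn (F n - F') - 0) < e" if n: "n \<ge> N" for n
      proof -
        have "opn (F n - F') \<le> e / 2"
        proof (rule opn_le)
          fix x assume x: "x \<in> H"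
          have "hn (F n x - F m x) \<le> e / 2 * hn x" if "m \<ge> N" for m
            using opn_bound[OF bounded_op_diff[OF bF bF] x, of n m]
              mult_right_mono[OF less_imp_le[OF N[OF n that]] hn_nonneg[of x]] by simp
          then have "hn (F n x - F' x) \<le> e / 2 * hn x"
            using x FGH F' by (intro hn_diff_le_of_tendsto[of "\<lambda>m. F m x" "F' x" "F n x" N]) auto
          then show "hn ((F n - F') x) \<le> e / 2 * hn x" by simp
        qed (use \<open>0 < e\<close> in simp)
        moreover have "0 \<le> opn (F n - F')"
          by (intro opn_nonneg bounded_op_diff bF adjoint_pair_bounded_op[OF \<open>adjoint_pair F' G'\<close>])
        ultimately show ?thesis using \<open>0 < e\<close> by simp
      qed
      then show "\<exists>N. \<forall>n\<ge>N. norm (opn (F n - F') - 0) < e" by blast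
    qed
  qed (use F' G' in auto)
qed

end

section \<open>Square-summable families\<close>

text \<open>The Cauchy criterion for unconditional convergence.\<close>

lemma summable_on_iff_small_tails:
  fixes f :: "'i => 'b::banach"
  shows "f summable_on UNIV \<longleftrightarrow>
    (\<forall>e>0. \<exists>A. finite A \<and> (\<forall>F. finite F --> F \<inter> A = {} --> norm (sum f F) < e))" (is "_ \<longleftrightarrow> ?tails")
proof
  assume f: "f summable_on UNIV"
  show ?tails
  proof (intro allI impI)
    fix e :: real assume "0 < e"
    then have "\<forall>\<^sub>F F in finite_subsets_at_top UNIV. dist (sum f F) (infsum f UNIV) < e / 2"
      using infsum_tendsto[OF f] by (intro tendstoD) simp_all
    then obtain A where A: "finite A" "\<And>F. finite F ==> A \<subseteq> F ==> dist (sum f F) (infsum f UNIV) < e / 2"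
      unfolding eventually_finite_subsets_at_top by auto
    have "norm (sum f F) < e" if F: "finite F" "F \<inter> A = {}" for F
    proof -
      have "sum f F = sum f (F \<union> A) - sum f A" using F A by (simp add: sum.union_disjoint)
      also have "norm \<dots> = dist (sum f (F \<union> A)) (sum f A)" by (simp add: dist_norm)
      also have "\<dots> < e"
        using dist_triangle_half_l[OF A(2)[of "F \<union> A"] A(2)[of A]] F A(1) by (simp add: dist_commute)
      finally show ?thesis .
    qed
    then show "\<exists>A. finite A \<and> (\<forall>F. finite F --> F \<inter> A = {} --> norm (sum f F) < e)"
      using A(1) by blast
  qed
next
  assume tails: ?tails
  have "\<exists>P. eventually P (finite_subsets_at_top UNIV) \<and>
              (\<forall>F F'. P F \<and> P F' --> dist (sum f F) (sum f F') < e)" if "0 < e" for e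
  proof -
    have "0 < e / 2" using that by simp
    then obtain A where A: "finite A" "\<And>F. finite F ==> F \<inter> A = {} ==> norm (sum f F) < e / 2"
      using tails by meson
    have close: "dist (sum f F) (sum f A) < e / 2" if F: "finite F" "A \<subseteq> F" for F
      using A(2)[of "F - A"] F by (simp add: dist_norm sum_diff Diff_Int_distrib2)
    show ?thesis
    proof (intro exI[of _ "\<lambda>F. finite F \<and> A \<subseteq> F"] conjI allI impI)
      show "\<forall>\<^sub>F F in finite_subsets_at_top UNIV. finite F \<and> A \<subseteq> F"
        unfolding eventually_finite_subsets_at_top using A(1) by auto
      fix F F' assume "(finite F \<and> A \<subseteq> F) \<and> (finite F' \<and> A \<subseteq> F')"
      then show "dist (sum f F) (sum f F') < e" using dist_triangle_half_l[OF close close] by blast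
    qed
  qed
  then have "cauchy_filter (filtermap (sum f) (finite_subsets_at_top UNIV))"
    by (simp add: cauchy_filter_metric_filtermap)
  moreover have "complete (UNIV::'b set)"
    by (meson Cauchy_convergent UNIV_I complete_def convergent_def)
  ultimately obtain L where "(sum f \<longlongrightarrow> L) (finite_subsets_at_top UNIV)"
    using complete_uniform[where S="UNIV::'b set"] by (force simp add: filterlim_def)
  then show "f summable_on UNIV"
    using summable_on_def has_sum_def by blast
qed

text \<open>Finite partial sums of the inner product of families. For each finite set they form a
  semi-inner product on all families, whose estimates carry over to infinite sums.\<close>

definition fin_ip :: "'i set => ('i => 'a::cstar_algebra) => ('i => 'a) => 'a"
  where "fin_ip F x y = (\<Sum>i\<in>F. (x i)\<^sup>\<star> * y i)"

abbreviation fin_norm :: "'i set => ('i => 'a::cstar_algebra) => real"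
  where "fin_norm F \<equiv> semi_hilbert_module.hn (fin_ip F)"

lemma fin_module:
  "semi_hilbert_module UNIV (fin_ip F) (\<lambda>(x :: 'i => 'a::cstar_algebra) a i. x i * a)"
  by standard
    (simp_all add: fin_ip_def csubspace_def distrib_left sum.distrib mult_scaleC_right scaleC_sum_right
      sum_distrib_right mult.assoc star_sum star_mult star_star cpos_sum cpos_star_mult)

lemmas fin_norm_triangle = semi_hilbert_module.hn_triangle[OF fin_module UNIV_I UNIV_I]
  and fin_norm_scaleC = semi_hilbert_module.hn_scaleC[OF fin_module UNIV_I]
  and fin_norm_diff_commute = semi_hilbert_module.hn_diff_commute[OF fin_module UNIV_I UNIV_I]
  and fin_Cauchy_Schwarz = semi_hilbert_module.Cauchy_Schwarz[OF fin_module UNIV_I UNIV_I]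
  and fin_norm_nonneg = semi_hilbert_module.hn_nonneg[OF fin_module]
  and fin_norm_def = semi_hilbert_module.hn_def[OF fin_module]

lemma cpos_fin_ip: "cpos (fin_ip F x x)"
  by (simp add: fin_ip_def cpos_sum cpos_star_mult)

lemma fin_norm_dominated:
  fixes x y :: "'i => 'a::cstar_algebra"
  assumes "\<And>i. i \<in> F ==> cpos (K\<^sup>2 *\<^sub>R ((x i)\<^sup>\<star> * x i) - (y i)\<^sup>\<star> * y i)" "0 \<le> K"
  shows "fin_norm F y \<le> K * fin_norm F x"
proof -
  have "cpos (\<Sum>i\<in>F. K\<^sup>2 *\<^sub>R ((x i)\<^sup>\<star> * x i) - (y i)\<^sup>\<star> * y i)" by (rule cpos_sum[OF assms(1)])
  then have "cpos (K\<^sup>2 *\<^sub>R fin_ip F x x - fin_ip F y y)"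
    by (simp add: fin_ip_def sum_subtractf scaleR_right.sum)
  then have "norm (fin_ip F y y) \<le> K\<^sup>2 * norm (fin_ip F x x)"
    using cpos_norm_mono[OF cpos_fin_ip] by (metis abs_power2 norm_scaleR power2_abs)
  then have "sqrt (norm (fin_ip F y y)) \<le> sqrt (K\<^sup>2 * norm (fin_ip F x x))" by simp
  then show ?thesis using assms(2) by (simp add: fin_norm_def real_sqrt_mult)
qed

lemma fin_norm_mono:
  assumes "F \<subseteq> F'" "finite F'"
  shows "fin_norm F x \<le> fin_norm F' x"
proof -
  have "fin_ip F' x x - fin_ip F x x = fin_ip (F' - F) x x"
    using assms by (simp add: fin_ip_def sum_diff)
  then have "cpos (fin_ip F' x x - fin_ip F x x)" by (simp add: cpos_fin_ip)
  then show ?thesis by (simp add: fin_norm_def cpos_norm_mono[OF cpos_fin_ip])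
qed

lemma fin_norm_mult_right: "fin_norm F (\<lambda>i. x i * a) \<le> fin_norm F x * norm (a::'a::cstar_algebra)"
proof -
  have "fin_ip F (\<lambda>i. x i * a) (\<lambda>i. x i * a) = a\<^sup>\<star> * fin_ip F x x * a"
    by (simp add: fin_ip_def star_mult sum_distrib_left sum_distrib_right mult.assoc)
  then have "norm (fin_ip F (\<lambda>i. x i * a) (\<lambda>i. x i * a)) \<le> norm a * norm (fin_ip F x x) * norm a"
    by (simp add: order.trans[OF norm_mult_ineq] mult_right_mono order.trans[OF norm_mult_ineq])
  then have "sqrt (norm (fin_ip F (\<lambda>i. x i * a) (\<lambda>i. x i * a))) \<le> sqrt (norm a * norm (fin_ip F x x) * norm a)"
    by simp
  also have "\<dots> = sqrt (norm (fin_ip F x x)) * norm a" by (simp add: real_sqrt_mult)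
  finally show ?thesis by (simp add: fin_norm_def)
qed

definition l2 :: "('i => 'a::cstar_algebra) set"
  where "l2 = {x. (\<lambda>i. (x i)\<^sup>\<star> * x i) summable_on UNIV}"

definition l2_ip :: "('i => 'a::cstar_algebra) => ('i => 'a) => 'a"
  where "l2_ip x y = (\<Sum>\<^sub>\<infinity>i. (x i)\<^sup>\<star> * y i)"

text \<open>Membership in terms of the seminorms \<open>fin_norm F\<close>, for which the triangle inequality is
  available.\<close>

lemma l2_iff:
  "x \<in> l2 \<longleftrightarrow> (\<forall>e>0. \<exists>A. finite A \<and> (\<forall>F. finite F --> F \<inter> A = {} --> fin_norm F x < e))"
  (is "_ \<longleftrightarrow> ?tails")
proof -
  have "x \<in> l2 \<longleftrightarrow> (\<forall>e>0. \<exists>A. finite A \<and> (\<forall>F. finite F --> F \<inter> A = {} --> norm (fin_ip F x x) < e))"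
    by (simp add: l2_def summable_on_iff_small_tails fin_ip_def)
  also have "\<dots> \<longleftrightarrow> ?tails"
  proof (intro iffI allI impI)
    fix e :: real assume *: "0 < e" "\<forall>e>0. \<exists>A. finite A \<and> (\<forall>F. finite F --> F \<inter> A = {} --> norm (fin_ip F x x) < e)"
    then have "0 < e\<^sup>2" by simp
    with *(2) obtain A where A: "finite A" "\<And>F. finite F ==> F \<inter> A = {} ==> norm (fin_ip F x x) < e\<^sup>2" by meson
    then show "\<exists>A. finite A \<and> (\<forall>F. finite F --> F \<inter> A = {} --> fin_norm F x < e)"
      using *(1) by (intro exI[of _ A]) (auto simp: fin_norm_def intro!: real_less_lsqrt)
  next
    fix e :: real assume *: "0 < e" "\<forall>e>0. \<exists>A. finite A \<and> (\<forall>F. finite F --> F \<inter> A = {} --> fin_norm F x < e)"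
    then have "0 < sqrt e" by simp
    with *(2) obtain A where A: "finite A" "\<And>F. finite F ==> F \<inter> A = {} ==> fin_norm F x < sqrt e" by meson
    then show "\<exists>A. finite A \<and> (\<forall>F. finite F --> F \<inter> A = {} --> norm (fin_ip F x x) < e)"
      by (intro exI[of _ A]) (auto simp: fin_norm_def)
  qed
  finally show ?thesis .
qed

lemma l2D:
  assumes "x \<in> l2" "0 < e"
  obtains A where "finite A" "\<And>F. finite F ==> F \<inter> A = {} ==> fin_norm F x < e"
  using assms unfolding l2_iff by meson

lemma l2_dominated:
  assumes x: "x \<in> l2" and le: "\<And>F. finite F ==> fin_norm F y \<le> K * fin_norm F x"
  shows "y \<in> l2"
  unfolding l2_iff
proof (intro allI impI)
  fix e :: real assume "0 < e"
  then have "0 < e / (\<bar>K\<bar> + 1)" by simp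
  then obtain A where A: "finite A" "\<And>F. finite F ==> F \<inter> A = {} ==> fin_norm F x < e / (\<bar>K\<bar> + 1)"
    using l2D[OF x] by metis
  have "fin_norm F y < e" if F: "finite F" "F \<inter> A = {}" for F
  proof -
    have "fin_norm F y \<le> (\<bar>K\<bar> + 1) * fin_norm F x"
      by (rule order.trans[OF le[OF F(1)]], rule mult_right_mono) (simp_all add: fin_norm_nonneg)
    also have "\<dots> < e" using A(2)[OF F] by (simp add: field_simps)
    finally show ?thesis .
  qed
  then show "\<exists>A. finite A \<and> (\<forall>F. finite F --> F \<inter> A = {} --> fin_norm F y < e)" using A(1) by blast
qed

lemma l2_add:
  assumes x: "x \<in> l2" and y: "y \<in> l2"
  shows "x + y \<in> l2"
  unfolding l2_iff
proof (intro allI impI)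
  fix e :: real assume "0 < e"
  then have e: "0 < e / 2" by simp
  obtain A B where A: "finite A" "\<And>F. finite F ==> F \<inter> A = {} ==> fin_norm F x < e / 2"
    and B: "finite B" "\<And>F. finite F ==> F \<inter> B = {} ==> fin_norm F y < e / 2"
    using l2D[OF x e] l2D[OF y e] by metis
  have "fin_norm F (x + y) < e" if "finite F" "F \<inter> (A \<union> B) = {}" for F
    using fin_norm_triangle[of F x y] A(2)[of F] B(2)[of F] that by (simp add: Int_Un_distrib)
  then show "\<exists>A. finite A \<and> (\<forall>F. finite F --> F \<inter> A = {} --> fin_norm F (x + y) < e)"
    using A(1) B(1) by (intro exI[of _ "A \<union> B"]) auto
qed

lemma l2_summable:
  assumes x: "x \<in> l2" and y: "y \<in> l2"
  shows "(\<lambda>i. (x i)\<^sup>\<star> * y i) summable_on UNIV"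
  unfolding summable_on_iff_small_tails
proof (intro allI impI)
  fix e :: real assume "0 < e"
  then have e: "0 < sqrt e" by simp
  obtain A B where A: "finite A" "\<And>F. finite F ==> F \<inter> A = {} ==> fin_norm F x < sqrt e"
    and B: "finite B" "\<And>F. finite F ==> F \<inter> B = {} ==> fin_norm F y < sqrt e"
    using l2D[OF x e] l2D[OF y e] by metis
  have "norm (\<Sum>i\<in>F. (x i)\<^sup>\<star> * y i) < e" if F: "finite F" "F \<inter> (A \<union> B) = {}" for F
  proof -
    have "norm (fin_ip F x y) \<le> fin_norm F x * fin_norm F y" by (rule fin_Cauchy_Schwarz)
    also have "\<dots> < sqrt e * sqrt e"
      using A(2)[of F] B(2)[of F] F fin_norm_nonneg[of F] by (intro mult_strict_mono) (auto simp: Int_Un_distrib \<open>0 < e\<close>)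
    finally show ?thesis using \<open>0 < e\<close> by (simp add: fin_ip_def)
  qed
  then show "\<exists>A. finite A \<and> (\<forall>F. finite F --> F \<inter> A = {} --> norm (\<Sum>i\<in>F. (x i)\<^sup>\<star> * y i) < e)"
    using A(1) B(1) by (intro exI[of _ "A \<union> B"]) auto
qed

lemma l2_scaleC: "x \<in> l2 ==> c *\<^sub>C x \<in> l2"
  by (rule l2_dominated[of x _ "cmod c"]) (auto simp: fin_norm_scaleC)

lemma l2_mult_right: "x \<in> l2 ==> (\<lambda>i. x i * a) \<in> l2"
  by (rule l2_dominated[of x _ "norm a"]) (auto simp: mult.commute intro: order.trans[OF fin_norm_mult_right])

lemma l2_zero: "0 \<in> l2"
  by (simp add: l2_def)

lemma csubspace_l2: "csubspace l2"
  by (simp add: csubspace_def l2_zero l2_add l2_scaleC)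

lemma fin_ip_tendsto: "x \<in> l2 ==> y \<in> l2 ==> ((\<lambda>F. fin_ip F x y) \<longlongrightarrow> l2_ip x y) (finite_subsets_at_top UNIV)"
  unfolding fin_ip_def l2_ip_def by (intro infsum_tendsto l2_summable)

lemma l2_module: "semi_hilbert_module l2 l2_ip (\<lambda>(x :: 'i => 'a::cstar_algebra) a i. x i * a)"
proof
  fix x y z :: "'i => 'a" and a c assume x: "x \<in> l2" and y: "y \<in> l2" 
  note lim = fin_ip_tendsto and uniq = tendsto_unique[OF finite_subsets_at_top_neq_bot]
  interpret F: semi_hilbert_module UNIV "fin_ip F" "\<lambda>(x :: 'i => 'a) a i. x i * a" for F
    by (rule fin_module)
  show "l2_ip x (y + z) = l2_ip x y + l2_ip x z" if z: "z \<in> l2"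
    using tendsto_add[OF lim[OF x y] lim[OF x z]] lim[OF x l2_add[OF y z]]
    by (intro uniq) (simp_all add: F.ip_add_right)
  have "((\<lambda>F. c *\<^sub>C fin_ip F x y) \<longlongrightarrow> c *\<^sub>C l2_ip x y) (finite_subsets_at_top UNIV)"
    using lim[OF x y, THEN tendsto_mult[OF tendsto_const], of "c *\<^sub>C 1"] by (simp add: mult_scaleC_left)
  then show "l2_ip x (c *\<^sub>C y) = c *\<^sub>C l2_ip x y"
    using lim[OF x l2_scaleC[OF y, of c]] by (intro uniq) (simp_all add: F.ip_scaleC_right)
  show "l2_ip x (\<lambda>i. y i * a) = l2_ip x y * a"
    using tendsto_mult[OF lim[OF x y] tendsto_const, of a] lim[OF x l2_mult_right[OF y, of a]]
    by (intro uniq) (simp_all add: F.ip_ract)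
  show "(l2_ip x y)\<^sup>\<star> = l2_ip y x"
    using tendsto_star[OF lim[OF x y]] lim[OF y x] by (intro uniq) (simp_all add: F.star_ip)
  show "cpos (l2_ip x x)"
    by (rule cpos_tendsto[OF lim[OF x x] finite_subsets_at_top_neq_bot cpos_fin_ip])
qed (auto simp: csubspace_l2 l2_mult_right)

abbreviation l2_norm :: "('i => 'a::cstar_algebra) => real"
  where "l2_norm \<equiv> semi_hilbert_module.hn l2_ip"

lemmas l2_norm_def = semi_hilbert_module.hn_def[OF l2_module]

lemma fin_norm_tendsto: "x \<in> l2 ==> ((\<lambda>F. fin_norm F x) \<longlongrightarrow> l2_norm x) (finite_subsets_at_top UNIV)"
  unfolding fin_norm_def l2_norm_def by (intro tendsto_intros fin_ip_tendsto)

lemma fin_norm_le_l2_norm: "x \<in> l2 ==> finite F ==> fin_norm F x \<le> l2_norm x"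
  by (rule tendsto_lowerbound[OF fin_norm_tendsto])
    (auto simp: eventually_finite_subsets_at_top intro: fin_norm_mono)

lemma l2_norm_le: "x \<in> l2 ==> (\<And>F. finite F ==> fin_norm F x \<le> K) ==> l2_norm x \<le> K"
  by (rule tendsto_upperbound[OF fin_norm_tendsto]) 
    (auto simp: eventually_finite_subsets_at_top)

lemma norm_le_l2_norm: "x \<in> l2 ==> norm (x i) \<le> l2_norm x"
  using fin_norm_le_l2_norm[of x "{i}"] by (simp add: fin_norm_def fin_ip_def cstar_identity)

text \<open>Completeness is proved as for complex square-summable sequences: the terms converge, and the
  finite seminorms of \<open>X n - x\<close> are bounded uniformly in the finite set.\<close>

theorem hilbert_module_l2: "hilbert_module l2 l2_ip (\<lambda>(x :: 'i => 'a::cstar_algebra) a i. x i * a)"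
proof -
  interpret semi_hilbert_module l2 l2_ip "\<lambda>(x :: 'i => 'a) a i. x i * a" by (rule l2_module)
  show ?thesis
  proof
    fix x :: "'i => 'a" assume x: "x \<in> l2" "l2_ip x x = 0"
    then have "norm (x i) = 0" for i using norm_le_l2_norm[OF x(1), of i] by (simp add: l2_norm_def)
    then show "x = 0" by (simp add: fun_eq_iff)
  next
    fix X :: "nat => 'i => 'a" assume X: "\<And>n. X n \<in> l2"
      and C: "\<And>e. 0 < e ==> \<exists>N. \<forall>m\<ge>N. \<forall>n\<ge>N. l2_norm (X m - X n) < e"
    have "convergent (\<lambda>n. X n i)" for i
    proof (rule Cauchy_convergent, rule metric_CauchyI)
      fix e :: real assume "0 < e"
      then show "\<exists>N. \<forall>m\<ge>N. \<forall>n\<ge>N. dist (X m i) (X n i) < e"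
        using C norm_le_l2_norm[OF H_diff[OF X X], of _ _ i]
        by (simp add: dist_norm) (meson le_less_trans)
    qed
    then obtain x where x: "\<And>i. (\<lambda>n. X n i) \<longlonglongrightarrow> x i" unfolding convergent_def by metis
    have close: "fin_norm F (X n - x) \<le> e" 
      if N: "\<And>m n. m \<ge> N ==> n \<ge> N ==> l2_norm (X m - X n) < e" and n: "n \<ge> N" and F: "finite F" for F N n e
    proof -
      have "(\<lambda>m. fin_ip F (X n - X m) (X n - X m)) \<longlonglongrightarrow> fin_ip F (X n - x) (X n - x)"
        unfolding fin_ip_def minus_apply by (intro tendsto_intros tendsto_star x)
      then have "(\<lambda>m. fin_norm F (X n - X m)) \<longlonglongrightarrow> fin_norm F (X n - x)"
        unfolding fin_norm_def by (intro tendsto_intros)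
      then show ?thesis
        by (rule LIMSEQ_le_const2) 
          (use N[OF n] fin_norm_le_l2_norm[OF H_diff[OF X X] F] in \<open>meson less_imp_le order.trans\<close>)
    qed
    have xl: "x \<in> l2"
      unfolding l2_iff
    proof (intro allI impI)
      fix e :: real assume "0 < e"
      then have e: "0 < e / 2" by simp
      from C[OF e] obtain N where N: "\<And>m n. m \<ge> N ==> n \<ge> N ==> l2_norm (X m - X n) < e / 2" by blast
      obtain A where A: "finite A" "\<And>F. finite F ==> F \<inter> A = {} ==> fin_norm F (X N) < e / 2"
        using l2D[OF X e] by metis
      have "fin_norm F x < e" if "finite F" "F \<inter> A = {}" for F
      proof -
        have "fin_norm F (X N - x) \<le> e / 2" by (rule close[where N=N]) (use N that in auto)
        then show ?thesis
          using fin_norm_triangle[of F "X N" "x - X N"] A(2)[OF that] fin_norm_diff_commute[of F x "X N"]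
          by simp
      qed
      then show "\<exists>A. finite A \<and> (\<forall>F. finite F --> F \<inter> A = {} --> fin_norm F x < e)" using A(1) by blast
    qed
    have "(\<lambda>n. l2_norm (X n - x)) \<longlonglongrightarrow> 0"
    proof (rule LIMSEQ_I)
      fix e :: real assume "0 < e"
      then have e: "0 < e / 2" by simp
      from C[OF e] obtain N where N: "\<And>m n. m \<ge> N ==> n \<ge> N ==> l2_norm (X m - X n) < e / 2" by blast
      have "l2_norm (X n - x) \<le> e / 2" if "n \<ge> N" for n
        by (rule l2_norm_le[OF H_diff[OF X xl]], rule close[where N=N]) (use N that in auto)
      then show "\<exists>N. \<forall>n\<ge>N. norm (l2_norm (X n - x) - 0) < e" using \<open>0 < e\<close> by fastforce
    qed
    then show "\<exists>x\<in>l2. (\<lambda>n. l2_norm (X n - x)) \<longlonglongrightarrow> 0" using xl by blast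
  qed
qed

section \<open>The Hilbert module of a twisted system\<close>

locale star_auto =
  fixes \<phi> :: "'a::cstar_algebra => 'a"
  assumes star_automorphism: "star_automorphism \<phi>"
begin

lemma bij: "bij \<phi>" and clinear: "clinear_on UNIV \<phi>" and mult: "\<phi> (x * y) = \<phi> x * \<phi> y"
  and star: "\<phi> (x\<^sup>\<star>) = (\<phi> x)\<^sup>\<star>" and one: "\<phi> 1 = 1"
  using star_automorphism by (auto simp: star_automorphism_def)

lemma add: "\<phi> (x + y) = \<phi> x + \<phi> y" and scaleC: "\<phi> (c *\<^sub>C x) = c *\<^sub>C \<phi> x"
  using clinear by (auto simp: clinear_on_def)

lemma zero: "\<phi> 0 = 0" using scaleC[of 0 0] by simp

lemma inv_left: "inv \<phi> (\<phi> x) = x" and inv_right: "\<phi> (inv \<phi> x) = x"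
  using bij by (simp_all add: bij_is_inj bij_is_surj surj_f_inv_f)

lemma diff: "\<phi> (x - y) = \<phi> x - \<phi> y"
  using add[of "x - y" y] by (simp add: eq_diff_eq)

lemma scaleR: "\<phi> (r *\<^sub>R x) = r *\<^sub>R \<phi> x"
  by (simp add: scaleR_scaleC scaleC)

lemma cpos: "cpos x ==> cpos (\<phi> x)"
  unfolding cpos_def by (metis mult star)

text \<open>The image of the positive element \<open>norm (x)\<^sup>2 - x* x\<close> is positive.\<close>

lemma norm_le: "norm (\<phi> x) \<le> norm x"
proof -
  have "cpos ((norm x)\<^sup>2 *\<^sub>R 1 - x\<^sup>\<star> * x)"
    by (rule cpos_scale_minus) (simp_all add: star_mult star_star cstar_identity)
  then have "cpos (\<phi> ((norm x)\<^sup>2 *\<^sub>R 1 - x\<^sup>\<star> * x))" by (rule cpos)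
  then have "cpos ((norm x)\<^sup>2 *\<^sub>R 1 - (\<phi> x)\<^sup>\<star> * \<phi> x)" by (simp add: diff scaleR one mult star)
  then have "norm ((\<phi> x)\<^sup>\<star> * \<phi> x) \<le> (norm x)\<^sup>2"
    by (intro norm_le_of_cpos cpos_star_mult) simp_all
  then have "(norm (\<phi> x))\<^sup>2 \<le> (norm x)\<^sup>2" by (simp add: cstar_identity)
  then show ?thesis by (rule power2_le_imp_le) simp
qed

lemma inv_automorphism: "star_automorphism (inv \<phi>)"
  unfolding star_automorphism_def clinear_on_def
proof (intro conjI allI ballI)
  show "bij (inv \<phi>)" by (rule bij_imp_bij_inv[OF bij])
  fix x y c
  show "inv \<phi> (x + y) = inv \<phi> x + inv \<phi> y" using add[of "inv \<phi> x" "inv \<phi> y"] by (metis inv_left inv_right)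
  show "inv \<phi> (c *\<^sub>C x) = c *\<^sub>C inv \<phi> x" using scaleC[of c "inv \<phi> x"] by (metis inv_left inv_right)
  show "inv \<phi> (x * y) = inv \<phi> x * inv \<phi> y" using mult[of "inv \<phi> x" "inv \<phi> y"] by (metis inv_left inv_right)
  show "inv \<phi> (x\<^sup>\<star>) = (inv \<phi> x)\<^sup>\<star>" using star[of "inv \<phi> x"] by (metis inv_left inv_right)
  show "inv \<phi> 1 = 1" by (metis one inv_left)
qed

end

context twisted_system
begin

abbreviation "\<H> \<equiv> hmod \<alpha>"

abbreviation "\<Lambda> \<equiv> Lam \<alpha> \<sigma>"

abbreviation "\<C> \<equiv> Cstar_r \<alpha> \<sigma>"

abbreviation "\<M> \<equiv> multiplier_map \<alpha> \<sigma>"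

abbreviation "opnorm \<equiv> op_norm \<alpha>"

abbreviation "mnorm \<equiv> matrix_norm \<alpha>"

abbreviation "\<L> \<equiv> adjointable \<alpha>"

abbreviation "MA \<equiv> M0A \<alpha> \<sigma>"

abbreviation "Mnorm \<equiv> multiplier_cb_norm \<alpha> \<sigma>"

abbreviation "Mconj \<equiv> multiplier_conj \<alpha> \<sigma>"

sublocale a: star_auto "\<alpha> g" for g
  by standard (rule automorphism)

sublocale ai: star_auto "inv (\<alpha> g)" for g
  by standard (rule a.inv_automorphism)

lemma norm_alpha [simp]: "norm (\<alpha> g x) = norm x"
  using a.norm_le[of g x] ai.norm_le[of g "\<alpha> g x"] by (simp add: a.inv_left)

lemma norm_inv_alpha [simp]: "norm (inv (\<alpha> g) x) = norm x"
  using norm_alpha[of g "inv (\<alpha> g) x"] by (simp add: a.inv_right)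

text \<open>In these coordinates the inner product of the Hilbert module is \<open>\<Sum> x(g)* y(g)\<close> and the right
  action of \<open>A\<close> is multiplication of each term.\<close>

definition coord :: "('g => 'a) => 'g => 'a"
  where "coord \<xi> = (\<lambda>g. inv (\<alpha> g) (\<xi> g))"

lemma hmod_iff: "\<xi> \<in> \<H> \<longleftrightarrow> coord \<xi> \<in> l2"
  by (simp add: hmod_def l2_def coord_def ai.mult ai.star)

lemma hinner_eq: "hinner \<alpha> \<xi> \<eta> = l2_ip (coord \<xi>) (coord \<eta>)"
  by (simp add: hinner_def l2_ip_def coord_def ai.mult ai.star)

lemma coord_add: "coord (\<xi> + \<eta>) = coord \<xi> + coord \<eta>"
  by (simp add: coord_def ai.add fun_eq_iff)

lemma coord_diff: "coord (\<xi> - \<eta>) = coord \<xi> - coord \<eta>"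
  by (simp add: coord_def ai.diff fun_eq_iff)

lemma coord_scaleC: "coord (c *\<^sub>C \<xi>) = c *\<^sub>C coord \<xi>"
  by (simp add: coord_def ai.scaleC fun_eq_iff)

lemma coord_ract: "coord (\<lambda>g. \<xi> g * \<alpha> g a) = (\<lambda>g. coord \<xi> g * a)"
  by (simp add: coord_def ai.mult a.inv_left fun_eq_iff)

lemma coord_zero: "coord 0 = 0"
  by (simp add: coord_def ai.zero fun_eq_iff)

lemma coord_inverse: "coord (\<lambda>g. \<alpha> g (x g)) = x"
  by (simp add: coord_def a.inv_left fun_eq_iff)

lemma coord_eq_0: "coord \<xi> = 0 \<longleftrightarrow> \<xi> = 0"
proof
  assume "coord \<xi> = 0"
  then have "inv (\<alpha> g) (\<xi> g) = 0" for g by (simp add: coord_def fun_eq_iff)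
  then have "\<xi> g = 0" for g by (metis a.inv_right a.zero)
  then show "\<xi> = 0" by (simp add: fun_eq_iff)
qed (simp add: coord_zero)

sublocale l2: hilbert_module l2 l2_ip "\<lambda>(x :: 'g => 'a) a i. x i * a"
  by (rule hilbert_module_l2)

lemma hmod_module: "semi_hilbert_module \<H> (hinner \<alpha>) (\<lambda>\<xi> a g. \<xi> g * \<alpha> g a)"
  by standard
   (simp_all add: csubspace_def hmod_iff hinner_eq coord_add coord_scaleC coord_ract coord_zero
    l2.H_0 l2.H_add l2.H_scaleC l2.ract_closed l2.ip_add_right l2.ip_scaleC_right l2.ip_ract l2.star_ip l2.cpos_ip)

lemma hmod_hn: "semi_hilbert_module.hn (hinner \<alpha>) = hnorm \<alpha>"
  by (simp add: semi_hilbert_module.hn_def[OF hmod_module] hnorm_def fun_eq_iff)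

lemma hnorm_eq: "hnorm \<alpha> \<xi> = l2_norm (coord \<xi>)"
  by (simp add: hnorm_def hinner_eq l2.hn_def)

sublocale hm: hilbert_module "\<H>" "hinner \<alpha>" "\<lambda>\<xi> a g. \<xi> g * \<alpha> g a"
  rewrites "semi_hilbert_module.hn (hinner \<alpha>) = hnorm \<alpha>"
    and "semi_hilbert_module.opn \<H> (hinner \<alpha>) = opnorm"
proof -
  interpret semi_hilbert_module "\<H>" "hinner \<alpha>" "\<lambda>\<xi> a g. \<xi> g * \<alpha> g a" by (rule hmod_module)
  show "hilbert_module \<H> (hinner \<alpha>) (\<lambda>\<xi> a g. \<xi> g * \<alpha> g a)"
  proof
    fix \<xi> assume "\<xi> \<in> \<H>" "hinner \<alpha> \<xi> \<xi> = 0"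
    then show "\<xi> = 0" using l2.ip_definite[of "coord \<xi>"] by (simp add: hmod_iff hinner_eq coord_eq_0)
  next
    fix X assume X: "\<And>n::nat. X n \<in> \<H>" and C: "\<And>e. 0 < e ==> \<exists>N. \<forall>m\<ge>N. \<forall>n\<ge>N. hn (X m - X n) < e"
    have "\<exists>x\<in>l2. (\<lambda>n. l2_norm (coord (X n) - x)) \<longlonglongrightarrow> 0"
      by (rule l2.complete) (use X C in \<open>simp_all add: hmod_iff hmod_hn hnorm_eq coord_diff\<close>)
    then obtain x where "x \<in> l2" "(\<lambda>n. l2_norm (coord (X n) - x)) \<longlonglongrightarrow> 0" by blast
    then show "\<exists>\<xi>\<in>\<H>. (\<lambda>n. hn (X n - \<xi>)) \<longlonglongrightarrow> 0"
      by (intro bexI[of _ "\<lambda>g. \<alpha> g (x g)"])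
        (simp_all add: hmod_iff hmod_hn hnorm_eq coord_diff coord_inverse)
  qed
  show "hn = hnorm \<alpha>" by (rule hmod_hn)
  show "opn = opnorm" by (simp add: opn_def op_norm_def hmod_hn fun_eq_iff)
qed

section \<open>Adjointable operators\<close>

lemma is_adjoint_iff:
  "F \<in> self_maps \<H> ==> G \<in> self_maps \<H> ==> is_adjoint \<alpha> F G \<longleftrightarrow> hm.adjoint_pair F G"
  by (auto simp: is_adjoint_def hm.adjoint_pair_def self_maps_def)

lemma adj_eqI:
  assumes "F \<in> self_maps \<H>" "G \<in> self_maps \<H>" "hm.adjoint_pair F G"
  shows "adj \<alpha> F = G"
  unfolding adj_def
proof (rule the_equality)
  show "G \<in> self_maps \<H> \<and> is_adjoint \<alpha> F G" using assms by (simp add: is_adjoint_iff)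
  fix G' assume "G' \<in> self_maps \<H> \<and> is_adjoint \<alpha> F G'"
  then show "G' = G"
    using assms hm.adjoint_unique[of F G' G] by (auto intro!: self_maps_eqI simp: is_adjoint_iff)
qed

lemma adjointableI:
  assumes "F \<in> self_maps \<H>" "G \<in> self_maps \<H>" "hm.adjoint_pair F G"
  shows "F \<in> \<L>"
  using assms unfolding adjointable_def by (auto simp: is_adjoint_iff)

lemma adjointable_self_map: "F \<in> \<L> ==> F \<in> self_maps \<H>"
  by (simp add: adjointable_def)

lemma
  assumes "F \<in> \<L>"
  shows adj_self_map: "adj \<alpha> F \<in> self_maps \<H>" and adjoint_pair_adj: "hm.adjoint_pair F (adj \<alpha> F)"
proof -
  obtain G where G: "G \<in> self_maps \<H>" "hm.adjoint_pair F G"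
    using assms by (auto simp: adjointable_def is_adjoint_iff)
  then have "adj \<alpha> F = G" using adj_eqI[OF adjointable_self_map[OF assms]] by blast
  then show "adj \<alpha> F \<in> self_maps \<H>" "hm.adjoint_pair F (adj \<alpha> F)" using G by simp_all
qed

lemma adjointable_bounded_op: "F \<in> \<L> ==> hm.bounded_op F"
  by (rule hm.adjoint_pair_bounded_op[OF adjoint_pair_adj])

lemma adj_adjointable: "F \<in> \<L> ==> adj \<alpha> F \<in> \<L>"
  using adj_self_map adjoint_pair_adj adjointable_self_map hm.adjoint_pair_commute adjointableI by metis

lemma adj_adj: "F \<in> \<L> ==> adj \<alpha> (adj \<alpha> F) = F"
  by (intro adj_eqI adj_self_map adjointable_self_map hm.adjoint_pair_commute[OF adjoint_pair_adj])

lemma adjoint_pair_add: "hm.adjoint_pair F F' ==> hm.adjoint_pair G G' ==> hm.adjoint_pair (F + G) (F' + G')"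
  by (auto simp: hm.adjoint_pair_def hm.H_add hm.ip_add_left hm.ip_add_right)

lemma adjoint_pair_scaleC: "hm.adjoint_pair F F' ==> hm.adjoint_pair (c *\<^sub>C F) (cnj c *\<^sub>C F')"
  by (auto simp: hm.adjoint_pair_def hm.H_scaleC hm.ip_scaleC_left hm.ip_scaleC_right)

lemma hmod_self_maps: "csubspace (self_maps \<H>)"
  by (rule csubspace_self_maps[OF hm.H])

lemma
  assumes "F \<in> \<L>" "G \<in> \<L>"
  shows adjointable_add: "F + G \<in> \<L>" and adj_add: "adj \<alpha> (F + G) = adj \<alpha> F + adj \<alpha> G"
proof -
  note * = csubspace_add[OF hmod_self_maps] adjointable_self_map adj_self_map adjoint_pair_add adjoint_pair_adj assms
  show "F + G \<in> \<L>" by (rule adjointableI[of _ "adj \<alpha> F + adj \<alpha> G"]) (intro *)+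
  show "adj \<alpha> (F + G) = adj \<alpha> F + adj \<alpha> G" by (rule adj_eqI) (intro *)+
qed

lemma
  assumes "F \<in> \<L>"
  shows adjointable_scaleC: "c *\<^sub>C F \<in> \<L>" and adj_scaleC: "adj \<alpha> (c *\<^sub>C F) = cnj c *\<^sub>C adj \<alpha> F"
proof -
  note * = csubspace_scaleC[OF hmod_self_maps] adjointable_self_map adj_self_map adjoint_pair_scaleC
    adjoint_pair_adj assms
  show "c *\<^sub>C F \<in> \<L>" by (rule adjointableI[of _ "cnj c *\<^sub>C adj \<alpha> F"]) (intro *)+
  show "adj \<alpha> (c *\<^sub>C F) = cnj c *\<^sub>C adj \<alpha> F" by (rule adj_eqI) (intro *)+
qed

lemma adjointable_0: "0 \<in> \<L>"
  by (rule adjointableI[of _ 0])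
    (auto simp: hm.adjoint_pair_def hm.H_0 hm.ip_zero_left hm.ip_zero_right csubspace_0[OF hmod_self_maps])

lemma csubspace_adjointable: "csubspace \<L>"
  by (simp add: csubspace_def adjointable_0 adjointable_add adjointable_scaleC)

lemma adj_diff: "F \<in> \<L> ==> G \<in> \<L> ==> adj \<alpha> (F - G) = adj \<alpha> F - adj \<alpha> G"
  using adj_add[of F "(-1) *\<^sub>C G"] adj_scaleC[of G "-1"] adjointable_scaleC[of G "-1"]
  by (simp add: scaleC_minus_one)

lemma op_norm_adj: "F \<in> \<L> ==> opnorm (adj \<alpha> F) = opnorm F"
  by (intro hm.opn_adjoint adjoint_pair_adj adjointable_bounded_op adj_adjointable)

lemma op_norm_eq_0D:
  assumes F: "F \<in> \<L>" "opnorm F = 0"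
  shows "F = 0"
proof (rule self_maps_eqI[OF adjointable_self_map[OF F(1)] csubspace_0[OF hmod_self_maps]])
  fix \<xi> assume x: "\<xi> \<in> \<H>"
  then have "hnorm \<alpha> (F \<xi>) = 0"
    using hm.opn_bound[OF adjointable_bounded_op[OF F(1)] x] F(2) hm.hn_nonneg[of "F \<xi>"] by simp
  then show "F \<xi> = 0 \<xi>" 
    using hm.hn_eq_0 self_maps_closed[OF adjointable_self_map[OF F(1)] x] by simp
qed

lemma op_norm_nonneg: "F \<in> \<L> ==> 0 \<le> opnorm F"
  by (rule hm.opn_nonneg[OF adjointable_bounded_op])

lemma op_norm_zero [simp]: "opnorm 0 = 0"
  using hm.opn_le[of 0 0] op_norm_nonneg[OF adjointable_0] by simp

theorem adjointable_complete:
  assumes X: "\<And>n. X n \<in> \<L>"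
    and C: "\<And>e. 0 < e ==> \<exists>N. \<forall>m\<ge>N. \<forall>n\<ge>N. opnorm (X m - X n) < e"
  obtains F where "F \<in> \<L>" "(\<lambda>n. opnorm (X n - F)) \<longlonglongrightarrow> 0"
proof -
  obtain F G where F: "hm.adjoint_pair F G" "\<And>x. x \<notin> \<H> ==> F x = 0" "\<And>x. x \<notin> \<H> ==> G x = 0"
    "(\<lambda>n. opnorm (X n - F)) \<longlonglongrightarrow> 0"
    using hm.adjoint_pair_limit[of X "\<lambda>n. adj \<alpha> (X n)", OF adjoint_pair_adj[OF X] C] by blast
  have "F \<in> self_maps \<H>" "G \<in> self_maps \<H>"
    using F(1-3) by (auto simp: self_maps_def hm.adjoint_pair_def)
  then show thesis using that adjointableI F(1,4) by blast
qed

section \<open>Matrices of operators\<close>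

text \<open>The terms with index at least \<open>n\<close> are arbitrary, as they are in the definition of the matrix
  norm.\<close>

definition hsum :: "nat => (nat => 'g => 'a) set"
  where "hsum n = {\<xi>. \<forall>j<n. \<xi> j \<in> \<H>}"

definition hsum_ip :: "nat => (nat => 'g => 'a) => (nat => 'g => 'a) => 'a"
  where "hsum_ip n \<xi> \<eta> = (\<Sum>i<n. hinner \<alpha> (\<xi> i) (\<eta> i))"

text \<open>The rows with index at least \<open>n\<close> are set to zero, since their entries need not be linear.\<close>

definition mat_op :: "nat => (nat => nat => ('g, 'a) operator) => (nat => 'g => 'a) => nat => 'g => 'a"
  where "mat_op n b \<xi> i = (if i < n then \<Sum>j<n. b i j (\<xi> j) else 0)"

lemma hsum_module: "semi_hilbert_module (hsum n) (hsum_ip n) (\<lambda>\<xi> a i g. \<xi> i g * \<alpha> g a)"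
  by standard
    (auto simp: hsum_def hsum_ip_def csubspace_def hm.H_0 hm.H_add hm.H_scaleC hm.ract_closed
      hm.ip_add_right hm.ip_scaleC_right hm.ip_ract hm.star_ip sum.distrib scaleC_sum_right star_sum
      sum_distrib_right intro!: cpos_sum hm.cpos_ip sum.cong)

lemma hsum_hn: "semi_hilbert_module.hn (hsum_ip n) = hnorm_sum \<alpha> n"
  by (simp add: semi_hilbert_module.hn_def[OF hsum_module] hnorm_sum_def hsum_ip_def fun_eq_iff)

sublocale hs: semi_hilbert_module "hsum n" "hsum_ip n" "\<lambda>\<xi> a i g. \<xi> i g * \<alpha> g a"
  rewrites "semi_hilbert_module.hn (hsum_ip n) = hnorm_sum \<alpha> n" for n
  by (rule hsum_module) (rule hsum_hn)

lemma matrix_norm_eq: "mnorm n b = hs.opn n (mat_op n b)"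
proof -
  have "hnorm_sum \<alpha> n (\<lambda>i. \<Sum>j<n. b i j (\<xi> j)) = hnorm_sum \<alpha> n (mat_op n b \<xi>)" for \<xi>
    unfolding hnorm_sum_def by (simp add: mat_op_def)
  then show ?thesis unfolding matrix_norm_def hs.opn_def by (simp add: hsum_def)
qed

lemma hnorm_le_hnorm_sum:
  assumes "\<xi> \<in> hsum n" "i < n"
  shows "hnorm \<alpha> (\<xi> i) \<le> hnorm_sum \<alpha> n \<xi>"
proof -
  have "(\<Sum>j<n. hinner \<alpha> (\<xi> j) (\<xi> j)) = hinner \<alpha> (\<xi> i) (\<xi> i) + (\<Sum>j\<in>{..<n} - {i}. hinner \<alpha> (\<xi> j) (\<xi> j))"
    using assms(2) by (simp add: sum.remove)
  moreover have "cpos (\<Sum>j\<in>{..<n} - {i}. hinner \<alpha> (\<xi> j) (\<xi> j))"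
    using assms(1) by (auto simp: hsum_def intro!: cpos_sum hm.cpos_ip)
  moreover have "cpos (hinner \<alpha> (\<xi> i) (\<xi> i))" using assms by (auto simp: hsum_def intro!: hm.cpos_ip)
  ultimately show ?thesis unfolding hnorm_def hnorm_sum_def
    by (intro real_sqrt_le_mono cpos_norm_mono) simp_all
qed

lemma hnorm_sum_le: "hnorm_sum \<alpha> n \<xi> \<le> (\<Sum>i<n. hnorm \<alpha> (\<xi> i))"
proof -
  have "hnorm_sum \<alpha> n \<xi> \<le> sqrt (\<Sum>i<n. (hnorm \<alpha> (\<xi> i))\<^sup>2)"
    unfolding hnorm_sum_def by (intro real_sqrt_le_mono order.trans[OF norm_sum]) (simp add: hnorm_def)
  also have "\<dots> \<le> (\<Sum>i<n. hnorm \<alpha> (\<xi> i))"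
    using L2_set_le_sum[of "{..<n}" "\<lambda>i. hnorm \<alpha> (\<xi> i)"] by (simp add: L2_set_def)
  finally show ?thesis .
qed

lemma matricesD: "b \<in> matrices n B ==> i < n ==> j < n ==> b i j \<in> B"
  by (simp add: matrices_def)

lemma mat_op_bound:
  assumes b: "b \<in> matrices n \<L>" and x: "\<xi> \<in> hsum n"
  shows "hnorm_sum \<alpha> n (mat_op n b \<xi>) \<le> (\<Sum>i<n. \<Sum>j<n. opnorm (b i j)) * hnorm_sum \<alpha> n \<xi>"
proof -
  have xj: "\<xi> j \<in> \<H>" if "j < n" for j using x that by (simp add: hsum_def)
  have bo: "hm.bounded_op (b i j)" "b i j (\<xi> j) \<in> \<H>" if "i < n" "j < n" for i j
    using matricesD[OF b that] xj that by (auto intro: adjointable_bounded_op self_maps_closed adjointable_self_map)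
  have "hnorm_sum \<alpha> n (mat_op n b \<xi>) \<le> (\<Sum>i<n. hnorm \<alpha> (mat_op n b \<xi> i))" by (rule hnorm_sum_le)
  also have "\<dots> \<le> (\<Sum>i<n. \<Sum>j<n. opnorm (b i j) * hnorm_sum \<alpha> n \<xi>)"
  proof (rule sum_mono)
    fix i assume i: "i \<in> {..<n}"
    have "hnorm \<alpha> (mat_op n b \<xi> i) \<le> (\<Sum>j<n. hnorm \<alpha> (b i j (\<xi> j)))"
      using hm.hn_sum[of "{..<n}" "\<lambda>j. b i j (\<xi> j)"] bo i by (simp add: mat_op_def)
    also have "\<dots> \<le> (\<Sum>j<n. opnorm (b i j) * hnorm_sum \<alpha> n \<xi>)"
    proof (rule sum_mono)
      fix j assume j: "j \<in> {..<n}"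
      show "hnorm \<alpha> (b i j (\<xi> j)) \<le> opnorm (b i j) * hnorm_sum \<alpha> n \<xi>"
        using i j x xj by (intro order.trans[OF hm.opn_bound[OF bo(1)]] mult_left_mono hnorm_le_hnorm_sum 
            hm.opn_nonneg[OF bo(1)]) auto
    qed
    finally show "hnorm \<alpha> (mat_op n b \<xi> i) \<le> (\<Sum>j<n. opnorm (b i j) * hnorm_sum \<alpha> n \<xi>)" .
  qed
  finally show ?thesis by (simp add: sum_distrib_right)
qed

lemma mat_op_bounded:
  assumes b: "b \<in> matrices n \<L>"
  shows "hs.bounded_op n (mat_op n b)"
proof -
  have bo: "hm.bounded_op (b i j)" if "i < n" "j < n" for i j
    using matricesD[OF b that] by (rule adjointable_bounded_op)
  then have "\<forall>\<xi>\<in>hsum n. mat_op n b \<xi> \<in> hsum n"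
    by (auto simp: hsum_def mat_op_def hm.bounded_op_def intro!: hm.H_sum)
  moreover have "clinear_on (hsum n) (mat_op n b)"
    unfolding clinear_on_def
  proof (intro conjI allI ballI)
    have lin: "clinear_on \<H> (b i j)" if "i < n" "j < n" for i j
      using bo[OF that] by (simp add: hm.bounded_op_def)
    fix \<xi> \<eta> c assume x: "\<xi> \<in> hsum n"
    show "mat_op n b (c *\<^sub>C \<xi>) = c *\<^sub>C mat_op n b \<xi>"
      using x by (auto simp: fun_eq_iff mat_op_def clinear_on_scaleC[OF lin] hsum_def sum_fun_apply scaleC_sum_right)
    assume y: "\<eta> \<in> hsum n"
    show "mat_op n b (\<xi> + \<eta>) = mat_op n b \<xi> + mat_op n b \<eta>"
      using x y by (auto simp: fun_eq_iff mat_op_def clinear_on_add[OF lin] hsum_def sum_fun_apply sum.distrib)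
  qed
  ultimately show ?thesis
    using mat_op_bound[OF b] unfolding hs.bounded_op_def by blast
qed

lemma matrix_norm_nonneg: "b \<in> matrices n \<L> ==> 0 \<le> mnorm n b"
  unfolding matrix_norm_eq by (intro hs.opn_nonneg mat_op_bounded)

lemma matrix_norm_le_sum:
  assumes "b \<in> matrices n \<L>"
  shows "mnorm n b \<le> (\<Sum>i<n. \<Sum>j<n. opnorm (b i j))"
  unfolding matrix_norm_eq
  by (intro hs.opn_le mat_op_bound[OF assms] sum_nonneg op_norm_nonneg matricesD[OF assms]) auto

lemma op_norm_le_matrix_norm:
  assumes b: "b \<in> matrices n \<L>" and ij: "i < n" "j < n"
  shows "opnorm (b i j) \<le> mnorm n b"
proof (rule hm.opn_le)
  fix \<xi> assume x: "\<xi> \<in> \<H>"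
  define e where "e = (\<lambda>k. if k = j then \<xi> else 0)"
  have e: "e \<in> hsum n" using x by (auto simp: e_def hsum_def hm.H_0)
  have "mat_op n b e i = (\<Sum>k<n. if k = j then b i j \<xi> else 0)"
  proof -
    have "b i k 0 = 0" if "k < n" for k
      using adjointable_bounded_op[OF matricesD[OF b ij(1) that]] clinear_on_0 hm.H_0
      by (auto simp: hm.bounded_op_def)
    then have "(\<Sum>k<n. b i k (e k)) = (\<Sum>k<n. if k = j then b i j \<xi> else 0)"
      by (intro sum.cong) (auto simp: e_def)
    then show ?thesis using ij by (simp add: mat_op_def)
  qed
  then have bi: "mat_op n b e i = b i j \<xi>" using ij by simp
  have he: "hnorm_sum \<alpha> n e = hnorm \<alpha> \<xi>"
  proof -
    have "(\<Sum>k<n. hinner \<alpha> (e k) (e k)) = (\<Sum>k<n. if k = j then hinner \<alpha> \<xi> \<xi> else 0)"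
      by (rule sum.cong) (auto simp: e_def hm.ip_zero_left hm.H_0)
    then show ?thesis using ij by (simp add: hnorm_sum_def hnorm_def)
  qed
  note bo = mat_op_bounded[OF b]
  have "hnorm \<alpha> (mat_op n b e i) \<le> hnorm_sum \<alpha> n (mat_op n b e)"
    using bo e ij by (intro hnorm_le_hnorm_sum) (auto simp: hs.bounded_op_def)
  also have "\<dots> \<le> mnorm n b * hnorm_sum \<alpha> n e"
    unfolding matrix_norm_eq by (rule hs.opn_bound[OF bo e])
  finally show "hnorm \<alpha> (b i j \<xi>) \<le> mnorm n b * hnorm \<alpha> \<xi>" by (simp add: bi he)
qed (rule matrix_norm_nonneg[OF b])

lemma matrix_norm_1: "F \<in> \<L> ==> mnorm 1 (\<lambda>i j. F) = opnorm F"
  using matrix_norm_le_sum[of "\<lambda>i j. F" 1] op_norm_le_matrix_norm[of "\<lambda>i j. F" 1 0 0]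
  by (simp add: matrices_def)

lemma mat_op_add: "mat_op n (b + c) = mat_op n b + mat_op n c"
  by (simp add: fun_eq_iff mat_op_def sum_fun_apply sum.distrib)

lemma mat_op_scaleC: "mat_op n (a *\<^sub>C b) = a *\<^sub>C mat_op n b"
  by (simp add: fun_eq_iff mat_op_def sum_fun_apply scaleC_sum_right)

lemma matrix_norm_triangle:
  "b \<in> matrices n \<L> ==> c \<in> matrices n \<L> ==>
    mnorm n (b + c) \<le> mnorm n b + mnorm n c"
  unfolding matrix_norm_eq mat_op_add by (intro hs.opn_triangle mat_op_bounded)

lemma matrix_norm_scaleC:
  "b \<in> matrices n \<L> ==> mnorm n (a *\<^sub>C b) = cmod a * mnorm n b"
  unfolding matrix_norm_eq mat_op_scaleC by (intro hs.opn_scaleC mat_op_bounded)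

lemma mat_op_adjoint:
  assumes b: "b \<in> matrices n \<L>"
  shows "hs.adjoint_pair n (mat_op n b) (mat_op n (\<lambda>i j. adj \<alpha> (b j i)))"
proof -
  let ?b' = "\<lambda>i j. adj \<alpha> (b j i)"
  have b': "?b' \<in> matrices n \<L>" using b by (simp add: matrices_def adj_adjointable)
  have bH: "b i j x \<in> \<H>" "adj \<alpha> (b i j) x \<in> \<H>" if "i < n" "j < n" "x \<in> \<H>" for i j x
    using matricesD[OF b that(1,2)] that(3) adjoint_pair_adj by (auto simp: hm.adjoint_pair_def)
  have "hsum_ip n (mat_op n b \<xi>) \<eta> = hsum_ip n \<xi> (mat_op n ?b' \<eta>)" if x: "\<xi> \<in> hsum n" and y: "\<eta> \<in> hsum n" for \<xi> \<eta>
  proof -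
    have xy: "\<xi> j \<in> \<H>" "\<eta> j \<in> \<H>" if "j < n" for j using x y that by (auto simp: hsum_def)
    have "hsum_ip n (mat_op n b \<xi>) \<eta> = (\<Sum>i<n. \<Sum>j<n. hinner \<alpha> (b i j (\<xi> j)) (\<eta> i))"
      unfolding hsum_ip_def
    proof (rule sum.cong)
      fix i assume "i \<in> {..<n}"
      then show "hinner \<alpha> (mat_op n b \<xi> i) (\<eta> i) = (\<Sum>j<n. hinner \<alpha> (b i j (\<xi> j)) (\<eta> i))"
        using hm.ip_sum_left[of "\<eta> i" "{..<n}" "\<lambda>j. b i j (\<xi> j)"] xy bH by (simp add: mat_op_def)
    qed simp
    also have "\<dots> = (\<Sum>i<n. \<Sum>j<n. hinner \<alpha> (\<xi> j) (adj \<alpha> (b i j) (\<eta> i)))"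
      using adjoint_pair_adj[OF matricesD[OF b]] xy by (intro sum.cong) (auto simp: hm.adjoint_pair_def)
    also have "\<dots> = (\<Sum>j<n. \<Sum>i<n. hinner \<alpha> (\<xi> j) (adj \<alpha> (b i j) (\<eta> i)))" by (rule sum.swap)
    also have "\<dots> = hsum_ip n \<xi> (mat_op n ?b' \<eta>)"
      unfolding hsum_ip_def
    proof (rule sum.cong)
      fix j assume "j \<in> {..<n}"
      then show "(\<Sum>i<n. hinner \<alpha> (\<xi> j) (adj \<alpha> (b i j) (\<eta> i))) = hinner \<alpha> (\<xi> j) (mat_op n ?b' \<eta> j)"
        using hm.ip_sum_right[of "\<xi> j" "{..<n}" "\<lambda>i. adj \<alpha> (b i j) (\<eta> i)"] xy bH by (simp add: mat_op_def)
    qed simp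
    finally show ?thesis .
  qed
  then show ?thesis
    using mat_op_bounded[OF b] mat_op_bounded[OF b'] by (simp add: hs.adjoint_pair_def hs.bounded_op_def)
qed

text \<open>The conjugate transpose of a matrix is its adjoint on the direct sum.\<close>

lemma matrix_norm_adjoint:
  assumes b: "b \<in> matrices n \<L>"
  shows "mnorm n (\<lambda>i j. adj \<alpha> (b j i)) = mnorm n b"
proof -
  have "(\<lambda>i j. adj \<alpha> (b j i)) \<in> matrices n \<L>" using b by (simp add: matrices_def adj_adjointable)
  then show ?thesis unfolding matrix_norm_eq by (intro hs.opn_adjoint mat_op_bounded mat_op_adjoint b)
qed

end

section \<open>Completely bounded maps\<close>

text \<open>The domain of the completely bounded maps: a norm-closed space of adjointable operators with
  the adjoints of its elements, for instance \<open>C*_r\<close>.\<close>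

locale operator_space = twisted_system \<alpha> \<sigma>
  for \<alpha> :: "'g::group_add => 'a::cstar_algebra => 'a" and \<sigma> :: "'g => 'g => 'a" +
  fixes B :: "('g, 'a) operator set"
  assumes B_adjointable: "B \<subseteq> \<L>"
    and B_subspace: "csubspace B"
    and B_closed: "F \<in> \<L> ==> (\<And>n. X n \<in> B) ==> (\<lambda>n::nat. opnorm (X n - F)) \<longlonglongrightarrow> 0 ==> F \<in> B"
    and B_adj: "F \<in> B ==> adj \<alpha> F \<in> B"
begin

abbreviation "\<D> \<equiv> cb_maps \<alpha> B"

abbreviation "cbnorm \<equiv> cb_norm \<alpha> B"

lemmas B_0 = csubspace_0[OF B_subspace] and B_add = csubspace_add[OF B_subspace]
  and B_scaleC = csubspace_scaleC[OF B_subspace] and B_diff = csubspace_diff[OF B_subspace]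

lemma BD: "F \<in> B ==> F \<in> \<L>"
  using B_adjointable by blast

lemma matrices_adjointable: "b \<in> matrices n B ==> b \<in> matrices n \<L>"
  by (auto simp: matrices_def BD)

lemma cb_maps_range: "\<Phi> \<in> \<D> ==> \<Phi> x \<in> B"
  unfolding cb_maps_def using self_maps_range[OF B_0] by blast

lemma cb_maps_linear: "\<Phi> \<in> \<D> ==> clinear_on B \<Phi>"
  and cb_maps_self_maps: "\<Phi> \<in> \<D> ==> \<Phi> \<in> self_maps B"
  by (auto simp: cb_maps_def)

lemma matrices_map: "\<Phi> \<in> \<D> ==> (\<lambda>i j. \<Phi> (b i j)) \<in> matrices n B"
  by (simp add: matrices_def cb_maps_range)

lemma cb_mapsI:
  assumes "\<Phi> \<in> self_maps B" "clinear_on B \<Phi>"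
    and "\<And>n b. 1 \<le> n ==> b \<in> matrices n B ==> mnorm n (\<lambda>i j. \<Phi> (b i j)) \<le> K * mnorm n b"
  shows "\<Phi> \<in> \<D>"
  using assms unfolding cb_maps_def completely_bounded_def by blast

lemma cb_mapsD:
  assumes "\<Phi> \<in> \<D>"
  obtains K where "0 \<le> K"
    "\<And>n b. 1 \<le> n ==> b \<in> matrices n B ==> mnorm n (\<lambda>i j. \<Phi> (b i j)) \<le> K * mnorm n b"
proof -
  obtain K where K: "\<And>n b. 1 \<le> n ==> b \<in> matrices n B ==> mnorm n (\<lambda>i j. \<Phi> (b i j)) \<le> K * mnorm n b"
    using assms unfolding cb_maps_def completely_bounded_def by blast
  have "mnorm n (\<lambda>i j. \<Phi> (b i j)) \<le> max K 0 * mnorm n b" if "1 \<le> n" "b \<in> matrices n B" for n b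
    by (rule order.trans[OF K[OF that]], rule mult_right_mono)
      (simp_all add: matrix_norm_nonneg matrices_adjointable that)
  then show thesis using that[of "max K 0"] by simp
qed

lemma amplification_norm_le:
  assumes \<Phi>: "\<Phi> \<in> self_maps B" and K: "0 \<le> K"
    "\<And>b. b \<in> matrices n B ==> mnorm n (\<lambda>i j. \<Phi> (b i j)) \<le> K * mnorm n b"
  shows "amplification_norm \<alpha> B n \<Phi> \<le> K"
  unfolding amplification_norm_def
proof (rule cSup_least)
  have "(\<lambda>i j. 0) \<in> matrices n B" by (simp add: matrices_def B_0)
  moreover have "mnorm n (\<lambda>i j. 0) \<le> 1"
    using matrix_norm_le_sum[OF matrices_adjointable[OF calculation]] by simp
  ultimately show "{mnorm n (\<lambda>i j. \<Phi> (b i j)) |b. b \<in> matrices n B \<and> mnorm n b \<le> 1} \<noteq> {}"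
    by blast
  fix r assume "r \<in> {mnorm n (\<lambda>i j. \<Phi> (b i j)) |b. b \<in> matrices n B \<and> mnorm n b \<le> 1}"
  then obtain b where b: "r = mnorm n (\<lambda>i j. \<Phi> (b i j))" "b \<in> matrices n B" "mnorm n b \<le> 1"
    by blast
  show "r \<le> K" using K(2)[OF b(2)] mult_left_le[OF b(3) K(1)] b(1) by simp
qed

lemma cb_norm_le:
  assumes "\<Phi> \<in> self_maps B" "0 \<le> K"
    "\<And>n b. 1 \<le> n ==> b \<in> matrices n B ==> mnorm n (\<lambda>i j. \<Phi> (b i j)) \<le> K * mnorm n b"
  shows "cbnorm \<Phi> \<le> K"
  unfolding cb_norm_def by (rule cSUP_least) (auto intro!: amplification_norm_le assms)

lemma cb_norm_bound_unit:
  assumes \<Phi>: "\<Phi> \<in> \<D>" and n: "1 \<le> n" and c: "c \<in> matrices n B" "mnorm n c \<le> 1"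
  shows "mnorm n (\<lambda>i j. \<Phi> (c i j)) \<le> cbnorm \<Phi>"
proof -
  obtain K where K: "0 \<le> K"
    "\<And>n b. 1 \<le> n ==> b \<in> matrices n B ==> mnorm n (\<lambda>i j. \<Phi> (b i j)) \<le> K * mnorm n b"
    using cb_mapsD[OF \<Phi>] by metis
  let ?S = "{mnorm n (\<lambda>i j. \<Phi> (b i j)) |b. b \<in> matrices n B \<and> mnorm n b \<le> 1}"
  have "mnorm n (\<lambda>i j. \<Phi> (c i j)) \<le> amplification_norm \<alpha> B n \<Phi>"
    unfolding amplification_norm_def
  proof (rule cSup_upper)
    show "bdd_above ?S"
    proof (rule bdd_aboveI)
      fix r assume "r \<in> ?S"
      then obtain b where b: "r = mnorm n (\<lambda>i j. \<Phi> (b i j))" "b \<in> matrices n B" "mnorm n b \<le> 1"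
        by blast
      show "r \<le> K" using K(2)[OF n b(2)] mult_left_le[OF b(3) K(1)] b(1) by linarith
    qed
  qed (use c in blast)
  also have "\<dots> \<le> cbnorm \<Phi>"
    unfolding cb_norm_def
    by (rule cSUP_upper)
      (use n amplification_norm_le[OF cb_maps_self_maps[OF \<Phi>] K(1) K(2)] in \<open>auto intro!: bdd_aboveI[of _ K]\<close>)
  finally show ?thesis .
qed

lemma cb_norm_nonneg:
  assumes \<Phi>: "\<Phi> \<in> \<D>"
  shows "0 \<le> cbnorm \<Phi>"
proof -
  have 0: "(\<lambda>i j. 0) \<in> matrices 1 B" by (simp add: matrices_def B_0)
  have "mnorm 1 (\<lambda>i j. 0) \<le> 1" using matrix_norm_1[OF adjointable_0] by simp
  then have "mnorm 1 (\<lambda>i j. \<Phi> 0) \<le> cbnorm \<Phi>" using cb_norm_bound_unit[OF \<Phi> _ 0] by simp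
  moreover have "0 \<le> mnorm 1 (\<lambda>i j. \<Phi> 0)"
    by (rule matrix_norm_nonneg[OF matrices_adjointable[OF matrices_map[OF \<Phi>]]])
  ultimately show ?thesis by simp
qed

text \<open>For \<open>mnorm n b \<noteq> 0\<close> divide \<open>b\<close> by its norm; for \<open>mnorm n b = 0\<close> complete boundedness forces
  the left side to vanish. Together with \<open>cb_norm_le\<close> this describes the completely bounded
  norm as the least constant for all matrices.\<close>

lemma cb_norm_bound:
  assumes \<Phi>: "\<Phi> \<in> \<D>" and n: "1 \<le> n" and b: "b \<in> matrices n B"
  shows "mnorm n (\<lambda>i j. \<Phi> (b i j)) \<le> cbnorm \<Phi> * mnorm n b"
proof -
  let ?m = "mnorm n b"
  note bA = matrices_adjointable[OF b]
  show ?thesis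
  proof (cases "?m = 0")
    case True
    then show ?thesis using cb_mapsD[OF \<Phi>] n b by (metis mult_zero_right)
  next
    case False
    then have m: "0 < ?m" using matrix_norm_nonneg[OF bA] by simp
    let ?r = "complex_of_real (1 / ?m)"
    have "mnorm n (\<lambda>i j. \<Phi> ((?r *\<^sub>C b) i j)) \<le> cbnorm \<Phi>"
    proof (rule cb_norm_bound_unit[OF \<Phi> n])
      show "?r *\<^sub>C b \<in> matrices n B" using b by (simp add: matrices_def B_scaleC)
      show "mnorm n (?r *\<^sub>C b) \<le> 1"
        unfolding matrix_norm_scaleC[OF bA] using m by (simp add: norm_divide)
    qed
    also have "mnorm n (\<lambda>i j. \<Phi> ((?r *\<^sub>C b) i j)) = mnorm n (?r *\<^sub>C (\<lambda>i j. \<Phi> (b i j)))"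
      unfolding matrix_norm_eq
      using b by (intro arg_cong[of _ _ "hs.opn n"])
        (auto simp: fun_eq_iff mat_op_def matrices_def clinear_on_scaleC[OF cb_maps_linear[OF \<Phi>]] intro!: sum.cong)
    also have "\<dots> = 1 / ?m * mnorm n (\<lambda>i j. \<Phi> (b i j))"
      using matrix_norm_scaleC[OF matrices_adjointable[OF matrices_map[OF \<Phi>]], of n ?r b] m
      by (simp add: norm_divide)
    finally show ?thesis using m by (simp add: field_simps)
  qed
qed

lemma op_norm_le_cb_norm:
  assumes \<Phi>: "\<Phi> \<in> \<D>" and x: "x \<in> B"
  shows "opnorm (\<Phi> x) \<le> cbnorm \<Phi> * opnorm x"
  using cb_norm_bound[OF \<Phi>, of 1 "\<lambda>i j. x"] x
  by (simp add: matrices_def matrix_norm_1[unfolded One_nat_def] BD cb_maps_range[OF \<Phi>])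

lemma cb_maps_zero: "0 \<in> \<D>"
proof (rule cb_mapsI[where K=0])
  fix n b
  have "(\<lambda>i j. 0) \<in> matrices n \<L>" by (simp add: matrices_def adjointable_0)
  from matrix_norm_le_sum[OF this] show "mnorm n (\<lambda>i j. 0 (b i j)) \<le> 0 * mnorm n b" by simp
qed (simp_all add: self_maps_def B_0 clinear_on_def)

lemma
  assumes \<Phi>: "\<Phi> \<in> \<D>" and \<Psi>: "\<Psi> \<in> \<D>"
  shows cb_maps_add: "\<Phi> + \<Psi> \<in> \<D>" 
    and cb_norm_triangle: "cbnorm (\<Phi> + \<Psi>) \<le> cbnorm \<Phi> + cbnorm \<Psi>"
proof -
  have s: "\<Phi> + \<Psi> \<in> self_maps B"
    by (intro csubspace_add[OF csubspace_self_maps[OF B_subspace]] cb_maps_self_maps assms)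
  have l: "clinear_on B (\<Phi> + \<Psi>)"
    using cb_maps_linear[OF \<Phi>] cb_maps_linear[OF \<Psi>] by (simp add: clinear_on_def scaleC_add_right)
  have m: "mnorm n (\<lambda>i j. (\<Phi> + \<Psi>) (b i j)) \<le> (cbnorm \<Phi> + cbnorm \<Psi>) * mnorm n b"
    if n: "1 \<le> n" and b: "b \<in> matrices n B" for n b
  proof -
    have "(\<lambda>i j. (\<Phi> + \<Psi>) (b i j)) = (\<lambda>i j. \<Phi> (b i j)) + (\<lambda>i j. \<Psi> (b i j))" by (simp add: fun_eq_iff)
    then show ?thesis
      using matrix_norm_triangle[OF matrices_adjointable matrices_adjointable, OF matrices_map[OF \<Phi>] matrices_map[OF \<Psi>], of n b b]
        cb_norm_bound[OF \<Phi> n b] cb_norm_bound[OF \<Psi> n b] by (simp add: distrib_right)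
  qed
  show "\<Phi> + \<Psi> \<in> \<D>" by (rule cb_mapsI[OF s l m])
  show "cbnorm (\<Phi> + \<Psi>) \<le> cbnorm \<Phi> + cbnorm \<Psi>"
    by (rule cb_norm_le[OF s _ m]) (simp add: cb_norm_nonneg assms)
qed

lemma
  assumes \<Phi>: "\<Phi> \<in> \<D>"
  shows cb_maps_scaleC: "c *\<^sub>C \<Phi> \<in> \<D>" 
    and cb_norm_scaleC_le: "cbnorm (c *\<^sub>C \<Phi>) \<le> cmod c * cbnorm \<Phi>"
proof -
  have s: "c *\<^sub>C \<Phi> \<in> self_maps B"
    by (intro csubspace_scaleC[OF csubspace_self_maps[OF B_subspace]] cb_maps_self_maps assms)
  have l: "clinear_on B (c *\<^sub>C \<Phi>)"
    using cb_maps_linear[OF \<Phi>] by (simp add: clinear_on_def scaleC_add_right scaleC_scaleC mult.commute)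
  have m: "mnorm n (\<lambda>i j. (c *\<^sub>C \<Phi>) (b i j)) \<le> (cmod c * cbnorm \<Phi>) * mnorm n b"
    if n: "1 \<le> n" and b: "b \<in> matrices n B" for n b
  proof -
    have "(\<lambda>i j. (c *\<^sub>C \<Phi>) (b i j)) = c *\<^sub>C (\<lambda>i j. \<Phi> (b i j))" by (simp add: fun_eq_iff)
    then show ?thesis
      using matrix_norm_scaleC[OF matrices_adjointable[OF matrices_map[OF \<Phi>]], of n c b]
        cb_norm_bound[OF \<Phi> n b] by (simp add: mult.assoc mult_left_mono)
  qed
  show "c *\<^sub>C \<Phi> \<in> \<D>" by (rule cb_mapsI[OF s l m])
  show "cbnorm (c *\<^sub>C \<Phi>) \<le> cmod c * cbnorm \<Phi>"
    by (rule cb_norm_le[OF s _ m]) (simp add: cb_norm_nonneg assms)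
qed

lemma cb_norm_zero: "cbnorm 0 = 0"
  using cb_norm_scaleC_le[OF cb_maps_zero, of 0] cb_norm_nonneg[OF cb_maps_zero] by simp

lemma cb_norm_scaleC:
  assumes \<Phi>: "\<Phi> \<in> \<D>"
  shows "cbnorm (c *\<^sub>C \<Phi>) = cmod c * cbnorm \<Phi>"
proof (cases "c = 0")
  case True
  then show ?thesis by (simp add: cb_norm_zero)
next
  case False
  have "cbnorm ((1/c) *\<^sub>C (c *\<^sub>C \<Phi>)) \<le> cmod (1/c) * cbnorm (c *\<^sub>C \<Phi>)"
    by (rule cb_norm_scaleC_le[OF cb_maps_scaleC[OF \<Phi>]])
  moreover have "(1/c) *\<^sub>C (c *\<^sub>C \<Phi>) = \<Phi>" using False by (simp add: scaleC_scaleC scaleC_one)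
  ultimately show ?thesis using cb_norm_scaleC_le[OF \<Phi>, of c] False by (simp add: norm_divide field_simps)
qed

lemma csubspace_cb_maps: "csubspace \<D>"
  by (simp add: csubspace_def cb_maps_zero cb_maps_add cb_maps_scaleC)

lemma cb_norm_eq_0D:
  assumes \<Phi>: "\<Phi> \<in> \<D>" and 0: "cbnorm \<Phi> = 0"
  shows "\<Phi> = 0"
proof (rule self_maps_eqI[OF cb_maps_self_maps[OF \<Phi>] cb_maps_self_maps[OF cb_maps_zero]])
  fix x assume "x \<in> B"
  then have "opnorm (\<Phi> x) \<le> 0" using op_norm_le_cb_norm[OF \<Phi>] 0 by force
  then show "\<Phi> x = 0 x"
    using op_norm_eq_0D[OF BD[OF cb_maps_range[OF \<Phi>]], of x] op_norm_nonneg[OF BD[OF cb_maps_range[OF \<Phi>]], of x] by simp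
qed

lemma
  assumes \<Phi>: "\<Phi> \<in> \<D>" and \<Psi>: "\<Psi> \<in> \<D>"
  shows cb_maps_comp: "\<Phi> \<circ> \<Psi> \<in> \<D>" 
    and cb_norm_comp: "cbnorm (\<Phi> \<circ> \<Psi>) \<le> cbnorm \<Phi> * cbnorm \<Psi>"
proof -
  have s: "\<Phi> \<circ> \<Psi> \<in> self_maps B"
    using cb_maps_range[OF \<Phi>] self_maps_outside[OF cb_maps_self_maps[OF \<Psi>]] clinear_on_0[OF cb_maps_linear[OF \<Phi>] B_0]
    by (simp add: self_maps_def)
  have l: "clinear_on B (\<Phi> \<circ> \<Psi>)"
    using cb_maps_linear[OF \<Phi>] cb_maps_linear[OF \<Psi>] cb_maps_range[OF \<Psi>] by (simp add: clinear_on_def)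
  have m: "mnorm n (\<lambda>i j. (\<Phi> \<circ> \<Psi>) (b i j)) \<le> (cbnorm \<Phi> * cbnorm \<Psi>) * mnorm n b"
    if n: "1 \<le> n" and b: "b \<in> matrices n B" for n b
    using cb_norm_bound[OF \<Phi> n matrices_map[OF \<Psi>], of b] mult_left_mono[OF cb_norm_bound[OF \<Psi> n b] cb_norm_nonneg[OF \<Phi>]]
    by (simp add: mult.assoc)
  show "\<Phi> \<circ> \<Psi> \<in> \<D>" by (rule cb_mapsI[OF s l m])
  show "cbnorm (\<Phi> \<circ> \<Psi>) \<le> cbnorm \<Phi> * cbnorm \<Psi>"
    by (rule cb_norm_le[OF s _ m]) (simp add: cb_norm_nonneg assms)
qed

lemma
  shows cb_maps_id: "restr B id \<in> \<D>" and cb_norm_id_le: "cbnorm (restr B id) \<le> 1"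
proof -
  have s: "restr B id \<in> self_maps B" by (rule restr_self_maps) simp
  have l: "clinear_on B (restr B id)" by (simp add: clinear_on_def restr_def B_add B_scaleC)
  have m: "mnorm n (\<lambda>i j. restr B id (b i j)) \<le> 1 * mnorm n b"
    if "1 \<le> n" and b: "b \<in> matrices n B" for n b
  proof -
    have "mat_op n (\<lambda>i j. restr B id (b i j)) = mat_op n b"
      using b by (auto simp: fun_eq_iff mat_op_def matrices_def restr_def intro!: sum.cong)
    then show ?thesis by (simp add: matrix_norm_eq)
  qed
  show "restr B id \<in> \<D>" by (rule cb_mapsI[OF s l m])
  show "cbnorm (restr B id) \<le> 1" by (rule cb_norm_le[OF s _ m]) simp
qed

lemma cb_norm_id:
  assumes "restr B id \<noteq> 0"
  shows "cbnorm (restr B id) = 1"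
proof -
  obtain x where "restr B id x \<noteq> 0" using assms by (metis ext zero_fun_apply)
  then have x: "x \<in> B" "x \<noteq> 0" by (auto simp: restr_def split: if_splits)
  then have "0 < opnorm x" using op_norm_eq_0D op_norm_nonneg BD by (metis order_le_less)
  moreover have "opnorm x \<le> cbnorm (restr B id) * opnorm x"
    using op_norm_le_cb_norm[OF cb_maps_id x(1)] x(1) by (simp add: restr_def)
  ultimately show ?thesis using cb_norm_id_le by simp
qed

lemma B_complete:
  assumes X: "\<And>n. X n \<in> B"
    and C: "\<And>e. 0 < e ==> \<exists>N. \<forall>m\<ge>N. \<forall>n\<ge>N. opnorm (X m - X n) < e"
  shows "\<exists>F\<in>B. (\<lambda>n. opnorm (X n - F)) \<longlonglongrightarrow> 0"
  using adjointable_complete[OF BD[OF X] C] B_closed X by metis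

lemma op_norm_limit_unique:
  assumes X: "\<And>n::nat. X n \<in> \<L>" and F: "F \<in> \<L>" "(\<lambda>n. opnorm (X n - F)) \<longlonglongrightarrow> 0"
    and G: "G \<in> \<L>" "(\<lambda>n. opnorm (X n - G)) \<longlonglongrightarrow> 0"
  shows "F = G"
proof -
  have le: "opnorm (F - G) \<le> opnorm (X n - F) + opnorm (X n - G)" for n
    using hm.opn_triangle_diff[of F "X n" G] hm.opn_diff_commute[of F "X n"] X F(1) G(1)
    by (simp add: adjointable_bounded_op)
  have "(\<lambda>n. opnorm (X n - F) + opnorm (X n - G)) \<longlonglongrightarrow> 0 + 0" by (intro tendsto_add F G)
  then have "opnorm (F - G) \<le> 0 + 0" by (rule LIMSEQ_le_const) (use le in blast)
  moreover have FG: "F - G \<in> \<L>" by (intro csubspace_diff[OF csubspace_adjointable] F G)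
  ultimately have "opnorm (F - G) = 0" using op_norm_nonneg[OF FG] by simp
  then show ?thesis using op_norm_eq_0D[OF FG] by simp
qed

text \<open>The maps converge at each \<open>x\<close>, and a matrix over \<open>B\<close> has finitely many entries; so the
  estimates for \<open>X n - X m\<close> on matrices pass to the limit \<open>m \<rightarrow> \<infinity>\<close>.\<close>

theorem cb_maps_complete:
  assumes X: "\<And>n. X n \<in> \<D>"
    and C: "\<And>e. 0 < e ==> \<exists>N. \<forall>m\<ge>N. \<forall>n\<ge>N. cbnorm (X m - X n) < e"
  shows "\<exists>\<Phi>\<in>\<D>. (\<lambda>n. cbnorm (X n - \<Phi>)) \<longlonglongrightarrow> 0 \<and>
    (\<forall>x\<in>B. (\<lambda>n. opnorm (X n x - \<Phi> x)) \<longlonglongrightarrow> 0)"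
proof -
  have Xd: "X m - X n \<in> \<D>" for m n by (intro csubspace_diff[OF csubspace_cb_maps] X)
  have "\<exists>y. y \<in> B \<and> (\<lambda>n. opnorm (X n x - y)) \<longlonglongrightarrow> 0" if x: "x \<in> B" for x
  proof -
    have "\<exists>F\<in>B. (\<lambda>n. opnorm (X n x - F)) \<longlonglongrightarrow> 0"
    proof (rule B_complete[OF cb_maps_range[OF X]])
      fix e :: real assume "0 < e"
      have ox: "0 \<le> opnorm x" by (intro op_norm_nonneg BD x)
      then have "0 < e / (opnorm x + 1)" using \<open>0 < e\<close> by simp
      from C[OF this] obtain N where N: "\<And>m n. m \<ge> N ==> n \<ge> N ==> cbnorm (X m - X n) < e / (opnorm x + 1)"
        by blast
      have "opnorm (X m x - X n x) < e" if "m \<ge> N" "n \<ge> N" for m n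
      proof -
        have "opnorm (X m x - X n x) \<le> cbnorm (X m - X n) * opnorm x"
          using op_norm_le_cb_norm[OF Xd x, of m n] by simp
        also have "\<dots> \<le> cbnorm (X m - X n) * (opnorm x + 1)"
          by (intro mult_left_mono cb_norm_nonneg Xd) simp
        also have "\<dots> < e" using N[OF that] ox by (simp add: field_simps)
        finally show ?thesis .
      qed
      then show "\<exists>N. \<forall>m\<ge>N. \<forall>n\<ge>N. opnorm (X m x - X n x) < e" by blast
    qed
    then show ?thesis by blast
  qed
  then have "\<forall>x. \<exists>y. (x \<in> B --> y \<in> B \<and> (\<lambda>n. opnorm (X n x - y)) \<longlonglongrightarrow> 0) \<and> (x \<notin> B --> y = 0)" by blast
  then obtain \<Phi> where \<Phi>: "\<And>x. x \<in> B ==> \<Phi> x \<in> B" "\<And>x. x \<in> B ==> (\<lambda>n. opnorm (X n x - \<Phi> x)) \<longlonglongrightarrow> 0"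
     "\<And>x. x \<notin> B ==> \<Phi> x = 0" by metis
  have s: "\<Phi> \<in> self_maps B" using \<Phi> by (simp add: self_maps_def)
  note XA = BD[OF cb_maps_range[OF X]]
  have l: "clinear_on B \<Phi>"
    unfolding clinear_on_def
  proof (intro conjI allI ballI)
    fix x y c assume x: "x \<in> B"
    have "(\<lambda>n. cmod c * opnorm (X n x - \<Phi> x)) \<longlonglongrightarrow> cmod c * 0" by (intro tendsto_intros \<Phi> x)
    moreover have "cmod c * opnorm (X n x - \<Phi> x) = opnorm (X n (c *\<^sub>C x) - c *\<^sub>C \<Phi> x)" for n
      using hm.opn_scaleC[of "X n x - \<Phi> x" c] x \<Phi>(1)[OF x] XA[of n x]
      by (simp add: clinear_on_scaleC[OF cb_maps_linear[OF X]] adjointable_bounded_op hm.bounded_op_diff BD scaleC_diff_right)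
    ultimately have "(\<lambda>n. opnorm (X n (c *\<^sub>C x) - c *\<^sub>C \<Phi> x)) \<longlonglongrightarrow> 0" by simp
    then show "\<Phi> (c *\<^sub>C x) = c *\<^sub>C \<Phi> x"
      by (intro op_norm_limit_unique[OF XA _ \<Phi>(2)]) (auto intro!: BD \<Phi> B_scaleC x)
    assume y: "y \<in> B"
    have "(\<lambda>n. opnorm (X n (x + y) - (\<Phi> x + \<Phi> y))) \<longlonglongrightarrow> 0"
    proof (rule Lim_null_comparison, intro always_eventually allI)
      show "(\<lambda>n. opnorm (X n x - \<Phi> x) + opnorm (X n y - \<Phi> y)) \<longlonglongrightarrow> 0"
        using tendsto_add[OF \<Phi>(2)[OF x] \<Phi>(2)[OF y]] by simp
      fix n
      have eq: "X n (x + y) - (\<Phi> x + \<Phi> y) = (X n x - \<Phi> x) + (X n y - \<Phi> y)"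
        using clinear_on_add[OF cb_maps_linear[OF X] x y] by simp
      show "norm (opnorm (X n (x + y) - (\<Phi> x + \<Phi> y))) \<le> opnorm (X n x - \<Phi> x) + opnorm (X n y - \<Phi> y)"
        unfolding eq
        using hm.opn_triangle[of "X n x - \<Phi> x" "X n y - \<Phi> y"] x y XA \<Phi>(1)
           op_norm_nonneg[OF BD, of "(X n x - \<Phi> x) + (X n y - \<Phi> y)"]
        by (simp add: adjointable_bounded_op hm.bounded_op_diff BD B_add B_diff cb_maps_range[OF X])
    qed
    then show "\<Phi> (x + y) = \<Phi> x + \<Phi> y"
      by (intro op_norm_limit_unique[OF XA _ \<Phi>(2)]) (auto intro!: BD \<Phi> B_add x y)
  qed
  have dB: "X n x - \<Phi> x \<in> B" for n x
    by (intro B_diff cb_maps_range[OF X] self_maps_range[OF B_0 s])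
  have close: "mnorm k (\<lambda>i j. (X n - \<Phi>) (b i j)) \<le> e * mnorm k b"
    if N: "\<And>m n. m \<ge> N ==> n \<ge> N ==> cbnorm (X m - X n) < e" and n: "n \<ge> N"
      and k: "1 \<le> k" and b: "b \<in> matrices k B" for e N n k b
  proof -
    have le: "mnorm k (\<lambda>i j. (X n - \<Phi>) (b i j)) \<le>
        e * mnorm k b + (\<Sum>i<k. \<Sum>j<k. opnorm (X m (b i j) - \<Phi> (b i j)))" if m: "m \<ge> N" for m
    proof -
      let ?u = "\<lambda>i j. (X n - X m) (b i j)" and ?v = "\<lambda>i j. X m (b i j) - \<Phi> (b i j)"
      have v: "?v \<in> matrices k \<L>" by (simp add: matrices_def BD dB)
      have "(\<lambda>i j. (X n - \<Phi>) (b i j)) = ?u + ?v" by (simp add: fun_eq_iff)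
      then have "mnorm k (\<lambda>i j. (X n - \<Phi>) (b i j)) \<le> mnorm k ?u + mnorm k ?v"
        using matrix_norm_triangle[OF matrices_adjointable[OF matrices_map[OF Xd]] v, of n m b] by simp
      also have "mnorm k ?u \<le> cbnorm (X n - X m) * mnorm k b"
        by (rule cb_norm_bound[OF Xd k b])
      also have "\<dots> \<le> e * mnorm k b"
        by (intro mult_right_mono less_imp_le[OF N[OF n m]] matrix_norm_nonneg matrices_adjointable b)
      finally show ?thesis using matrix_norm_le_sum[OF v] by linarith
    qed
    have "(\<lambda>m. e * mnorm k b + (\<Sum>i<k. \<Sum>j<k. opnorm (X m (b i j) - \<Phi> (b i j))))
        \<longlonglongrightarrow> e * mnorm k b + (\<Sum>i<k. \<Sum>j<k. 0)"
      by (intro tendsto_intros \<Phi>(2) matricesD[OF b]) auto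
    then have "mnorm k (\<lambda>i j. (X n - \<Phi>) (b i j)) \<le> e * mnorm k b + (\<Sum>i<k. \<Sum>j<k. 0)"
      by (rule LIMSEQ_le_const) (use le in blast)
    then show ?thesis by simp
  qed
  have dl: "clinear_on B (X n - \<Phi>)" for n
    using cb_maps_linear[OF X, of n] l by (simp add: clinear_on_def scaleC_diff_right)
  have ds: "X n - \<Phi> \<in> self_maps B" for n
    by (intro csubspace_diff[OF csubspace_self_maps[OF B_subspace]] cb_maps_self_maps X s)
  obtain N1 where N1: "\<And>m n. m \<ge> N1 ==> n \<ge> N1 ==> cbnorm (X m - X n) < 1" using C[of 1] by auto
  have "X N1 - \<Phi> \<in> \<D>" 
    by (rule cb_mapsI[OF ds dl, of N1 1], rule close[where N=N1]) (use N1 in auto)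
  then have "X N1 - (X N1 - \<Phi>) \<in> \<D>" by (rule csubspace_diff[OF csubspace_cb_maps X])
  then have \<Phi>cb: "\<Phi> \<in> \<D>" by simp
  have "(\<lambda>n. cbnorm (X n - \<Phi>)) \<longlonglongrightarrow> 0"
  proof (rule LIMSEQ_I)
    fix e :: real assume "0 < e"
    then have e: "0 < e / 2" by simp
    from C[OF e] obtain N where N: "\<And>m n. m \<ge> N ==> n \<ge> N ==> cbnorm (X m - X n) < e / 2" by blast
    have "norm (cbnorm (X n - \<Phi>) - 0) < e" if "n \<ge> N" for n
    proof -
      have "cbnorm (X n - \<Phi>) \<le> e / 2"
        by (rule cb_norm_le[OF ds], use e in simp, rule close[where N=N]) (use N that in auto)
      moreover have "0 \<le> cbnorm (X n - \<Phi>)"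
        by (intro cb_norm_nonneg csubspace_diff[OF csubspace_cb_maps] X \<Phi>cb)
      ultimately show ?thesis using \<open>0 < e\<close> by simp
    qed
    then show "\<exists>N. \<forall>n\<ge>N. norm (cbnorm (X n - \<Phi>) - 0) < e" by blast
  qed
  then show ?thesis using \<Phi>cb \<Phi>(2) by blast
qed

theorem cb_maps_banach_algebra:
  "unital_banach_algebra \<D> (\<circ>) (restr B id) cbnorm"
proof
  fix x y z :: "('g, 'a) operator => ('g, 'a) operator" and c
  show "csubspace \<D>" by (rule csubspace_cb_maps)
  show "x \<circ> y \<circ> z = x \<circ> (y \<circ> z)" by (rule comp_assoc)
  show "clinear_on \<D> (\<lambda>x. x \<circ> y)" by (simp add: clinear_on_def fun_eq_iff)
  show "restr B id \<in> \<D>" by (rule cb_maps_id)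
  show "restr B id \<noteq> 0 ==> cbnorm (restr B id) = 1" by (rule cb_norm_id)
  assume x: "x \<in> \<D>"
  show "clinear_on \<D> ((\<circ>) x)"
    using cb_maps_linear[OF x] by (simp add: clinear_on_def fun_eq_iff cb_maps_range)
  show "restr B id \<circ> x = x" using cb_maps_range[OF x] by (simp add: restr_def fun_eq_iff)
  show "x \<circ> restr B id = x"
    using self_maps_outside[OF cb_maps_self_maps[OF x]] clinear_on_0[OF cb_maps_linear[OF x] B_0]
    by (simp add: restr_def fun_eq_iff)
  show "0 \<le> cbnorm x" by (rule cb_norm_nonneg[OF x])
  show "(cbnorm x = 0) = (x = 0)" using cb_norm_eq_0D[OF x] cb_norm_zero by blast
  show "cbnorm (c *\<^sub>C x) = cmod c * cbnorm x" by (rule cb_norm_scaleC[OF x])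
  assume y: "y \<in> \<D>"
  show "x \<circ> y \<in> \<D>" by (rule cb_maps_comp[OF x y])
  show "cbnorm (x + y) \<le> cbnorm x + cbnorm y" by (rule cb_norm_triangle[OF x y])
  show "cbnorm (x \<circ> y) \<le> cbnorm x * cbnorm y" by (rule cb_norm_comp[OF x y])
next
  fix X :: "nat => ('g, 'a) operator => ('g, 'a) operator"
  assume "range X \<subseteq> \<D>" and C: "\<forall>\<epsilon>>0. \<exists>N. \<forall>m\<ge>N. \<forall>n\<ge>N. cbnorm (X m - X n) < \<epsilon>"
  then have "X n \<in> \<D>" for n by blast
  from cb_maps_complete[of X, OF this] C
  show "\<exists>x\<in>\<D>. (\<lambda>n. cbnorm (X n - x)) \<longlonglongrightarrow> 0" by blast
qed

lemma
  assumes \<Phi>: "\<Phi> \<in> \<D>"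
  shows cb_conj_cb_maps: "cb_conj \<alpha> B \<Phi> \<in> \<D>"
    and cb_norm_conj_le: "cbnorm (cb_conj \<alpha> B \<Phi>) \<le> cbnorm \<Phi>"
proof -
  let ?C = "cb_conj \<alpha> B \<Phi>"
  have C: "?C x = adj \<alpha> (\<Phi> (adj \<alpha> x))" if "x \<in> B" for x using that by (simp add: cb_conj_def restr_def)
  have s: "?C \<in> self_maps B" unfolding cb_conj_def
    by (rule restr_self_maps) (intro B_adj cb_maps_range[OF \<Phi>])
  have l: "clinear_on B ?C"
    unfolding clinear_on_def
    by (auto simp: C B_add B_scaleC adj_add adj_scaleC BD B_adj cb_maps_range[OF \<Phi>]
        clinear_on_add[OF cb_maps_linear[OF \<Phi>]] clinear_on_scaleC[OF cb_maps_linear[OF \<Phi>]])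
  have m: "mnorm n (\<lambda>i j. ?C (b i j)) \<le> cbnorm \<Phi> * mnorm n b"
    if n: "1 \<le> n" and b: "b \<in> matrices n B" for n b
  proof -
    let ?b = "\<lambda>i j. adj \<alpha> (b j i)"
    have b': "?b \<in> matrices n B" using b by (simp add: matrices_def B_adj)
    have "mat_op n (\<lambda>i j. ?C (b i j)) = mat_op n (\<lambda>i j. adj \<alpha> (\<Phi> (?b j i)))"
      using b by (auto simp: fun_eq_iff mat_op_def matrices_def C intro!: sum.cong)
    then have "mnorm n (\<lambda>i j. ?C (b i j)) = mnorm n (\<lambda>i j. adj \<alpha> (\<Phi> (?b j i)))"
      by (simp add: matrix_norm_eq)
    also have "\<dots> = mnorm n (\<lambda>i j. \<Phi> (?b i j))"
      by (rule matrix_norm_adjoint[OF matrices_adjointable[OF matrices_map[OF \<Phi>]]])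
    also have "\<dots> \<le> cbnorm \<Phi> * mnorm n ?b" by (rule cb_norm_bound[OF \<Phi> n b'])
    also have "mnorm n ?b = mnorm n b" by (rule matrix_norm_adjoint[OF matrices_adjointable[OF b]])
    finally show ?thesis .
  qed
  show "?C \<in> \<D>" by (rule cb_mapsI[OF s l m])
  show "cbnorm ?C \<le> cbnorm \<Phi>" by (rule cb_norm_le[OF s _ m]) (simp add: cb_norm_nonneg \<Phi>)
qed

theorem cb_conj_isometric_conjugation: "isometric_conjugation \<D> (\<circ>) cbnorm (cb_conj \<alpha> B)"
proof
  fix x y :: "('g, 'a) operator => ('g, 'a) operator" and c
  assume x: "x \<in> \<D>"
  show "cb_conj \<alpha> B x \<in> \<D>" by (rule cb_conj_cb_maps[OF x])
  show cc: "cb_conj \<alpha> B (cb_conj \<alpha> B x) = x"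
    using self_maps_outside[OF cb_maps_self_maps[OF x]]
    by (auto simp: cb_conj_def restr_def fun_eq_iff B_adj adj_adj BD cb_maps_range[OF x])
  show "cb_conj \<alpha> B (c *\<^sub>C x) = cnj c *\<^sub>C cb_conj \<alpha> B x"
    by (auto simp: cb_conj_def restr_def fun_eq_iff adj_scaleC BD cb_maps_range[OF x])
  show "cbnorm (cb_conj \<alpha> B x) = cbnorm x"
    using cb_norm_conj_le[OF x] cb_norm_conj_le[OF cb_conj_cb_maps[OF x]] by (simp add: cc)
  assume y: "y \<in> \<D>"
  show "cb_conj \<alpha> B (x + y) = cb_conj \<alpha> B x + cb_conj \<alpha> B y"
    by (auto simp: cb_conj_def restr_def fun_eq_iff adj_add BD cb_maps_range[OF x] cb_maps_range[OF y])
  show "cb_conj \<alpha> B (x \<circ> y) = cb_conj \<alpha> B x \<circ> cb_conj \<alpha> B y"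
  proof (rule self_maps_eqI)
    show "cb_conj \<alpha> B (x \<circ> y) \<in> self_maps B"
      by (intro cb_maps_self_maps cb_conj_cb_maps cb_maps_comp x y)
    show "cb_conj \<alpha> B x \<circ> cb_conj \<alpha> B y \<in> self_maps B"
      by (intro cb_maps_self_maps cb_conj_cb_maps cb_maps_comp x y)
  qed (simp add: cb_conj_def restr_def B_adj adj_adj BD cb_maps_range[OF y])
qed

end

section \<open>The reduced crossed product\<close>

context twisted_system
begin

lemma sigma_unitary: "(\<sigma> g h)\<^sup>\<star> * \<sigma> g h = 1" "\<sigma> g h * (\<sigma> g h)\<^sup>\<star> = 1"
  using unitary_cocycle by (auto simp: unitary_def)

lemma sigma_cancel: "(\<sigma> g h)\<^sup>\<star> * (\<sigma> g h * x) = x" "\<sigma> g h * ((\<sigma> g h)\<^sup>\<star> * x) = x"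
  by (simp_all add: sigma_unitary flip: mult.assoc)

lemma alpha_zero: "\<alpha> 0 a = a"
proof -
  have "\<alpha> 0 (\<alpha> 0 a) = \<alpha> 0 a" using twisted_action[of 0 0 a] by (simp add: normalized_left)
  then show ?thesis using a.bij[of 0] by (metis bij_is_inj injD)
qed

text \<open>The identity \<open>\<alpha>_g \<alpha>_k = Ad(\<sigma>(g, k)) \<alpha>_gk\<close>, solved for \<open>\<alpha>_k\<inverse>\<close>. It moves the \<open>k\<close>-th term of an
  inner product to the \<open>gk\<close>-th term.\<close>

lemma inv_alpha_eq: "inv (\<alpha> k) x = inv (\<alpha> (g + k)) ((\<sigma> g k)\<^sup>\<star> * \<alpha> g x * \<sigma> g k)"
proof -
  have "\<alpha> g x = \<sigma> g k * \<alpha> (g + k) (inv (\<alpha> k) x) * (\<sigma> g k)\<^sup>\<star>"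
    using twisted_action[of g k "inv (\<alpha> k) x"] by (simp add: a.inv_right)
  then have "(\<sigma> g k)\<^sup>\<star> * \<alpha> g x * \<sigma> g k = \<alpha> (g + k) (inv (\<alpha> k) x)"
    by (simp add: mult.assoc sigma_cancel sigma_unitary)
  then show ?thesis by (simp add: a.inv_left)
qed

lemma alpha_sigma_neg: "\<alpha> g (\<sigma> (- g) g) = \<sigma> g (- g)"
  using cocycle[of g "- g" g] by (simp add: normalized_left normalized_right)

lemma alpha_sigma_neg_shift: "\<alpha> g (\<sigma> (- g) (g + k)) * \<sigma> g k = \<sigma> g (- g)"
  using cocycle[of g "- g" "g + k"] by (simp add: normalized_left flip: add.assoc)

lemma alpha_alpha_neg: "\<alpha> g (\<alpha> (- g) x) = \<sigma> g (- g) * x * (\<sigma> g (- g))\<^sup>\<star>"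
  using twisted_action[of g "- g" x] by (simp add: alpha_zero)

definition wop :: "'a => 'g => ('g, 'a) operator"
  where "wop a g = ell \<alpha> a \<circ> lam \<alpha> \<sigma> g"

text \<open>The action of \<open>a \<lambda>(g)\<close> on an arbitrary function.\<close>

definition shift :: "'a => 'g => ('g => 'a) => 'g => 'a"
  where "shift a g \<xi> h = a * (\<alpha> g (\<xi> (- g + h)) * \<sigma> g (- g + h))"

text \<open>The coefficient of \<open>(a \<lambda>(g))* = \<sigma>(g\<inverse>, g)* \<alpha>_g\<inverse>(a*) \<lambda>(g\<inverse>)\<close>, where \<open>\<alpha>_g\<inverse>\<close> is the automorphism
  attached to \<open>g\<inverse>\<close>.\<close>

definition wop_star_coeff :: "'a => 'g => 'a"
  where "wop_star_coeff a g = (\<sigma> (- g) g)\<^sup>\<star> * \<alpha> (- g) (a\<^sup>\<star>)"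

lemma bij_betw_translate: "bij_betw ((+) g) UNIV (UNIV :: 'g set)"
  by (rule bij_betwI[where g="(+) (- g)"]) (auto simp flip: add.assoc)

text \<open>In coordinates \<open>a \<lambda>(g)\<close> is, up to unitaries on the left, the translation by \<open>g\<close> followed by
  multiplications on the left with elements of the same norm as \<open>a\<close>.\<close>

lemma coord_shift:
  "(coord (shift a g \<xi>) (g + k))\<^sup>\<star> * coord (shift a g \<xi>) (g + k)
    = (inv (\<alpha> k) (inv (\<alpha> g) a * \<xi> k))\<^sup>\<star> * inv (\<alpha> k) (inv (\<alpha> g) a * \<xi> k)"
proof -
  have "(inv (\<alpha> k) (inv (\<alpha> g) a * \<xi> k))\<^sup>\<star> * inv (\<alpha> k) (inv (\<alpha> g) a * \<xi> k)
      = inv (\<alpha> k) ((inv (\<alpha> g) a * \<xi> k)\<^sup>\<star> * (inv (\<alpha> g) a * \<xi> k))"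
    by (simp add: ai.mult ai.star)
  also have "\<dots> = inv (\<alpha> (g + k)) ((\<sigma> g k)\<^sup>\<star> * \<alpha> g ((inv (\<alpha> g) a * \<xi> k)\<^sup>\<star> * (inv (\<alpha> g) a * \<xi> k)) * \<sigma> g k)"
    by (rule inv_alpha_eq)
  also have "\<dots> = inv (\<alpha> (g + k)) ((shift a g \<xi> (g + k))\<^sup>\<star> * shift a g \<xi> (g + k))"
    by (simp add: shift_def a.mult a.star star_mult a.inv_right mult.assoc flip: add.assoc)
  finally show ?thesis by (simp add: coord_def ai.mult ai.star)
qed

lemma
  assumes x: "\<xi> \<in> \<H>"
  shows shift_hmod: "shift a g \<xi> \<in> \<H>" and hnorm_shift_le: "hnorm \<alpha> (shift a g \<xi>) \<le> norm a * hnorm \<alpha> \<xi>"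
proof -
  let ?y = "coord (shift a g \<xi>)"
  define z where "z k = inv (\<alpha> k) (inv (\<alpha> g) a * \<xi> k)" for k
  have cx: "coord \<xi> \<in> l2" using x by (simp add: hmod_iff)
  have zF: "fin_norm F z \<le> norm a * fin_norm F (coord \<xi>)" for F
  proof (rule fin_norm_dominated)
    fix k
    define d where "d = inv (\<alpha> k) (inv (\<alpha> g) a)"
    have zk: "z k = d * coord \<xi> k" by (simp add: z_def d_def coord_def ai.mult)
    have "norm (d\<^sup>\<star> * d) \<le> (norm a)\<^sup>2" by (simp add: cstar_identity d_def)
    then have "cpos ((norm a)\<^sup>2 *\<^sub>R 1 - d\<^sup>\<star> * d)" by (intro cpos_scale_minus) (simp_all add: star_mult star_star)
    then have "cpos ((coord \<xi> k)\<^sup>\<star> * ((norm a)\<^sup>2 *\<^sub>R 1 - d\<^sup>\<star> * d) * coord \<xi> k)" by (rule cpos_conjugate)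
    then show "cpos ((norm a)\<^sup>2 *\<^sub>R ((coord \<xi> k)\<^sup>\<star> * coord \<xi> k) - (z k)\<^sup>\<star> * z k)"
      by (simp add: zk star_mult algebra_simps)
  qed simp
  have zl: "z \<in> l2" by (rule l2_dominated[OF cx zF])
  have yz: "(?y (g + k))\<^sup>\<star> * ?y (g + k) = (z k)\<^sup>\<star> * z k" for k by (simp add: coord_shift z_def)
  have "(\<lambda>k. (?y (g + k))\<^sup>\<star> * ?y (g + k)) summable_on UNIV" using zl by (simp add: yz l2_def)
  then have "(\<lambda>k. (?y k)\<^sup>\<star> * ?y k) summable_on UNIV"
    by (subst (asm) summable_on_reindex_bij_betw[OF bij_betw_translate])
  then show "shift a g \<xi> \<in> \<H>" by (simp add: hmod_iff l2_def)
  have "l2_ip ?y ?y = l2_ip z z"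
    unfolding l2_ip_def by (subst infsum_reindex_bij_betw[OF bij_betw_translate[of g], symmetric]) (simp add: yz)
  then have "hnorm \<alpha> (shift a g \<xi>) = l2_norm z" by (simp add: hnorm_eq l2.hn_def)
  also have "\<dots> \<le> norm a * hnorm \<alpha> \<xi>" unfolding hnorm_eq
    by (rule l2_norm_le[OF zl], rule order.trans[OF zF], rule mult_left_mono[OF fin_norm_le_l2_norm[OF cx]]) auto
  finally show "hnorm \<alpha> (shift a g \<xi>) \<le> norm a * hnorm \<alpha> \<xi>" .
qed

text \<open>By the cocycle identity the two inner products agree term by term after the substitution
  \<open>h = gk\<close>.\<close>

lemma hinner_shift: "hinner \<alpha> (shift a g \<xi>) \<eta> = hinner \<alpha> \<xi> (shift (wop_star_coeff a g) (- g) \<eta>)"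
proof -
  let ?\<zeta> = "shift (wop_star_coeff a g) (- g) \<eta>"
  have adjoint: "\<alpha> g (?\<zeta> k) * \<sigma> g k = a\<^sup>\<star> * \<eta> (g + k)" for k
  proof -
    have "\<alpha> g (?\<zeta> k) * \<sigma> g k
        = (\<alpha> g (\<sigma> (- g) g))\<^sup>\<star> * (\<alpha> g (\<alpha> (- g) (a\<^sup>\<star>)) * \<alpha> g (\<alpha> (- g) (\<eta> (g + k)))) * (\<alpha> g (\<sigma> (- g) (g + k)) * \<sigma> g k)"
      by (simp add: shift_def wop_star_coeff_def a.mult a.star mult.assoc)
    also have "\<dots> = a\<^sup>\<star> * \<eta> (g + k)"
      by (simp add: alpha_sigma_neg alpha_sigma_neg_shift alpha_alpha_neg mult.assoc sigma_cancel sigma_unitary)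
    finally show ?thesis .
  qed
  have "inv (\<alpha> (g + k)) ((shift a g \<xi> (g + k))\<^sup>\<star> * \<eta> (g + k)) = inv (\<alpha> k) ((\<xi> k)\<^sup>\<star> * ?\<zeta> k)" for k
  proof -
    have "inv (\<alpha> k) ((\<xi> k)\<^sup>\<star> * ?\<zeta> k) = inv (\<alpha> (g + k)) ((\<sigma> g k)\<^sup>\<star> * (\<alpha> g (\<xi> k))\<^sup>\<star> * (\<alpha> g (?\<zeta> k) * \<sigma> g k))"
      by (subst inv_alpha_eq[of k _ g]) (simp add: a.mult a.star mult.assoc)
    also have "\<dots> = inv (\<alpha> (g + k)) ((shift a g \<xi> (g + k))\<^sup>\<star> * \<eta> (g + k))"
      unfolding adjoint by (simp add: shift_def star_mult mult.assoc flip: add.assoc)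
    finally show ?thesis by simp
  qed
  then show ?thesis
    unfolding hinner_def by (subst infsum_reindex_bij_betw[OF bij_betw_translate[of g], symmetric]) simp
qed

lemma wop_apply: "wop a g \<xi> = (if \<xi> \<in> \<H> then shift a g \<xi> else 0)"
proof (cases "\<xi> \<in> \<H>")
  case True
  have "(\<lambda>h. \<alpha> g (\<xi> (- g + h)) * \<sigma> g (- g + h)) \<in> \<H>"
    using shift_hmod[OF True, of 1 g] by (simp add: shift_def[abs_def])
  then show ?thesis using True by (simp add: wop_def lam_def ell_def restr_def shift_def[abs_def])
next
  case False
  then show ?thesis by (simp add: wop_def lam_def ell_def restr_def fun_eq_iff)
qed

lemma wop_self_map: "wop a g \<in> self_maps \<H>"
  by (simp add: self_maps_def wop_apply shift_hmod)

lemma wop_adjoint_pair: "hm.adjoint_pair (wop a g) (wop (wop_star_coeff a g) (- g))"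
  by (simp add: hm.adjoint_pair_def wop_apply shift_hmod hinner_shift)

lemma wop_adjointable: "wop a g \<in> \<L>"
  by (rule adjointableI[OF wop_self_map wop_self_map wop_adjoint_pair])

lemma adj_wop: "adj \<alpha> (wop a g) = wop (wop_star_coeff a g) (- g)"
  by (rule adj_eqI[OF wop_self_map wop_self_map wop_adjoint_pair])

lemma op_norm_wop_le: "opnorm (wop a g) \<le> norm a"
  by (rule hm.opn_le) (simp_all add: wop_apply hnorm_shift_le)

lemma wop_add: "wop (a + b) g = wop a g + wop b g"
  by (simp add: fun_eq_iff wop_apply shift_def distrib_right)

lemma wop_scaleC: "wop (c *\<^sub>C a) g = c *\<^sub>C wop a g"
  by (simp add: fun_eq_iff wop_apply shift_def mult_scaleC_left)

lemma wop_zero: "wop 0 g = 0"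
  by (simp add: fun_eq_iff wop_apply shift_def)

lemma adj_sum: "(\<And>i. i \<in> I ==> F i \<in> \<L>) ==> adj \<alpha> (\<Sum>i\<in>I. F i) = (\<Sum>i\<in>I. adj \<alpha> (F i))"
proof (induction I rule: infinite_finite_induct)
  case (insert i I)
  have "adj \<alpha> (F i + sum F I) = adj \<alpha> (F i) + adj \<alpha> (sum F I)"
    by (intro adj_add csubspace_sum[OF csubspace_adjointable] insert.prems) simp_all
  also have "adj \<alpha> (sum F I) = (\<Sum>i\<in>I. adj \<alpha> (F i))" by (rule insert.IH) (simp add: insert.prems)
  finally show ?case unfolding sum.insert[OF insert.hyps(1,2)] .
qed (use adj_scaleC[OF adjointable_0, of 0] in simp_all)

lemma op_norm_sum_le:
  "(\<And>i. i \<in> I ==> F i \<in> \<L>) ==> opnorm (\<Sum>i\<in>I. F i) \<le> (\<Sum>i\<in>I. opnorm (F i))"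
proof (induction I rule: infinite_finite_induct)
  case (insert i I)
  have "opnorm (F i + sum F I) \<le> opnorm (F i) + opnorm (sum F I)"
    by (intro hm.opn_triangle adjointable_bounded_op csubspace_sum[OF csubspace_adjointable] insert.prems) simp_all
  moreover have "opnorm (sum F I) \<le> (\<Sum>i\<in>I. opnorm (F i))"
    by (rule insert.IH) (simp add: insert.prems)
  ultimately show ?case unfolding sum.insert[OF insert.hyps(1,2)] by linarith
qed simp_all

lemma Lam_eq_sum:
  assumes "finite S" "\<And>g. g \<notin> S ==> f g = 0"
  shows "\<Lambda> f = (\<Sum>g\<in>S. wop (f g) g)"
  unfolding Lam_def wop_def[symmetric]
  by (rule sum.mono_neutral_left) (use assms wop_zero in auto)

lemma CcE:
  assumes "f \<in> Cc"
  obtains S where "finite S" "\<And>g. g \<notin> S ==> f g = 0"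
  by (rule that[of "{g. f g \<noteq> 0}"]) (use assms in \<open>auto simp: Cc_def\<close>)

lemma CcI: "finite S ==> (\<And>g. g \<notin> S ==> f g = 0) ==> f \<in> Cc"
  unfolding Cc_def by (auto elim!: rev_finite_subset)

lemma csubspace_Cc: "csubspace (Cc :: ('g => 'a) set)"
  unfolding csubspace_def
proof (intro conjI ballI allI)
  show "(0 :: 'g => 'a) \<in> Cc" by (simp add: Cc_def)
  fix f f' :: "'g => 'a" and c assume f: "f \<in> Cc"
  then obtain S where S: "finite S" "\<And>g. g \<notin> S ==> f g = 0" by (rule CcE) blast
  then show "c *\<^sub>C f \<in> Cc" by (auto intro!: CcI[of S])
  assume "f' \<in> Cc"
  then obtain S' where "finite S'" "\<And>g. g \<notin> S' ==> f' g = 0" by (rule CcE) blast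
  then show "f + f' \<in> Cc" by (intro CcI[of "S \<union> S'"]) (use S in simp_all)
qed

lemma Lam_adjointable: "f \<in> Cc ==> \<Lambda> f \<in> \<L>"
  by (erule CcE) (simp add: Lam_eq_sum csubspace_sum[OF csubspace_adjointable] wop_adjointable)

lemma Lam_clinear: "clinear_on Cc \<Lambda>"
  unfolding clinear_on_def
proof (intro conjI ballI allI)
  fix f f' :: "'g => 'a" and c assume f: "f \<in> Cc"
  then obtain S where S: "finite S" "\<And>g. g \<notin> S ==> f g = 0" by (rule CcE) blast
  then show "\<Lambda> (c *\<^sub>C f) = c *\<^sub>C \<Lambda> f"
    by (simp add: Lam_eq_sum[of S] wop_scaleC scaleC_sum_right)
  assume "f' \<in> Cc"
  then obtain S' where S': "finite S'" "\<And>g. g \<notin> S' ==> f' g = 0" by (rule CcE) blast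
  have fin: "finite (S \<union> S')" using S S' by simp
  have "\<Lambda> (f + f') = (\<Sum>g\<in>S \<union> S'. wop ((f + f') g) g)" by (rule Lam_eq_sum[OF fin]) (use S S' in simp)
  also have "\<dots> = (\<Sum>g\<in>S \<union> S'. wop (f g) g) + (\<Sum>g\<in>S \<union> S'. wop (f' g) g)"
  proof -
    have "wop ((f + f') g) g = wop (f g) g + wop (f' g) g" for g using wop_add[of "f g" "f' g" g] by simp
    then show ?thesis by (simp only: sum.distrib)
  qed
  also have "(\<Sum>g\<in>S \<union> S'. wop (f g) g) = \<Lambda> f" by (rule Lam_eq_sum[OF fin, symmetric]) (use S in simp)
  also have "(\<Sum>g\<in>S \<union> S'. wop (f' g) g) = \<Lambda> f'" by (rule Lam_eq_sum[OF fin, symmetric]) (use S' in simp)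
  finally show "\<Lambda> (f + f') = \<Lambda> f + \<Lambda> f'" .
qed

lemmas Lam_diff = clinear_on_diff[OF Lam_clinear csubspace_Cc]

text \<open>The involution of the twisted convolution algebra.\<close>

definition Cc_star :: "('g => 'a) => 'g => 'a"
  where "Cc_star f g = (\<sigma> g (- g))\<^sup>\<star> * \<alpha> g ((f (- g))\<^sup>\<star>)"

lemma
  assumes "f \<in> Cc"
  shows Cc_star_Cc: "Cc_star f \<in> Cc" and adj_Lam: "adj \<alpha> (\<Lambda> f) = \<Lambda> (Cc_star f)"
proof -
  obtain S where S: "finite S" "\<And>g. g \<notin> S ==> f g = 0" using assms by (rule CcE) blast
  have S': "finite (uminus ` S)" "\<And>g. g \<notin> uminus ` S ==> Cc_star f g = 0"
    using S by (auto simp: Cc_star_def a.zero image_iff) (metis S(2) a.zero minus_minus mult_zero_right star_zero)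
  then show "Cc_star f \<in> Cc" by (rule CcI)
  have "adj \<alpha> (\<Lambda> f) = (\<Sum>g\<in>S. adj \<alpha> (wop (f g) g))"
    by (simp add: Lam_eq_sum[OF S] adj_sum wop_adjointable)
  also have "\<dots> = (\<Sum>g\<in>S. wop (Cc_star f (- g)) (- g))"
    by (simp add: adj_wop wop_star_coeff_def Cc_star_def)
  also have "\<dots> = (\<Sum>g\<in>uminus ` S. wop (Cc_star f g) g)"
    by (subst sum.reindex) auto
  also have "\<dots> = \<Lambda> (Cc_star f)" by (rule Lam_eq_sum[OF S', symmetric])
  finally show "adj \<alpha> (\<Lambda> f) = \<Lambda> (Cc_star f)" .
qed

text \<open>A vector of norm at most one from which \<open>\<Lambda> f\<close> recovers \<open>f\<close>.\<close>

definition vacuum :: "'g => 'a"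
  where "vacuum h = (if h = 0 then 1 else 0)"

lemma vacuum_hmod: "vacuum \<in> \<H>" and hnorm_vacuum_le: "hnorm \<alpha> vacuum \<le> 1"
proof -
  have v: "inv (\<alpha> g) ((vacuum g)\<^sup>\<star> * vacuum g) = (if g = 0 then 1 else 0)" for g
    by (simp add: vacuum_def ai.one ai.zero)
  have s: "((\<lambda>g::'g. if g = 0 then 1 else (0::'a)) has_sum 1) UNIV"
    by (rule has_sum_finite_neutralI[of "{0}"]) auto
  then show "vacuum \<in> \<H>" unfolding hmod_def by (auto simp: v summable_on_def)
  show "hnorm \<alpha> vacuum \<le> 1" using infsumI[OF s] norm_one_le by (simp add: hnorm_def hinner_def v)
qed

lemma Lam_vacuum: "f \<in> Cc ==> \<Lambda> f vacuum = f"
proof (erule CcE)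
  fix S assume S: "finite S" "\<And>g. g \<notin> S ==> f g = 0"
  show "\<Lambda> f vacuum = f"
  proof
    fix h
    have "\<Lambda> f vacuum h = (\<Sum>g\<in>S. shift (f g) g vacuum h)"
      by (simp add: Lam_eq_sum[OF S] sum_fun_apply wop_apply vacuum_hmod)
    also have "\<dots> = (\<Sum>g\<in>S. if g = h then f h else 0)"
    proof (rule sum.cong)
      fix g
      have "- g + h = 0 \<longleftrightarrow> g = h" by (metis add.right_inverse minus_minus neg_eq_iff_add_eq_0)
      then show "shift (f g) g vacuum h = (if g = h then f h else 0)"
        by (auto simp: shift_def vacuum_def a.one a.zero normalized_right)
    qed simp
    also have "\<dots> = f h" using S by auto
    finally show "\<Lambda> f vacuum h = f h" .
  qed
qed

lemma Lam_inj: "f \<in> Cc ==> f' \<in> Cc ==> \<Lambda> f = \<Lambda> f' ==> f = f'"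
  using Lam_vacuum by metis

text \<open>A value of \<open>f = \<Lambda> f vacuum\<close> is bounded by the norm of \<open>f\<close> in the Hilbert module.\<close>

lemma norm_le_op_norm_Lam:
  assumes f: "f \<in> Cc"
  shows "norm (f h) \<le> opnorm (\<Lambda> f)"
proof -
  have bo: "hm.bounded_op (\<Lambda> f)" by (intro adjointable_bounded_op Lam_adjointable f)
  have "f \<in> \<H>" using bo vacuum_hmod Lam_vacuum[OF f] by (metis hm.bounded_op_def)
  then have "norm (coord f h) \<le> hnorm \<alpha> f" unfolding hnorm_eq hmod_iff by (rule norm_le_l2_norm)
  also have "\<dots> \<le> opnorm (\<Lambda> f)"
    using hm.opn_bound_unit[OF bo vacuum_hmod hnorm_vacuum_le] by (simp add: Lam_vacuum[OF f])
  finally show ?thesis by (simp add: coord_def)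
qed

lemma Cstar_rE:
  assumes "F \<in> \<C>" "0 < e"
  obtains f where "f \<in> Cc" "opnorm (F - \<Lambda> f) < e"
  using assms unfolding Cstar_r_def by blast

lemma Cstar_rI:
  "F \<in> \<L> ==> (\<And>e. 0 < e ==> \<exists>f\<in>Cc. opnorm (F - \<Lambda> f) < e) ==> F \<in> \<C>"
  unfolding Cstar_r_def by blast

lemma Lam_Cstar_r: "f \<in> Cc ==> \<Lambda> f \<in> \<C>"
  by (rule Cstar_rI) (auto intro!: Lam_adjointable bexI[of _ f])

lemma Cstar_r_adjointable: "F \<in> \<C> ==> F \<in> \<L>"
  by (simp add: Cstar_r_def)

lemma Cstar_r_bounded: "F \<in> \<C> ==> hm.bounded_op F"
  by (simp add: adjointable_bounded_op Cstar_r_adjointable)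

lemma Lam_bounded: "f \<in> Cc ==> hm.bounded_op (\<Lambda> f)"
  by (simp add: adjointable_bounded_op Lam_adjointable)

sublocale crossed: operator_space \<alpha> \<sigma> "\<C>"
proof
  show "\<C> \<subseteq> \<L>" using Cstar_r_adjointable by blast
  show "csubspace \<C>"
    unfolding csubspace_def
  proof (intro conjI ballI allI)
    show "0 \<in> \<C>"
      using Lam_Cstar_r[OF csubspace_0[OF csubspace_Cc]] clinear_on_0[OF Lam_clinear csubspace_0[OF csubspace_Cc]] by simp
    fix F G c assume F: "F \<in> \<C>"
    show "c *\<^sub>C F \<in> \<C>"
    proof (rule Cstar_rI)
      show "c *\<^sub>C F \<in> \<L>" by (intro adjointable_scaleC Cstar_r_adjointable F)
      fix e :: real assume "0 < e"
      then have "0 < e / (cmod c + 1)" by (simp add: add_nonneg_pos)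
      then obtain f where f: "f \<in> Cc" "opnorm (F - \<Lambda> f) < e / (cmod c + 1)"
        using Cstar_rE[OF F] by metis
      have bo: "hm.bounded_op (F - \<Lambda> f)" by (intro hm.bounded_op_diff Cstar_r_bounded Lam_bounded F f)
      have "c *\<^sub>C F - \<Lambda> (c *\<^sub>C f) = c *\<^sub>C (F - \<Lambda> f)"
        by (simp add: clinear_on_scaleC[OF Lam_clinear f(1)] scaleC_diff_right)
      then have "opnorm (c *\<^sub>C F - \<Lambda> (c *\<^sub>C f)) = cmod c * opnorm (F - \<Lambda> f)"
        by (simp add: hm.opn_scaleC[OF bo])
      also have "\<dots> \<le> (cmod c + 1) * opnorm (F - \<Lambda> f)"
        by (intro mult_right_mono hm.opn_nonneg[OF bo]) simp
      also have "\<dots> < e"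
        using f(2) pos_less_divide_eq[of "cmod c + 1"] by (simp add: add_nonneg_pos mult.commute)
      finally show "\<exists>f\<in>Cc. opnorm (c *\<^sub>C F - \<Lambda> f) < e"
        using csubspace_scaleC[OF csubspace_Cc f(1)] by blast
    qed
    assume G: "G \<in> \<C>"
    show "F + G \<in> \<C>"
    proof (rule Cstar_rI)
      show "F + G \<in> \<L>" by (intro adjointable_add Cstar_r_adjointable F G)
      fix e :: real assume "0 < e"
      then have "0 < e / 2" by simp
      then obtain f f' where f: "f \<in> Cc" "opnorm (F - \<Lambda> f) < e / 2"
        and f': "f' \<in> Cc" "opnorm (G - \<Lambda> f') < e / 2"
        using Cstar_rE[OF F] Cstar_rE[OF G] by metis
      have bo: "hm.bounded_op (F - \<Lambda> f)" "hm.bounded_op (G - \<Lambda> f')"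
        by (intro hm.bounded_op_diff Cstar_r_bounded Lam_bounded F f G f')+
      have "F + G - \<Lambda> (f + f') = (F - \<Lambda> f) + (G - \<Lambda> f')"
        by (simp add: clinear_on_add[OF Lam_clinear f(1) f'(1)])
      then have "opnorm (F + G - \<Lambda> (f + f')) < e"
        using hm.opn_triangle[OF bo] f(2) f'(2) by (simp only:)
      then show "\<exists>f\<in>Cc. opnorm (F + G - \<Lambda> f) < e"
        using csubspace_add[OF csubspace_Cc f(1) f'(1)] by blast
    qed
  qed
  show "F \<in> \<C>" if F: "F \<in> \<L>" and X: "\<And>n. X n \<in> \<C>"
    and lim: "(\<lambda>n::nat. opnorm (X n - F)) \<longlonglongrightarrow> 0" for F X
  proof (rule Cstar_rI[OF F])
    fix e :: real assume "0 < e"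
    then have e: "0 < e / 2" by simp
    from order_tendstoD(2)[OF lim e] obtain n where n: "opnorm (X n - F) < e / 2"
      by (auto simp: eventually_sequentially)
    obtain f where f: "f \<in> Cc" "opnorm (X n - \<Lambda> f) < e / 2" using Cstar_rE[OF X e] by metis
    have bo: "hm.bounded_op F" "hm.bounded_op (X n)" "hm.bounded_op (\<Lambda> f)"
      by (intro adjointable_bounded_op F Cstar_r_bounded X Lam_bounded f)+
    have "opnorm (F - \<Lambda> f) < e"
      using hm.opn_triangle_diff[OF bo] hm.opn_diff_commute[OF bo(1,2)] n f(2) by simp
    then show "\<exists>f\<in>Cc. opnorm (F - \<Lambda> f) < e" using f(1) by blast
  qed
  show "adj \<alpha> F \<in> \<C>" if F: "F \<in> \<C>" for F
  proof (rule Cstar_rI)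
    show "adj \<alpha> F \<in> \<L>" by (intro adj_adjointable Cstar_r_adjointable F)
    fix e :: real assume "0 < e"
    then obtain f where f: "f \<in> Cc" "opnorm (F - \<Lambda> f) < e" using Cstar_rE[OF F] by metis
    have "adj \<alpha> F - \<Lambda> (Cc_star f) = adj \<alpha> (F - \<Lambda> f)"
      using adj_diff[OF Cstar_r_adjointable[OF F] Lam_adjointable[OF f(1)]] by (simp add: adj_Lam f(1))
    then have "opnorm (adj \<alpha> F - \<Lambda> (Cc_star f)) < e"
      using op_norm_adj[OF csubspace_diff[OF csubspace_adjointable Cstar_r_adjointable[OF F] Lam_adjointable[OF f(1)]]] f(2)
      by simp
    then show "\<exists>f\<in>Cc. opnorm (adj \<alpha> F - \<Lambda> f) < e" using Cc_star_Cc[OF f(1)] by blast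
  qed
qed

section \<open>Multipliers\<close>

text \<open>Both maps are continuous and agree on the dense subspace of all \<open>\<Lambda> f\<close>.\<close>

lemma multiplier_map_unique:
  assumes M: "is_multiplier_map \<alpha> \<sigma> T M" and M': "is_multiplier_map \<alpha> \<sigma> T M'"
  shows "M = M'"
proof (rule self_maps_eqI[of _ "\<C>"])
  show s: "M \<in> self_maps \<C>" "M' \<in> self_maps \<C>"
    using M M' by (auto simp: is_multiplier_map_def)
  obtain K K' where K: "\<And>x. x \<in> \<C> ==> opnorm (M x) \<le> K * opnorm x"
    and K': "\<And>x. x \<in> \<C> ==> opnorm (M' x) \<le> K' * opnorm x"
    using M M' unfolding is_multiplier_map_def by blast
  have lin: "clinear_on \<C> M" "clinear_on \<C> M'"
    using M M' by (auto simp: is_multiplier_map_def)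
  fix x assume x: "x \<in> \<C>"
  have MC: "M y \<in> \<C>" "M' y \<in> \<C>" if "y \<in> \<C>" for y
    using self_maps_closed[OF s(1) that] self_maps_closed[OF s(2) that] .
  have d: "M x - M' x \<in> \<L>" by (intro Cstar_r_adjointable crossed.B_diff MC x)
  have "opnorm (M x - M' x) \<le> 0 + e" if "0 < e" for e
  proof -
    let ?L = "\<bar>K\<bar> + \<bar>K'\<bar> + 1"
    have "0 < e / ?L" using that by (simp add: add_nonneg_pos)
    then obtain f where f: "f \<in> Cc" "opnorm (x - \<Lambda> f) < e / ?L" using Cstar_rE[OF x] by metis
    let ?y = "x - \<Lambda> f"
    have y: "?y \<in> \<C>" by (intro crossed.B_diff x Lam_Cstar_r f)
    have "M (\<Lambda> f) = M' (\<Lambda> f)" using M M' f(1) by (simp add: is_multiplier_map_def)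
    then have eq: "M x - M' x = M ?y - M' ?y"
      by (simp add: clinear_on_diff[OF lin(1) crossed.B_subspace x Lam_Cstar_r[OF f(1)]]
          clinear_on_diff[OF lin(2) crossed.B_subspace x Lam_Cstar_r[OF f(1)]])
    have "opnorm (M x - M' x) \<le> opnorm (M ?y) + opnorm (M' ?y)"
      unfolding eq
      using hm.opn_triangle_diff[of "M ?y" 0 "M' ?y"] hm.opn_diff_commute[of 0 "M' ?y"] MC[OF y]
        adjointable_bounded_op[OF adjointable_0] by (simp add: Cstar_r_bounded)
    also have "\<dots> \<le> ?L * opnorm ?y"
    proof -
      have n: "0 \<le> opnorm ?y" by (intro op_norm_nonneg Cstar_r_adjointable y)
      have "opnorm (M ?y) \<le> \<bar>K\<bar> * opnorm ?y"
        by (rule order.trans[OF K[OF y] mult_right_mono[OF _ n]]) simp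
      moreover have "opnorm (M' ?y) \<le> \<bar>K'\<bar> * opnorm ?y"
        by (rule order.trans[OF K'[OF y] mult_right_mono[OF _ n]]) simp
      ultimately show ?thesis using n by (simp add: distrib_right)
    qed
    also have "\<dots> \<le> e" using f(2) by (simp add: field_simps add_nonneg_pos)
    finally show ?thesis by simp
  qed
  then have "opnorm (M x - M' x) \<le> 0" by (rule field_le_epsilon)
  then have "M x - M' x = 0" using op_norm_eq_0D[OF d] op_norm_nonneg[OF d] by simp
  then show "M x = M' x" by simp
qed

abbreviation cb where "cb \<equiv> cb_maps \<alpha> \<C>"

lemma cb_multiplier_map:
  assumes \<Phi>: "\<Phi> \<in> cb" and f: "\<And>f. f \<in> Cc ==> \<Phi> (\<Lambda> f) = \<Lambda> (act T f)"
  shows "is_multiplier_map \<alpha> \<sigma> T \<Phi>"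
  unfolding is_multiplier_map_def
  using crossed.cb_maps_self_maps[OF \<Phi>] crossed.cb_maps_linear[OF \<Phi>] crossed.op_norm_le_cb_norm[OF \<Phi>] f by blast

lemma
  assumes T: "T \<in> L_Sigma" and \<Phi>: "\<Phi> \<in> cb" 
    and f: "\<And>f. f \<in> Cc ==> \<Phi> (\<Lambda> f) = \<Lambda> (act T f)"
  shows M0A_I: "T \<in> MA" and multiplier_map_eqI: "\<M> T = \<Phi>"
proof -
  have M: "is_multiplier_map \<alpha> \<sigma> T \<Phi>" by (rule cb_multiplier_map[OF \<Phi> f])
  show eq: "\<M> T = \<Phi>"
    unfolding multiplier_map_def by (rule the_equality, rule M, rule multiplier_map_unique[OF _ M])
  show "T \<in> MA" unfolding M0A_def is_multiplier_def using T M \<Phi> by (auto simp: eq cb_maps_def)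
qed

lemma
  assumes "T \<in> MA"
  shows M0A_L_Sigma: "T \<in> L_Sigma" and multiplier_map_cb: "\<M> T \<in> cb"
    and multiplier_map_Lam: "f \<in> Cc ==> \<M> T (\<Lambda> f) = \<Lambda> (act T f)"
proof -
  obtain M where T: "T \<in> L_Sigma" and M: "is_multiplier_map \<alpha> \<sigma> T M"
    and c: "completely_bounded \<alpha> \<C> (\<M> T)"
    using assms unfolding M0A_def is_multiplier_def by blast
  have eq: "\<M> T = M"
    unfolding multiplier_map_def by (rule the_equality, rule M, rule multiplier_map_unique[OF _ M])
  show "T \<in> L_Sigma" by (rule T)
  show "\<M> T \<in> cb" using M c by (auto simp: eq cb_maps_def is_multiplier_map_def)
  show "\<M> T (\<Lambda> f) = \<Lambda> (act T f)" if "f \<in> Cc"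
    using M that by (simp add: eq is_multiplier_map_def)
qed

lemma L_Sigma_zero: "T \<in> L_Sigma ==> T g 0 = 0"
  by (auto simp: L_Sigma_def intro: clinear_on_0)

lemma act_Cc: "T \<in> L_Sigma ==> f \<in> Cc ==> act T f \<in> Cc"
  by (erule CcE) (auto intro!: CcI simp: act_def L_Sigma_zero)

definition single :: "'g => 'a => 'g => 'a"
  where "single g a = (\<lambda>h. if h = g then a else 0)"

lemma single_Cc: "single g a \<in> Cc"
  by (rule CcI[of "{g}"]) (auto simp: single_def)

lemma act_single: "T \<in> L_Sigma ==> act T (single g a) = single g (T g a)"
  by (auto simp: act_def single_def L_Sigma_zero)

lemma multiplier_map_inj: "inj_on \<M> MA"
proof (rule inj_onI, rule ext, rule ext)
  fix T T' g a assume T: "T \<in> MA" and T': "T' \<in> MA"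
    and eq: "\<M> T = \<M> T'"
  have "\<Lambda> (single g (T g a)) = \<Lambda> (single g (T' g a))"
    using multiplier_map_Lam[OF T single_Cc, of g a] multiplier_map_Lam[OF T' single_Cc, of g a] eq
    by (simp add: act_single M0A_L_Sigma T T')
  then have "single g (T g a) = single g (T' g a)" by (rule Lam_inj[OF single_Cc single_Cc])
  then show "T g a = T' g a" by (metis single_def)
qed

lemma L_Sigma_algebra: "unital_algebra (L_Sigma :: ('g => 'a => 'a) set) L_mult L_unit"
  by standard
    (auto simp: csubspace_def L_Sigma_def clinear_on_def L_mult_def L_unit_def fun_eq_iff scaleC_add_right
      scaleC_scaleC mult.commute algebra_simps)

lemma
  assumes T: "T \<in> MA" and T': "T' \<in> MA"
  shows M0A_add: "T + T' \<in> MA"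
    and multiplier_map_add: "\<M> (T + T') = \<M> T + \<M> T'"
    and M0A_mult: "L_mult T T' \<in> MA"
    and multiplier_map_mult: "\<M> (L_mult T T') = \<M> T \<circ> \<M> T'"
    and M0A_scaleC: "c *\<^sub>C T \<in> MA"
    and multiplier_map_scaleC: "\<M> (c *\<^sub>C T) = c *\<^sub>C \<M> T"
proof -
  interpret L: unital_algebra "L_Sigma :: ('g => 'a => 'a) set" L_mult L_unit by (rule L_Sigma_algebra)
  note L = M0A_L_Sigma[OF T] M0A_L_Sigma[OF T']
  note add = csubspace_add[OF L.subspace L] crossed.cb_maps_add[OF multiplier_map_cb[OF T] multiplier_map_cb[OF T']]
  have "(\<M> T + \<M> T') (\<Lambda> f) = \<Lambda> (act (T + T') f)" if f: "f \<in> Cc" for f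
  proof -
    have "act (T + T') f = act T f + act T' f" by (simp add: act_def fun_eq_iff)
    then show ?thesis
      by (simp add: multiplier_map_Lam[OF T f] multiplier_map_Lam[OF T' f] clinear_on_add[OF Lam_clinear] act_Cc L f)
  qed
  then show "T + T' \<in> MA" "\<M> (T + T') = \<M> T + \<M> T'"
    using M0A_I[OF add] multiplier_map_eqI[OF add] by blast+
  note mult = L.mult_closed[OF L] crossed.cb_maps_comp[OF multiplier_map_cb[OF T] multiplier_map_cb[OF T']]
  have "(\<M> T \<circ> \<M> T') (\<Lambda> f) = \<Lambda> (act (L_mult T T') f)" if f: "f \<in> Cc" for f
    using multiplier_map_Lam[OF T act_Cc[OF L(2) f]] multiplier_map_Lam[OF T' f] by (simp add: act_def L_mult_def)
  then show "L_mult T T' \<in> MA" "\<M> (L_mult T T') = \<M> T \<circ> \<M> T'"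
    using M0A_I[OF mult] multiplier_map_eqI[OF mult] by blast+
  note scale = csubspace_scaleC[OF L.subspace L(1), of c] crossed.cb_maps_scaleC[OF multiplier_map_cb[OF T], of c]
  have "(c *\<^sub>C \<M> T) (\<Lambda> f) = \<Lambda> (act (c *\<^sub>C T) f)" if f: "f \<in> Cc" for f
  proof -
    have "act (c *\<^sub>C T) f = c *\<^sub>C act T f" by (simp add: act_def fun_eq_iff)
    then show ?thesis
      by (simp add: multiplier_map_Lam[OF T f] clinear_on_scaleC[OF Lam_clinear] act_Cc L f)
  qed
  then show "c *\<^sub>C T \<in> MA" "\<M> (c *\<^sub>C T) = c *\<^sub>C \<M> T"
    using M0A_I[OF scale] multiplier_map_eqI[OF scale] by blast+
qed

lemma
  shows M0A_unit: "L_unit \<in> MA" and multiplier_map_unit: "\<M> L_unit = restr \<C> id"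
proof -
  interpret L: unital_algebra "L_Sigma :: ('g => 'a => 'a) set" L_mult L_unit by (rule L_Sigma_algebra)
  have *: "restr \<C> id (\<Lambda> f) = \<Lambda> (act L_unit f)" if "f \<in> Cc" for f
    using Lam_Cstar_r[OF that] by (simp add: restr_def act_def L_unit_def)
  show "L_unit \<in> MA" "\<M> L_unit = restr \<C> id"
    using M0A_I[OF L.unit_closed crossed.cb_maps_id *] multiplier_map_eqI[OF L.unit_closed crossed.cb_maps_id *] by blast+
qed

lemma
  shows M0A_zero: "0 \<in> MA" and multiplier_map_zero: "\<M> 0 = 0"
  using M0A_scaleC[OF M0A_unit M0A_unit, of 0] multiplier_map_scaleC[OF M0A_unit M0A_unit, of 0] by simp_all

lemma csubspace_M0A: "csubspace MA"
  by (simp add: csubspace_def M0A_zero M0A_add M0A_scaleC)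

lemma multiplier_map_clinear: "clinear_on MA \<M>"
  by (simp add: clinear_on_def multiplier_map_add multiplier_map_scaleC)

lemma multiplier_map_diff: 
  "T \<in> MA ==> T' \<in> MA ==> \<M> (T - T') = \<M> T - \<M> T'"
  by (rule clinear_on_diff[OF multiplier_map_clinear csubspace_M0A])

theorem M0A_subalgebra: "unital_subalgebra MA L_Sigma L_mult L_unit"
proof -
  interpret L: unital_algebra "L_Sigma :: ('g => 'a => 'a) set" L_mult L_unit by (rule L_Sigma_algebra)
  show ?thesis
    by standard (use M0A_L_Sigma csubspace_M0A M0A_mult M0A_unit in auto)
qed

text \<open>Apply \<open>\<M> T\<close> to \<open>\<Lambda> (single g a)\<close>; the value of \<open>T g\<close> at \<open>a\<close> is a value of the resulting
  function.\<close>

lemma norm_single_le: 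
  assumes T: "T \<in> MA"
  shows "norm (T g a) \<le> Mnorm T * opnorm (\<Lambda> (single g a))"
proof -
  have eq: "\<Lambda> (single g (T g a)) = \<M> T (\<Lambda> (single g a))"
    by (simp add: multiplier_map_Lam[OF T single_Cc] act_single M0A_L_Sigma[OF T])
  have "norm (T g a) = norm (single g (T g a) g)" by (simp add: single_def)
  also have "\<dots> \<le> opnorm (\<Lambda> (single g (T g a)))" by (rule norm_le_op_norm_Lam[OF single_Cc])
  also have "\<dots> \<le> Mnorm T * opnorm (\<Lambda> (single g a))"
    unfolding multiplier_cb_norm_def eq
    by (rule crossed.op_norm_le_cb_norm[OF multiplier_map_cb[OF T] Lam_Cstar_r[OF single_Cc]])
  finally show ?thesis .
qed

text \<open>By \<open>norm_single_le\<close> the values \<open>X n g a\<close> form Cauchy sequences; their limits define \<open>T\<close>.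
  Both \<open>\<Phi> (\<Lambda> f)\<close> and \<open>\<Lambda> (act T f)\<close> are limits of \<open>\<Lambda> (act (X n) f)\<close>, the latter because the
  support of \<open>f\<close> is finite.\<close>

theorem M0A_complete:
  assumes X: "\<And>n. X n \<in> MA"
    and C: "\<And>e. 0 < e ==> \<exists>N. \<forall>m\<ge>N. \<forall>n\<ge>N. Mnorm (X m - X n) < e"
  shows "\<exists>T\<in>MA. (\<lambda>n. Mnorm (X n - T)) \<longlonglongrightarrow> 0"
proof -
  let ?M = "\<lambda>n. \<M> (X n)"
  have C': "\<exists>N. \<forall>m\<ge>N. \<forall>n\<ge>N. cb_norm \<alpha> \<C> (?M m - ?M n) < e" if "0 < e" for e
    using C[OF that] by (simp add: multiplier_cb_norm_def multiplier_map_diff X)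
  obtain \<Phi> where \<Phi>: "\<Phi> \<in> cb" "(\<lambda>n. cb_norm \<alpha> \<C> (?M n - \<Phi>)) \<longlonglongrightarrow> 0"
    "\<And>x. x \<in> \<C> ==> (\<lambda>n. opnorm (?M n x - \<Phi> x)) \<longlonglongrightarrow> 0"
    using crossed.cb_maps_complete[of ?M, OF multiplier_map_cb[OF X] C'] by blast
  have "convergent (\<lambda>n. X n g a)" for g a
  proof (rule Cauchy_convergent, rule metric_CauchyI)
    fix e :: real assume "0 < e"
    let ?s = "opnorm (\<Lambda> (single g a))"
    have s: "0 \<le> ?s" by (intro op_norm_nonneg Lam_adjointable single_Cc)
    then have "0 < e / (?s + 1)" using \<open>0 < e\<close> by simp
    from C[OF this] obtain N where N: "\<And>m n. m \<ge> N ==> n \<ge> N ==> Mnorm (X m - X n) < e / (?s + 1)"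
      by blast
    have "dist (X m g a) (X n g a) < e" if "m \<ge> N" "n \<ge> N" for m n
    proof -
      have d: "X m - X n \<in> MA" by (intro csubspace_diff[OF csubspace_M0A] X)
      have "dist (X m g a) (X n g a) = norm ((X m - X n) g a)" by (simp add: dist_norm)
      also have "\<dots> \<le> Mnorm (X m - X n) * ?s" by (rule norm_single_le[OF d])
      also have "\<dots> \<le> Mnorm (X m - X n) * (?s + 1)"
        unfolding multiplier_cb_norm_def by (intro mult_left_mono crossed.cb_norm_nonneg multiplier_map_cb d) simp
      also have "\<dots> < e" using N[OF that] s by (simp add: field_simps)
      finally show ?thesis .
    qed
    then show "\<exists>N. \<forall>m\<ge>N. \<forall>n\<ge>N. dist (X m g a) (X n g a) < e" by blast
  qed
  then obtain T where T: "\<And>g a. (\<lambda>n. X n g a) \<longlonglongrightarrow> T g a" unfolding convergent_def by metis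
  have XL: "clinear_on UNIV (X n g)" for n g using M0A_L_Sigma[OF X] by (simp add: L_Sigma_def)
  have TL: "T \<in> L_Sigma"
    unfolding L_Sigma_def clinear_on_def
  proof (intro CollectI allI conjI ballI)
    fix g a b c
    have "(\<lambda>n. X n g (a + b)) \<longlonglongrightarrow> T g a + T g b"
      unfolding clinear_on_add[OF XL UNIV_I UNIV_I] by (intro tendsto_intros T)
    then show "T g (a + b) = T g a + T g b" using LIMSEQ_unique T by blast
    have "(\<lambda>n. (c *\<^sub>C 1) * X n g a) \<longlonglongrightarrow> (c *\<^sub>C 1) * T g a" by (intro tendsto_intros T)
    then have "(\<lambda>n. X n g (c *\<^sub>C a)) \<longlonglongrightarrow> c *\<^sub>C T g a"
      by (simp add: clinear_on_scaleC[OF XL UNIV_I] mult_scaleC_left)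
    then show "T g (c *\<^sub>C a) = c *\<^sub>C T g a" using LIMSEQ_unique T by blast
  qed
  have "\<Phi> (\<Lambda> f) = \<Lambda> (act T f)" if f: "f \<in> Cc" for f
  proof -
    obtain S where S: "finite S" "\<And>g. g \<notin> S ==> f g = 0" using f by (rule CcE) blast
    have lim: "(\<lambda>n. opnorm (?M n (\<Lambda> f) - \<Lambda> (act T f))) \<longlonglongrightarrow> 0"
    proof (rule Lim_null_comparison, intro always_eventually allI)
      fix n
      have Xn: "X n \<in> L_Sigma" by (rule M0A_L_Sigma[OF X])
      have S': "act (X n) f g - act T f g = 0" if "g \<notin> S" for g
        using S(2)[OF that] by (simp add: act_def L_Sigma_zero Xn TL)
      have "?M n (\<Lambda> f) - \<Lambda> (act T f) = \<Lambda> (act (X n) f - act T f)"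
        by (simp add: multiplier_map_Lam[OF X f] Lam_diff act_Cc Xn TL f)
      also have "\<dots> = (\<Sum>g\<in>S. wop (X n g (f g) - T g (f g)) g)"
        using Lam_eq_sum[OF S(1), of "act (X n) f - act T f"] S' by (simp add: act_def)
      finally have eq: "?M n (\<Lambda> f) - \<Lambda> (act T f) = (\<Sum>g\<in>S. wop (X n g (f g) - T g (f g)) g)" .
      have "opnorm (?M n (\<Lambda> f) - \<Lambda> (act T f)) \<le> (\<Sum>g\<in>S. opnorm (wop (X n g (f g) - T g (f g)) g))"
        unfolding eq by (rule op_norm_sum_le) (rule wop_adjointable)
      also have "\<dots> \<le> (\<Sum>g\<in>S. norm (X n g (f g) - T g (f g)))"
        by (rule sum_mono) (rule op_norm_wop_le)
      finally show "norm (opnorm (?M n (\<Lambda> f) - \<Lambda> (act T f))) \<le> (\<Sum>g\<in>S. norm (X n g (f g) - T g (f g)))"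
        using op_norm_nonneg[OF csubspace_diff[OF csubspace_adjointable Lam_adjointable Lam_adjointable], OF act_Cc[OF Xn f] act_Cc[OF TL f]]
        by (simp add: multiplier_map_Lam[OF X f])
    next
      have "(\<lambda>n. \<Sum>g\<in>S. norm (X n g (f g) - T g (f g))) \<longlonglongrightarrow> (\<Sum>g\<in>S. norm (T g (f g) - T g (f g)))"
        by (intro tendsto_intros T)
      then show "(\<lambda>n. \<Sum>g\<in>S. norm (X n g (f g) - T g (f g))) \<longlonglongrightarrow> 0" by simp
    qed
    show ?thesis
    proof (rule crossed.op_norm_limit_unique[of "\<lambda>n. ?M n (\<Lambda> f)"])
      show "?M n (\<Lambda> f) \<in> \<L>" for n
        by (intro Cstar_r_adjointable crossed.cb_maps_range[OF multiplier_map_cb[OF X]])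
      show "\<Phi> (\<Lambda> f) \<in> \<L>"
        by (intro Cstar_r_adjointable crossed.cb_maps_range[OF \<Phi>(1)])
      show "\<Lambda> (act T f) \<in> \<L>" by (intro Lam_adjointable act_Cc TL f)
    qed (rule \<Phi>(3)[OF Lam_Cstar_r[OF f]], rule lim)
  qed
  note T' = M0A_I[OF TL \<Phi>(1) this] multiplier_map_eqI[OF TL \<Phi>(1) this]
  show ?thesis
    by (rule bexI[OF _ T'(1)]) (use \<Phi>(2) in \<open>simp add: multiplier_cb_norm_def multiplier_map_diff X T'\<close>)
qed

theorem M0A_banach_algebra: "unital_banach_algebra MA L_mult L_unit Mnorm"
proof -
  interpret L: unital_subalgebra "MA" L_Sigma L_mult L_unit by (rule M0A_subalgebra)
  interpret D: unital_banach_algebra "cb_maps \<alpha> \<C>" "(\<circ>)" "restr \<C> id" "cb_norm \<alpha> \<C>"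
    by (rule crossed.cb_maps_banach_algebra)
  note nd = multiplier_cb_norm_def and cb = multiplier_map_cb
  have eq0: "T = 0" if "T \<in> MA" "\<M> T = 0" for T
    using inj_onD[OF multiplier_map_inj _ that(1) M0A_zero] that(2) by (simp add: multiplier_map_zero)
  show ?thesis
  proof
    fix x y z :: "'g => 'a => 'a" and c
    show "csubspace MA" by (rule csubspace_M0A)
    show "L_mult (L_mult x y) z = L_mult x (L_mult y z)" by (simp add: L_mult_def)
    show "clinear_on MA (\<lambda>x. L_mult x y)" by (simp add: clinear_on_def L_mult_def fun_eq_iff)
    show "L_unit \<in> MA" by (rule M0A_unit)
    show "L_mult L_unit x = x" "L_mult x L_unit = x" by (simp_all add: L_mult_def L_unit_def)
    show "Mnorm L_unit = 1" if "(L_unit :: 'g => 'a => 'a) \<noteq> 0"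
      unfolding nd multiplier_map_unit
      by (rule D.nrm_unit) (use eq0[OF M0A_unit] that in \<open>auto simp: multiplier_map_unit\<close>)
    assume x: "x \<in> MA"
    show "clinear_on MA (L_mult x)"
      using L.mult_linear_right[OF M0A_L_Sigma[OF x]] M0A_L_Sigma unfolding clinear_on_def by blast
    show "0 \<le> Mnorm x" unfolding nd by (rule D.nrm_nonneg[OF cb[OF x]])
    show "(Mnorm x = 0) = (x = 0)"
      unfolding nd D.nrm_eq_0[OF cb[OF x]] using eq0[OF x] multiplier_map_zero by blast
    show "Mnorm (c *\<^sub>C x) = cmod c * Mnorm x"
      unfolding nd multiplier_map_scaleC[OF x x] by (rule D.nrm_scaleC[OF cb[OF x]])
    assume y: "y \<in> MA"
    show "L_mult x y \<in> MA" by (rule M0A_mult[OF x y])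
    show "Mnorm (x + y) \<le> Mnorm x + Mnorm y"
      unfolding nd multiplier_map_add[OF x y] by (rule D.nrm_triangle[OF cb[OF x] cb[OF y]])
    show "Mnorm (L_mult x y) \<le> Mnorm x * Mnorm y"
      unfolding nd multiplier_map_mult[OF x y] by (rule D.nrm_mult[OF cb[OF x] cb[OF y]])
  next
    fix X :: "nat => 'g => 'a => 'a"
    assume X: "range X \<subseteq> MA" and C: "\<forall>\<epsilon>>0. \<exists>N. \<forall>m\<ge>N. \<forall>n\<ge>N. Mnorm (X m - X n) < \<epsilon>"
    have "X n \<in> MA" for n using X by blast
    then show "\<exists>x\<in>MA. (\<lambda>n. Mnorm (X n - x)) \<longlonglongrightarrow> 0"
      by (rule M0A_complete) (use C in auto)
  qed
qed

text \<open>The argument of \<open>T\<close> in the definition of the conjugate is the value of \<open>Cc_star f\<close> at the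
  inverse of \<open>g\<close>.\<close>

lemma Cc_star_conj: "act (Mconj T) f = Cc_star (act T (Cc_star f))"
proof
  fix g
  have "\<alpha> g ((\<sigma> (- g) g)\<^sup>\<star> * \<alpha> (- g) ((f g)\<^sup>\<star>)) = (f g)\<^sup>\<star> * (\<sigma> g (- g))\<^sup>\<star>"
    by (simp add: a.mult a.star alpha_sigma_neg alpha_alpha_neg mult.assoc sigma_cancel star_mult star_star)
  then have "inv (\<alpha> g) ((f g)\<^sup>\<star> * (\<sigma> g (- g))\<^sup>\<star>) = (\<sigma> (- g) g)\<^sup>\<star> * \<alpha> (- g) ((f g)\<^sup>\<star>)"
    by (metis a.inv_left)
  then show "act (Mconj T) f g = Cc_star (act T (Cc_star f)) g"
    by (simp add: act_def multiplier_conj_def Cc_star_def a.star)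
qed

lemma
  assumes T: "T \<in> MA"
  shows M0A_conj: "Mconj T \<in> MA"
    and multiplier_map_conj: 
      "\<M> (Mconj T) = cb_conj \<alpha> \<C> (\<M> T)"
proof -
  have lin: "clinear_on UNIV (T g)" for g using M0A_L_Sigma[OF T] by (simp add: L_Sigma_def)
  have L: "Mconj T \<in> L_Sigma"
    by (simp add: L_Sigma_def clinear_on_def multiplier_conj_def star_add star_scaleC distrib_right distrib_left
        mult_scaleC_left mult_scaleC_right ai.add ai.scaleC a.add a.scaleC
        clinear_on_add[OF lin] clinear_on_scaleC[OF lin])
  have *: "cb_conj \<alpha> \<C> (\<M> T) (\<Lambda> f) = \<Lambda> (act (Mconj T) f)"
    if f: "f \<in> Cc" for f
    using Lam_Cstar_r[OF f] 
    by (simp add: cb_conj_def restr_def adj_Lam[OF f] multiplier_map_Lam[OF T] Cc_star_Cc f 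
        adj_Lam act_Cc[OF M0A_L_Sigma[OF T]] Cc_star_conj)
  note c = crossed.cb_conj_cb_maps[OF multiplier_map_cb[OF T]]
  show "Mconj T \<in> MA" by (rule M0A_I[OF L c *])
  show "\<M> (Mconj T) = cb_conj \<alpha> \<C> (\<M> T)"
    by (rule multiplier_map_eqI[OF L c *])
qed

theorem M0A_isometric_conjugation: 
  "isometric_conjugation MA L_mult Mnorm Mconj"
proof -
  interpret D: isometric_conjugation "cb_maps \<alpha> \<C>" "(\<circ>)" "cb_norm \<alpha> \<C>" "cb_conj \<alpha> \<C>"
    by (rule crossed.cb_conj_isometric_conjugation)
  note inj = inj_onD[OF multiplier_map_inj] and cb = multiplier_map_cb and mc = multiplier_map_conj
  show ?thesis
  proof
    fix x y :: "'g => 'a => 'a" and c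
    assume x: "x \<in> MA"
    show cx: "Mconj x \<in> MA" by (rule M0A_conj[OF x])
    show "Mconj (c *\<^sub>C x) = cnj c *\<^sub>C Mconj x"
      by (rule inj) (simp_all add: M0A_scaleC[OF _ x] M0A_conj x mc multiplier_map_scaleC[OF _ x] D.conj_scaleC cb)
    show "Mconj (Mconj x) = x"
      by (rule inj) (simp_all add: M0A_conj x mc D.conj_conj cb)
    show "Mnorm (Mconj x) = Mnorm x"
      by (simp add: multiplier_cb_norm_def mc x D.conj_isometric cb)
    assume y: "y \<in> MA"
    show "Mconj (x + y) = Mconj x + Mconj y"
      by (rule inj) (simp_all add: M0A_add M0A_conj x y mc multiplier_map_add D.conj_add cb)
    show "Mconj (L_mult x y) = L_mult (Mconj x) (Mconj y)"
      by (rule inj) (simp_all add: M0A_mult M0A_conj x y mc multiplier_map_mult D.conj_mult cb)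
  qed
qed

theorem multiplier_map_hom:
  "unital_banach_algebra_hom MA L_mult L_unit Mnorm
     (cb_maps \<alpha> \<C>) (\<circ>) (restr \<C> id) (cb_norm \<alpha> \<C>) \<M>"
proof -
  interpret M: unital_banach_algebra "MA" L_mult L_unit "Mnorm"
    by (rule M0A_banach_algebra)
  interpret D: unital_banach_algebra "cb_maps \<alpha> \<C>" "(\<circ>)" "restr \<C> id" "cb_norm \<alpha> \<C>"
    by (rule crossed.cb_maps_banach_algebra)
  show ?thesis
    by standard
      (auto simp: multiplier_map_cb multiplier_map_clinear multiplier_map_mult multiplier_map_unit
        multiplier_cb_norm_def intro: exI[of _ 1])
qed

end

theorem proposition4p42:
  fixes \<alpha> :: "'g::group_add \<Rightarrow> 'a::cstar_algebra \<Rightarrow> 'a" and \<sigma> :: "'g \<Rightarrow> 'g \<Rightarrow> 'a"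
  assumes "twisted_system \<alpha> \<sigma>"
  shows "unital_subalgebra (M0A \<alpha> \<sigma>) L_Sigma L_mult L_unit
    \<and> unital_banach_algebra (M0A \<alpha> \<sigma>) L_mult L_unit (multiplier_cb_norm \<alpha> \<sigma>)
    \<and> isometric_conjugation (M0A \<alpha> \<sigma>) L_mult (multiplier_cb_norm \<alpha> \<sigma>) (multiplier_conj \<alpha> \<sigma>)
    \<and> unital_banach_algebra_hom
        (M0A \<alpha> \<sigma>) L_mult L_unit (multiplier_cb_norm \<alpha> \<sigma>)
        (cb_maps \<alpha> (Cstar_r \<alpha> \<sigma>)) (\<circ>) (restr (Cstar_r \<alpha> \<sigma>) id) (cb_norm \<alpha> (Cstar_r \<alpha> \<sigma>))
        (multiplier_map \<alpha> \<sigma>)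
    \<and> inj_on (multiplier_map \<alpha> \<sigma>) (M0A \<alpha> \<sigma>)
    \<and> (\<forall>T\<in>M0A \<alpha> \<sigma>. multiplier_map \<alpha> \<sigma> (multiplier_conj \<alpha> \<sigma> T)
          = cb_conj \<alpha> (Cstar_r \<alpha> \<sigma>) (multiplier_map \<alpha> \<sigma> T))"
proof -
  interpret twisted_system \<alpha> \<sigma> by (rule assms)
  show ?thesis
    using M0A_subalgebra M0A_banach_algebra M0A_isometric_conjugation multiplier_map_hom multiplier_map_inj
      multiplier_map_conj by blast
qed

end
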